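(* Let $\ell=n-j-k\ge 1$ and let $f$ be a radial function on $G(n,j)$, $f(\tau)\equiv f_0(|\tau|)$. If $f$ satisfies the conditions $$\int_0^a |f_0(t)|\,t^{n-j-1}\,dt<\infty\quad\text{and}\quad \int_a^\infty |f_0(t)|\,t^{k-1}\,dt<\infty$$ for some $a>0$, then $$(\mathcal R_{j,k}f)(\zeta)=(I_{j,k}f_0)(|\zeta|),$$ where $$(I_{j,k}f_0)(s)=\frac{c_1}{s^{n-k-2}}\int_0^s (s^2-r^2)^{j/2-1}r^{\ell-1}\,dr\int_r^\infty f_0(t)\,(t^2-r^2)^{k/2-1}\,t\,dt=\frac{\tilde c_1}{s^{n-k-2}}\,\bigl(I^{j/2}_{+,2}\,r^{\ell-2}\,I^{k/2}_{-,2}f_0\bigr)(s),$$ $$c_1=\frac{\sigma_{j-1}\sigma_{k-1}\sigma_{\ell-1}}{\sigma_{n-k-1}},\qquad \tilde c_1=\frac{\pi^{k/2}\,\Gamma((n-k)/2)}{\Gamma(\ell/2)}.$$ Moreover, $$\int_\alpha^\beta |(I_{j,k}f_0)(s)|\,ds<\infty\quad\text{for all } 0<\alpha<\beta<\infty.$$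
   Context: Throughout, $n,j,k$ are integers with $j>0$, $k>0$, $j+k<n$, and all integrals are understood in the Lebesgue sense. $G_{n,j}$ is the Grassmannian of $j$-dimensional linear subspaces of $\mathbb R^n$; $G(n,j)$ is the manifold of $j$-dimensional unoriented affine planes in $\mathbb R^n$. Every $\tau\in G(n,j)$ is written as $\tau=\tau(\xi,u)=\xi+u$ with $\xi\in G_{n,j}$, $u\in\xi^\perp$; $|\tau|=|u|$ is the Euclidean distance from $\tau$ to the origin. Similarly, $\zeta\in G(n,k)$ is written as $\zeta=\zeta(\eta,v)=\eta+v$ with $\eta\in G_{n,k}$, $v\in\eta^\perp$, and $|\zeta|=|v|$. A function $f$ on $G(n,j)$ is radial if there is a function $f_0$ on $(0,\infty)$ such that $f(\tau)=f_0(|\tau|)$. The mixed $j$-plane to $k$-plane Radon transform $\mathcal R_{j,k}$ takes a function $f$ on $G(n,j)$ to the function on $G(n,k)$ given by $$(\mathcal R_{j,k}f)(\zeta)\equiv(\mathcal R_{j,k}f)(\eta,v)=\int_{G_j(\eta^\perp)}d\xi\int_\eta f(\xi+u+v)\,du,$$ where $G_j(\eta^\perp)$ is the Grassmannian of $j$-dimensional linear subspaces of $\eta^\perp$, $d\xi$ is its canonical (invariant) probability measure, and $du$ is the Euclidean (Lebesgue) measure on $\eta$. The Erdélyi–Kober fractional integrals on $(0,\infty)$ are, for $\alpha>0$, $$(I^\alpha_{+,2}g)(t)=\frac{2}{\Gamma(\alpha)}\int_0^t (t^2-r^2)^{\alpha-1}g(r)\,r\,dr,\qquad (I^\alpha_{-,2}g)(t)=\frac{2}{\Gamma(\alpha)}\int_t^\infty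 (r^2-t^2)^{\alpha-1}g(r)\,r\,dr.$$ In the composition $I^{j/2}_{+,2}\,r^{\ell-2}\,I^{k/2}_{-,2}$, the factor $r^{\ell-2}$ denotes multiplication by that power of the variable. $\sigma_{m-1}=2\pi^{m/2}/\Gamma(m/2)$ is the area of the unit sphere in $\mathbb R^m$. *)

theory Defs
  imports "HOL-Analysis.Analysis" "HOL-Probability.Probability"
begin

definition grassmannian :: "(real ^ 'n) set \<Rightarrow> nat \<Rightarrow> (real ^ 'n) set set" where
  "grassmannian V j = {\<xi>. subspace \<xi> \<and> \<xi> \<subseteq> V \<and> dim \<xi> = j}"

definition affine_grassmannian :: "nat \<Rightarrow> (real ^ 'n) set set" where
  "affine_grassmannian j = {\<tau>. affine \<tau> \<and> aff_dim \<tau> = int j}"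

definition plane_dist :: "(real ^ 'n) set \<Rightarrow> real" where
  "plane_dist \<tau> = infdist 0 \<tau>"

text \<open>For \<open>\<zeta> = \<eta> + v\<close> with \<open>\<eta>\<close> a linear subspace and \<open>v\<close> orthogonal to \<open>\<eta>\<close>,
  the following two functions recover \<open>\<eta>\<close> and \<open>v\<close>.\<close>

definition direction :: "(real ^ 'n) set \<Rightarrow> (real ^ 'n) set" where
  "direction \<zeta> = {x - y | x y. x \<in> \<zeta> \<and> y \<in> \<zeta>}"

definition foot :: "(real ^ 'n) set \<Rightarrow> real ^ 'n" where
  "foot \<zeta> = closest_point \<zeta> 0"

text \<open>The product Lebesgue measure in the coordinates of an orthonormal basis, completed. It is
  carried by the subspace and does not depend on the basis chosen. For \<open>\<eta> = UNIV\<close> it is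
  \<open>lebesgue\<close>.\<close>

definition subspace_lebesgue :: "(real ^ 'n) set \<Rightarrow> (real ^ 'n) measure" where
  "subspace_lebesgue \<eta> =
    (let B = (SOME B. pairwise orthogonal B \<and> (\<forall>b\<in>B. norm b = 1) \<and> span B = \<eta>)
     in completion (distr (\<Pi>\<^sub>M b\<in>B. lborel) borel (\<lambda>x. \<Sum>b\<in>B. x b *\<^sub>R b)))"

text \<open>The Borel structure of the Grassmannian, seen as a manifold of orthogonal projection
  matrices.\<close>

definition grassmannian_borel :: "(real ^ 'n) set \<Rightarrow> nat \<Rightarrow> (real ^ 'n) set measure" where
  "grassmannian_borel V j =
    vimage_algebra (grassmannian V j) (\<lambda>\<xi>. matrix (closest_point \<xi>)) borel"

text \<open>Every linear isometry of \<open>V\<close> is the restriction of an orthogonal transformation of the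
  ambient space that preserves \<open>V\<close>.\<close>

definition invariant_prob :: "(real ^ 'n) set \<Rightarrow> nat \<Rightarrow> (real ^ 'n) set measure \<Rightarrow> bool" where
  "invariant_prob V j M \<longleftrightarrow>
    sets M = sets (grassmannian_borel V j) \<and> prob_space M \<and>
    (\<forall>T. orthogonal_transformation T \<and> T ` V = V \<longrightarrow> distr M M ((`) T) = M)"

text \<open>For \<open>V\<close> a subspace with \<open>j \<le> dim V\<close> there is exactly one such measure.\<close>

definition grassmannian_measure :: "(real ^ 'n) set \<Rightarrow> nat \<Rightarrow> (real ^ 'n) set measure" where
  "grassmannian_measure V j = (SOME M. invariant_prob V j M)"

text \<open>\<open>mixed_radon j f\<close> is \<open>\<R>\<^sub>j\<^sub>,\<^sub>k f\<close>, where \<open>k\<close> is the dimension of the plane \<open>\<zeta>\<close>. The Bochner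
  integral is total, with value 0 for functions that are not integrable, so convergence of
  the integrals is a separate predicate.\<close>

definition mixed_radon_inner ::
    "((real ^ 'n) set \<Rightarrow> real) \<Rightarrow> (real ^ 'n) set \<Rightarrow> (real ^ 'n) set \<Rightarrow> real ^ 'n \<Rightarrow> real" where
  "mixed_radon_inner f \<zeta> \<xi> u = f ((\<lambda>x. x + u + foot \<zeta>) ` \<xi>)"

definition mixed_radon :: "nat \<Rightarrow> ((real ^ 'n) set \<Rightarrow> real) \<Rightarrow> (real ^ 'n) set \<Rightarrow> real" where
  "mixed_radon j f \<zeta> =
    (LINT \<xi> | grassmannian_measure (orthogonal_comp (direction \<zeta>)) j.
      LINT u | subspace_lebesgue (direction \<zeta>). mixed_radon_inner f \<zeta> \<xi> u)"

definition mixed_radon_converges ::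
    "nat \<Rightarrow> ((real ^ 'n) set \<Rightarrow> real) \<Rightarrow> (real ^ 'n) set \<Rightarrow> bool" where
  "mixed_radon_converges j f \<zeta> \<longleftrightarrow>
    (AE \<xi> in grassmannian_measure (orthogonal_comp (direction \<zeta>)) j.
      integrable (subspace_lebesgue (direction \<zeta>)) (mixed_radon_inner f \<zeta> \<xi>)) \<and>
    integrable (grassmannian_measure (orthogonal_comp (direction \<zeta>)) j)
      (\<lambda>\<xi>. LINT u | subspace_lebesgue (direction \<zeta>). mixed_radon_inner f \<zeta> \<xi> u)"

definition EK_plus :: "real \<Rightarrow> (real \<Rightarrow> real) \<Rightarrow> real \<Rightarrow> real" where
  "EK_plus \<alpha> g t =
    2 / Gamma \<alpha> * (LINT r:{0<..<t}|lebesgue. (t^2 - r^2) powr (\<alpha> - 1) * g r * r)"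

definition EK_minus :: "real \<Rightarrow> (real \<Rightarrow> real) \<Rightarrow> real \<Rightarrow> real" where
  "EK_minus \<alpha> g t =
    2 / Gamma \<alpha> * (LINT r:{t<..}|lebesgue. (r^2 - t^2) powr (\<alpha> - 1) * g r * r)"

text \<open>\<open>sphere_area d\<close> is the area of the \<open>d\<close>-dimensional unit sphere in \<open>(d+1)\<close>-space.\<close>

definition sphere_area :: "nat \<Rightarrow> real" where
  "sphere_area d = 2 * pi powr (real (d + 1) / 2) / Gamma (real (d + 1) / 2)"

definition c1 :: "nat \<Rightarrow> nat \<Rightarrow> nat \<Rightarrow> real" where
  "c1 n j k =
    sphere_area (j - 1) * sphere_area (k - 1) * sphere_area (n - j - k - 1) / sphere_area (n - k - 1)"

definition c1_tilde :: "nat \<Rightarrow> nat \<Rightarrow> nat \<Rightarrow> real" where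
  "c1_tilde n j k =
    pi powr (real k / 2) * Gamma (real (n - k) / 2) / Gamma (real (n - j - k) / 2)"

definition I_inner :: "nat \<Rightarrow> (real \<Rightarrow> real) \<Rightarrow> real \<Rightarrow> real \<Rightarrow> real" where
  "I_inner k f0 r t = f0 t * (t^2 - r^2) powr (real k / 2 - 1) * t"

definition I_outer :: "nat \<Rightarrow> nat \<Rightarrow> nat \<Rightarrow> (real \<Rightarrow> real) \<Rightarrow> real \<Rightarrow> real \<Rightarrow> real" where
  "I_outer n j k f0 s r =
    (s^2 - r^2) powr (real j / 2 - 1) * r ^ (n - j - k - 1) *
    (LINT t:{r<..}|lebesgue. I_inner k f0 r t)"

definition I_jk :: "nat \<Rightarrow> nat \<Rightarrow> nat \<Rightarrow> (real \<Rightarrow> real) \<Rightarrow> real \<Rightarrow> real" where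
  "I_jk n j k f0 s =
    c1 n j k / s ^ (n - k - 2) * (LINT r:{0<..<s}|lebesgue. I_outer n j k f0 s r)"

definition I_jk_converges :: "nat \<Rightarrow> nat \<Rightarrow> nat \<Rightarrow> (real \<Rightarrow> real) \<Rightarrow> real \<Rightarrow> bool" where
  "I_jk_converges n j k f0 s \<longleftrightarrow>
    (AE r in lebesgue. r \<in> {0<..<s} \<longrightarrow> set_integrable lebesgue {r<..} (I_inner k f0 r)) \<and>
    set_integrable lebesgue {0<..<s} (I_outer n j k f0 s)"

end

theory Submission
  imports Defs
begin

text \<open>
  Let \<open>\<zeta> = \<eta> + v\<close> with \<open>v \<noteq> 0\<close> orthogonal to \<open>\<eta>\<close>, let \<open>V\<close> be the orthogonal complement of \<open>\<eta>\<close>, and let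
  \<open>d\<close> be the distance from \<open>v\<close> to the \<open>j\<close>-dimensional subspace \<open>\<xi>\<close> of \<open>V\<close>. The plane \<open>\<xi> + u + v\<close> has
  distance \<open>sqrt (\<bar>u\<bar>\<^sup>2 + d\<^sup>2)\<close> from the origin, so polar coordinates in \<open>\<eta>\<close> turn the inner integral into a
  fractional integral of \<open>f0\<close> evaluated at \<open>d\<close>. Under any invariant probability measure, the distribution
  of \<open>d\<close> depends only on \<open>\<bar>v\<bar> = s\<close>. Averaging over \<open>v\<close> in the unit ball of \<open>V\<close> and splitting
  \<open>V = \<xi> + \<xi>\<^sup>\<bottom>\<close> for each fixed \<open>\<xi>\<close> gives its density, a multiple of
  \<open>(s\<^sup>2 - r\<^sup>2)\<^bsup>j/2 - 1\<^esup> r\<^bsup>l - 1\<^esup>\<close> on \<open>0 < r < s\<close>. No uniqueness of the invariant measure is needed,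
  but its existence is. Local integrability follows from Tonelli's theorem: with respect to \<open>\<bar>f0 t\<bar> dt\<close> the
  remaining kernel is at most a constant times \<open>min t \<beta> ^ l * t ^ (k - 1)\<close>.
\<close>

section \<open>Lebesgue measure on a subspace\<close>

text \<open>Two of the notions rest on a choice: \<open>grassmannian_measure\<close> is some
  invariant measure, \<open>subspace_lebesgue\<close> uses some orthonormal basis. All that is known
  of the first is its invariance. For the second, independence of the basis has to be proved,
  because the averaging argument needs a different basis for each \<xi>, one adapted to it. The
  profile \<open>f0\<close> comes only with Lebesgue integrability, whereas Fubini and pushforwards
  are applied to Borel functions. It is exchanged for a Borel \<open>g\<close> that agrees with it
  almost everywhere. This is legitimate inside the transform because \<open>u\<close> \<mapsto>
  sqrt(|u|^2 + d^2) pulls null sets back to null sets. A divergent Bochner integral has the value 0,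
  so an equality of values says nothing about convergence. The transform and \<open>I_jk\<close> are
  therefore compared through equalities of measures, pushforward against density, which carry value
  and integrability together. Convergence itself comes out for almost every \<open>s\<close> only,
  from finiteness of an integral over \<open>s\<close>.\<close>

definition onb :: "'a::euclidean_space set \<Rightarrow> 'a set \<Rightarrow> bool" where
  "onb B V \<longleftrightarrow> pairwise orthogonal B \<and> (\<forall>b\<in>B. norm b = 1) \<and> span B = V"

text \<open>The Borel measure whose completion is \<open>subspace_lebesgue\<close>, kept apart so
  that product measures and Fubini apply to it directly.\<close>

definition span_lborel :: "'a::euclidean_space set \<Rightarrow> 'a measure" where
  "span_lborel B = distr (\<Pi>\<^sub>M b\<in>B. lborel) borel (\<lambda>x. \<Sum>b\<in>B. x b *\<^sub>R b)"

lemma onb_independent: "onb B V \<Longrightarrow> independent B"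
  unfolding onb_def by (metis norm_zero pairwise_orthogonal_independent zero_neq_one)

lemma onb_finite: "onb B V \<Longrightarrow> finite B"
  using onb_independent independent_imp_finite by blast

lemma onb_card: "onb B V \<Longrightarrow> card B = dim V"
  using onb_independent[of B V] dim_span_eq_card_independent[of B] by (simp add: onb_def)

lemma onb_subspace: "onb B V \<Longrightarrow> subspace V"
  unfolding onb_def by (metis subspace_span)

lemma onb_in: "onb B V \<Longrightarrow> b \<in> B \<Longrightarrow> b \<in> V"
  unfolding onb_def by (metis span_base)

lemma onb_exists: "subspace V \<Longrightarrow> \<exists>B. onb B V"
  unfolding onb_def by (metis orthonormal_basis_subspace)

lemma onb_inner: "onb B V \<Longrightarrow> b \<in> B \<Longrightarrow> c \<in> B \<Longrightarrow> b \<bullet> c = (if b = c then 1 else 0)"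
  unfolding onb_def pairwise_def orthogonal_def by (auto simp: norm_eq_1)

lemma onb_inner_sum:
  assumes "onb B V" "S \<subseteq> B" "c \<in> B"
  shows "(\<Sum>b\<in>S. x b *\<^sub>R b) \<bullet> c = (if c \<in> S then x c else 0)"
proof -
  have "finite S" using assms onb_finite finite_subset by blast
  have "(\<Sum>b\<in>S. x b *\<^sub>R b) \<bullet> c = (\<Sum>b\<in>S. if b = c then x c else 0)"
    unfolding inner_sum_left using assms
    by (intro sum.cong) (auto simp: onb_inner[OF assms(1)] subset_iff)
  then show ?thesis using \<open>finite S\<close> by simp
qed

lemma onb_norm_sum:
  assumes "onb B V" "S \<subseteq> B"
  shows "norm (\<Sum>b\<in>S. x b *\<^sub>R b) = sqrt (\<Sum>b\<in>S. (x b)\<^sup>2)"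
proof -
  have "(\<Sum>b\<in>S. x b *\<^sub>R b) \<bullet> (\<Sum>b\<in>S. x b *\<^sub>R b) = (\<Sum>c\<in>S. x c * x c)"
    unfolding inner_sum_right inner_scaleR_right 
    by (intro sum.cong refl) (use assms(2) in \<open>auto simp: onb_inner_sum[OF assms]\<close>)
  then show ?thesis by (simp add: norm_eq_sqrt_inner power2_eq_square)
qed

lemma onb_expand:
  assumes "onb B V" "v \<in> V"
  shows "(\<Sum>b\<in>B. (v \<bullet> b) *\<^sub>R b) = v"
proof -
  have "v \<in> span B" using assms by (simp add: onb_def)
  then obtain u where u: "v = (\<Sum>b\<in>B. u b *\<^sub>R b)"
    unfolding span_finite[OF onb_finite[OF assms(1)]] by auto
  show ?thesis
    unfolding u by (intro sum.cong refl) (simp add: onb_inner_sum[OF assms(1)])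
qed

lemma measurable_span_lborel_sum:
  fixes B :: "'a::euclidean_space set"
  shows "S \<subseteq> B \<Longrightarrow> (\<lambda>x. \<Sum>b\<in>S. x b *\<^sub>R b) \<in> borel_measurable (\<Pi>\<^sub>M b\<in>B. (lborel :: real measure))"
  by (intro borel_measurable_sum borel_measurable_scaleR borel_measurable_const) (auto simp: subset_iff)

lemma sets_span_lborel [simp, measurable_cong]: "sets (span_lborel B) = sets borel"
  and space_span_lborel [simp]: "space (span_lborel B) = UNIV"
  by (simp_all add: span_lborel_def)

lemma nn_integral_span_lborel:
  assumes [measurable]: "f \<in> borel_measurable borel"
  shows "(\<integral>\<^sup>+x. f x \<partial>span_lborel B) = (\<integral>\<^sup>+x. f (\<Sum>b\<in>B. x b *\<^sub>R b) \<partial>(\<Pi>\<^sub>M b\<in>B. lborel))"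
  unfolding span_lborel_def by (subst nn_integral_distr) (auto intro: measurable_span_lborel_sum)

section \<open>Translation invariance and uniqueness of the measure on a subspace\<close>

lemma emeasure_lborel_translate:
  fixes c :: "'a::euclidean_space"
  assumes [measurable]: "X \<in> sets borel"
  shows "emeasure lborel ((\<lambda>y. c + y) -` X) = emeasure lborel X"
proof -
  have "emeasure lborel X = emeasure (distr lborel borel ((+) c)) X" by (simp add: lborel_distr_plus)
  also have "\<dots> = emeasure lborel ((\<lambda>y. c + y) -` X)" by (subst emeasure_distr) auto
  finally show ?thesis by simp
qed

lemma PiM_lborel_translate:
  fixes c :: "'i \<Rightarrow> real"
  assumes "finite B"
  shows "distr (\<Pi>\<^sub>M b\<in>B. lborel) (\<Pi>\<^sub>M b\<in>B. lborel) (\<lambda>x. \<lambda>b\<in>B. c b + x b) = (\<Pi>\<^sub>M b\<in>B. lborel)"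
proof (rule product_sigma_finite.PiM_eqI)
  show "product_sigma_finite (\<lambda>b. lborel :: real measure)" by standard
  interpret product_sigma_finite "\<lambda>b. lborel :: real measure" by standard
  fix A :: "'i \<Rightarrow> real set" assume A: "\<And>i. i \<in> B \<Longrightarrow> A i \<in> sets lborel"
  have "(\<lambda>x. \<lambda>b\<in>B. c b + x b) -` Pi\<^sub>E B A \<inter> space (\<Pi>\<^sub>M b\<in>B. lborel) = Pi\<^sub>E B (\<lambda>b. (\<lambda>y. c b + y) -` A b)"
    by (auto simp: space_PiM PiE_iff)
  moreover have "(\<lambda>y. c b + y) -` A b \<in> sets lborel" if "b \<in> B" for b
    using measurable_sets[of "\<lambda>y. c b + y" lborel lborel "A b"] A[OF that] by simp
  ultimately show "emeasure (distr (\<Pi>\<^sub>M b\<in>B. lborel) (\<Pi>\<^sub>M b\<in>B. lborel) (\<lambda>x. \<lambda>b\<in>B. c b + x b)) (Pi\<^sub>E B A)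
      = (\<Prod>i\<in>B. emeasure lborel (A i))"
    using A assms
    by (subst emeasure_distr) (auto simp: emeasure_PiM emeasure_lborel_translate intro!: prod.cong sets_PiM_I_finite)
qed (use assms in auto)

lemma span_lborel_translate:
  assumes "onb B V" "v \<in> V"
  shows "distr (span_lborel B) borel ((+) v) = span_lborel B"
proof -
  note [measurable] = measurable_span_lborel_sum[OF subset_refl, of B]
  have fin: "finite B" using assms onb_finite by blast
  have "distr (span_lborel B) borel ((+) v) = distr (\<Pi>\<^sub>M b\<in>B. lborel) borel (\<lambda>x. v + (\<Sum>b\<in>B. x b *\<^sub>R b))"
    unfolding span_lborel_def by (subst distr_distr) (auto simp: comp_def)
  also have "\<dots> = distr (\<Pi>\<^sub>M b\<in>B. lborel) borel ((\<lambda>x. \<Sum>b\<in>B. x b *\<^sub>R b) \<circ> (\<lambda>x. \<lambda>b\<in>B. (v \<bullet> b) + x b))"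
  proof -
    have "v + (\<Sum>b\<in>B. x b *\<^sub>R b) = (\<Sum>b\<in>B. (v \<bullet> b + x b) *\<^sub>R b)" for x
      using onb_expand[OF assms] by (simp add: scaleR_add_left sum.distrib)
    then show ?thesis by (simp add: comp_def)
  qed
  also have "\<dots> = span_lborel B"
    unfolding span_lborel_def
    by (subst distr_distr[symmetric, where N="\<Pi>\<^sub>M b\<in>B. lborel"]) (auto simp: PiM_lborel_translate[OF fin])
  finally show ?thesis .
qed

lemma AE_span_lborel_in:
  assumes "onb B V"
  shows "AE x in span_lborel B. x \<in> V"
proof -
  have "V = span B" using assms by (simp add: onb_def)
  then have "(\<Sum>b\<in>B. x b *\<^sub>R b) \<in> V" for x by (simp add: span_base span_scale span_sum)
  moreover have "{x. x \<in> V} \<in> sets borel"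
    using closed_subspace[OF onb_subspace[OF assms]] by simp
  ultimately show ?thesis
    unfolding span_lborel_def by (subst AE_distr_iff) (auto intro: measurable_span_lborel_sum)
qed

text \<open>Orthonormal coordinates preserve the norm, so this is the volume of a coordinate ball.
  The unit ball serves as the normalization in the uniqueness argument.\<close>

lemma emeasure_span_lborel_cball:
  assumes "onb B V" "r > 0"
  shows "emeasure (span_lborel B) (cball 0 r) = ennreal (unit_ball_vol (card B) * r ^ card B)"
proof -
  have "emeasure (span_lborel B) (cball 0 r) = emeasure (\<Pi>\<^sub>M b\<in>B. lborel)
     ({f. sqrt (\<Sum>i\<in>B. (f i)\<^sup>2) \<le> r} \<inter> space (Pi\<^sub>M B (\<lambda>_. lborel)))"
    unfolding span_lborel_def
    by (subst emeasure_distr) (auto intro: measurable_span_lborel_sum simp: vimage_def onb_norm_sum[OF assms(1)])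
  then show ?thesis using emeasure_cball_aux[OF onb_finite[OF assms(1)] assms(2)] by simp
qed

lemma cball_Suc_cover: "\<Union> (range (\<lambda>i. cball (0::'a::real_normed_vector) (real (Suc i)))) = UNIV"
proof -
  have "\<exists>i. norm x \<le> real (Suc i)" for x :: 'a
    using real_arch_simple[of "norm x"] by (metis le_SucI of_nat_le_iff order_trans order_refl)
  then show ?thesis by (auto simp: dist_norm)
qed

lemma sigma_finite_span_lborel:
  assumes "onb B V" shows "sigma_finite_measure (span_lborel B)"
proof
  have "\<Union> (range (\<lambda>i. cball (0::'a) (real (Suc i)))) = UNIV"
    using cball_Suc_cover by blast
  then show "\<exists>A. countable A \<and> A \<subseteq> sets (span_lborel B) \<and> \<Union> A = space (span_lborel B) \<and> (\<forall>a\<in>A. emeasure (span_lborel B) a \<noteq> \<infinity>)"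
    by (intro exI[of _ "range (\<lambda>i. cball (0::'a) (real (Suc i)))"])
      (auto simp: emeasure_span_lborel_cball[OF assms] simp del: of_nat_Suc)
qed

text \<open>Fubini for \<open>(x, y) \<mapsto> 1\<^sub>A x * 1\<^sub>B (y - x)\<close>, \<open>B\<close> the unit ball, determines each
  translation-invariant measure by its value on \<open>B\<close>.\<close>

lemma translation_invariant_unique:
  fixes M N :: "'a::euclidean_space measure"
  assumes M [measurable_cong]: "sets M = sets borel" and N [measurable_cong]: "sets N = sets borel"
    and sfM: "sigma_finite_measure M" and sfN: "sigma_finite_measure N"
    and inM: "AE x in M. x \<in> V" and inN: "AE x in N. x \<in> V"
    and tM: "\<And>v. v \<in> V \<Longrightarrow> distr M borel ((+) v) = M"
    and tN: "\<And>v. v \<in> V \<Longrightarrow> distr N borel ((+) v) = N"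
    and V: "subspace V"
    and A [measurable]: "A \<in> sets borel"
  shows "emeasure M A * emeasure N (cball 0 1) = emeasure N A * emeasure M (cball 0 1)"
proof -
  let ?B = "cball (0::'a) 1"
  interpret M: sigma_finite_measure M by fact
  interpret N: sigma_finite_measure N by fact
  interpret pair_sigma_finite M N ..
  have [measurable]: "?B \<in> sets borel" by (simp add: borel_closed)
  have trM: "(\<integral>\<^sup>+x. f x \<partial>M) = (\<integral>\<^sup>+x. f (v + x) \<partial>M)"
    if [measurable]: "f \<in> borel_measurable borel" and v: "v \<in> V" for f :: "'a \<Rightarrow> ennreal" and v
    by (subst tM[OF v, symmetric], subst nn_integral_distr) (auto simp: measurable_cong_sets[OF M refl])
  have trN: "(\<integral>\<^sup>+x. f x \<partial>N) = (\<integral>\<^sup>+x. f (v + x) \<partial>N)"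
    if [measurable]: "f \<in> borel_measurable borel" and v: "v \<in> V" for f :: "'a \<Rightarrow> ennreal" and v
    by (subst tN[OF v, symmetric], subst nn_integral_distr) (auto simp: measurable_cong_sets[OF N refl])
  have "emeasure M A * emeasure N ?B = (\<integral>\<^sup>+x. indicator A x * (\<integral>\<^sup>+y. indicator ?B y \<partial>N) \<partial>M)"
    by (simp add: nn_integral_multc M N)
  also have "\<dots> = (\<integral>\<^sup>+x. indicator A x * (\<integral>\<^sup>+y. indicator ?B (- x + y) \<partial>N) \<partial>M)"
    using inM
  proof (intro nn_integral_cong_AE, eventually_elim)
    case (elim x)
    have "(\<integral>\<^sup>+y. indicator ?B y \<partial>N) = (\<integral>\<^sup>+y. indicator ?B (- x + y) \<partial>N)"
      by (rule trN[OF _ subspace_neg[OF V elim(2)]]) measurable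
    then show ?case by (simp only:)
  qed
  also have "\<dots> = (\<integral>\<^sup>+x. (\<integral>\<^sup>+y. indicator A x * indicator ?B (- x + y) \<partial>N) \<partial>M)"
    by (intro nn_integral_cong nn_integral_cmult[symmetric]) (auto simp: measurable_cong_sets[OF N refl])
  also have "\<dots> = (\<integral>\<^sup>+y. (\<integral>\<^sup>+x. indicator A x * indicator ?B (- x + y) \<partial>M) \<partial>N)"
    by (rule Fubini'[symmetric]) (simp add: split_beta')
  \<comment> \<open>The shift of \<open>x\<close> by \<open>y\<close> removes \<open>y\<close> from
    the ball factor; after the next exchange the shift of \<open>y\<close> by \<open>x\<close>
    isolates the measure of \<open>A\<close>. Invariance is available only under shifts from
    \<open>V\<close>, hence the almost-everywhere restriction to \<open>V\<close> each time.\<close>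
  also have "\<dots> = (\<integral>\<^sup>+y. (\<integral>\<^sup>+x. indicator A (y + x) * indicator ?B (- x) \<partial>M) \<partial>N)"
    using inN
  proof (intro nn_integral_cong_AE, eventually_elim)
    case (elim y)
    then show ?case using trM[of "\<lambda>x. indicator A x * indicator ?B (- x + y)" y] by simp
  qed
  also have "\<dots> = (\<integral>\<^sup>+x. (\<integral>\<^sup>+y. indicator A (y + x) * indicator ?B (- x) \<partial>N) \<partial>M)"
    by (rule Fubini') (simp add: split_beta')
  also have "\<dots> = (\<integral>\<^sup>+x. (\<integral>\<^sup>+y. indicator A (y + x) \<partial>N) * indicator ?B (- x) \<partial>M)"
    by (intro nn_integral_cong nn_integral_multc) (auto simp: measurable_cong_sets[OF N refl])
  also have "\<dots> = (\<integral>\<^sup>+x. emeasure N A * indicator ?B x \<partial>M)"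
    using inM
  proof (intro nn_integral_cong_AE, eventually_elim)
    case (elim x)
    then have "(\<integral>\<^sup>+y. indicator A (y + x) \<partial>N) = (\<integral>\<^sup>+y. indicator A y \<partial>N)"
      using trN[of "indicator A" x] by (simp add: add.commute)
    also have "\<dots> = emeasure N A" by (rule nn_integral_indicator) (simp add: N)
    finally show ?case by (auto split: split_indicator)
  qed
  also have "\<dots> = emeasure N A * emeasure M ?B"
    by (simp add: nn_integral_cmult M)
  finally show ?thesis .
qed

text \<open>The mass of the unit ball is positive, finite and common to both measures, so it cancels
  in \<open>translation_invariant_unique\<close>. Independence of the basis and orthogonal
  invariance follow from this without any determinant.\<close>

lemma span_lborel_unique:
  assumes B: "onb B V"
    and M: "sets M = sets borel" "sigma_finite_measure M" "AE x in M. x \<in> V"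
    and tM: "\<And>v. v \<in> V \<Longrightarrow> distr M borel ((+) v) = M"
    and ball: "emeasure M (cball 0 1) = unit_ball_vol (card B)"
  shows "M = span_lborel B"
proof (rule measure_eqI)
  fix A assume "A \<in> sets M"
  then have A: "A \<in> sets borel" using M by simp
  have pos: "unit_ball_vol (card B) \<noteq> 0"
    using unit_ball_vol_pos[of "card B"] by (metis less_irrefl of_nat_0_le_iff)
  have "emeasure M A * ennreal (unit_ball_vol (card B)) = emeasure (span_lborel B) A * ennreal (unit_ball_vol (card B))"
    using translation_invariant_unique[OF M(1) sets_span_lborel M(2) sigma_finite_span_lborel[OF B] M(3) AE_span_lborel_in[OF B] tM
      span_lborel_translate[OF B] onb_subspace[OF B] A] emeasure_span_lborel_cball[OF B, of 1] ball by simp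
  then show "emeasure M A = emeasure (span_lborel B) A"
    using pos ennreal_mult_cancel_left[of "ennreal (unit_ball_vol (card B))" "emeasure M A" "emeasure (span_lborel B) A"]
    by (simp add: mult.commute)
qed (simp add: M)

lemma span_lborel_basis_independent:
  assumes B: "onb B V" and C: "onb C V"
  shows "span_lborel C = span_lborel B"
  using assms onb_card[OF B] onb_card[OF C] emeasure_span_lborel_cball[OF C, of 1]
  by (intro span_lborel_unique[OF B]) (auto simp: sigma_finite_span_lborel AE_span_lborel_in span_lborel_translate)

lemma span_lborel_orthogonal_invariant:
  assumes B: "onb B V" and T: "orthogonal_transformation T" and TV: "T ` V = V"
  shows "distr (span_lborel B) borel T = span_lborel B"
proof (rule span_lborel_unique[OF B])
  have lin: "linear T" using T orthogonal_transformation_linear by blast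
  then have [measurable]: "T \<in> borel_measurable borel"
    by (simp add: borel_measurable_continuous_onI linear_continuous_on linear_linear)
  interpret E: sigma_finite_measure "span_lborel B" using sigma_finite_span_lborel[OF B] .
  have inj: "inj T" and surj: "surj T"
    using T orthogonal_transformation_inj orthogonal_transformation_surj by blast+
  have pre: "T -` cball 0 r = cball 0 r" for r
    using T by (auto simp: orthogonal_transformation_norm)
  show "sets (distr (span_lborel B) borel T) = sets borel" by simp
  show ball: "emeasure (distr (span_lborel B) borel T) (cball 0 1) = unit_ball_vol (card B)"
    using emeasure_span_lborel_cball[OF B, of 1] by (subst emeasure_distr) (auto simp: pre)
  show "AE x in distr (span_lborel B) borel T. x \<in> V"
  proof -
    have "AE x in span_lborel B. T x \<in> V" using AE_span_lborel_in[OF B] by eventually_elim (use TV in blast)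
    then show ?thesis
      using closed_subspace[OF onb_subspace[OF B]] by (subst AE_distr_iff) auto
  qed
  show "sigma_finite_measure (distr (span_lborel B) borel T)"
  proof
    have "\<Union> (range (\<lambda>i. cball (0::'a) (real (Suc i)))) = UNIV"
      using cball_Suc_cover by blast
    then show "\<exists>A. countable A \<and> A \<subseteq> sets (distr (span_lborel B) borel T) \<and> \<Union> A = space (distr (span_lborel B) borel T)
        \<and> (\<forall>a\<in>A. emeasure (distr (span_lborel B) borel T) a \<noteq> \<infinity>)"
      by (intro exI[of _ "range (\<lambda>i. cball (0::'a) (real (Suc i)))"])
        (auto simp: emeasure_distr pre emeasure_span_lborel_cball[OF B] simp del: of_nat_Suc)
  qed
  show "distr (distr (span_lborel B) borel T) borel ((+) v) = distr (span_lborel B) borel T" if v: "v \<in> V" for v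
  proof -
    \<comment> \<open>Translation by \<open>T w\<close> after \<open>T\<close> is \<open>T\<close>
      after translation by \<open>w\<close>, and each \<open>v\<close> in \<open>V\<close> has the
      form \<open>T w\<close> with \<open>w\<close> in \<open>V\<close>.\<close>
    obtain w where w: "w \<in> V" "v = T w" using v TV by blast
    have "distr (distr (span_lborel B) borel T) borel ((+) v) = distr (span_lborel B) borel (T \<circ> (+) w)"
      by (subst distr_distr) (auto simp: comp_def w linear_add[OF lin])
    also have "\<dots> = distr (distr (span_lborel B) borel ((+) w)) borel T"
      by (subst distr_distr) auto
    finally show ?thesis by (simp add: span_lborel_translate[OF B w(1)])
  qed
qed

section \<open>Radial integrals\<close>

text \<open>Differentiability is asked for only inside the interval and continuity of
  \<open>F\<close> up to its ends. This admits the integrable endpoint singularities that occur when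
  an exponent such as k/2 - 1 is negative.\<close>

lemma nn_integral_FTC_Ioo:
  fixes f F :: "real \<Rightarrow> real"
  assumes ab: "a < b"
    and F: "\<And>x. a < x \<Longrightarrow> x < b \<Longrightarrow> (F has_real_derivative f x) (at x)"
    and f: "\<And>x. a < x \<Longrightarrow> x < b \<Longrightarrow> isCont f x"
    and nonneg: "\<And>x. a < x \<Longrightarrow> x < b \<Longrightarrow> 0 \<le> f x"
    and cont: "continuous_on {a..b} F"
  shows "(\<integral>\<^sup>+x. ennreal (f x) * indicator {a<..<b} x \<partial>lborel) = ennreal (F b - F a)"
proof -
  have A: "((F \<circ> real_of_ereal) \<longlongrightarrow> F a) (at_right (ereal a))"
    and B: "((F \<circ> real_of_ereal) \<longlongrightarrow> F b) (at_left (ereal b))"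
    unfolding ereal_tendsto_simps
    using cont ab continuous_on_Icc_at_rightD continuous_on_Icc_at_leftD by blast+
  have I: "set_integrable lborel (einterval a b) f" "(LBINT x=a..b. f x) = F b - F a"
    using interval_integral_FTC_nonneg[of "ereal a" "ereal b" F f, OF _ _ _ _ A B] ab F f nonneg by auto
  have e: "einterval (ereal a) (ereal b) = {a<..<b}" by (auto simp: einterval_def)
  have int: "integrable lborel (\<lambda>x. indicator {a<..<b} x * f x)"
    using I(1) by (simp add: e set_integrable_def)
  have "(\<integral>\<^sup>+x. ennreal (f x) * indicator {a<..<b} x \<partial>lborel)
      = (\<integral>\<^sup>+x. ennreal (indicator {a<..<b} x * f x) \<partial>lborel)"
    by (intro nn_integral_cong) (auto split: split_indicator)
  also have "\<dots> = ennreal (\<integral>x. indicator {a<..<b} x * f x \<partial>lborel)"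
    using int nonneg by (intro nn_integral_eq_integral) (auto split: split_indicator)
  also have "(\<integral>x. indicator {a<..<b} x * f x \<partial>lborel) = F b - F a"
    using I(2) ab by (simp add: interval_lebesgue_integral_def e set_lebesgue_integral_def)
  finally show ?thesis .
qed

lemma sphere_area_pos: "sphere_area d > 0"
  by (simp add: sphere_area_def)

lemma unit_ball_vol_sphere_area:
  assumes "0 < k" shows "unit_ball_vol (real k) = sphere_area (k - 1) / real k"
proof -
  have "real k / 2 \<notin> \<int>\<^sub>\<le>\<^sub>0" using assms nonpos_Ints_nonpos[of "real k / 2"] by auto
  then have G: "Gamma (real k / 2 + 1) = real k / 2 * Gamma (real k / 2)" by (rule Gamma_plus1)
  show ?thesis
    unfolding unit_ball_vol_def sphere_area_def G using assms by (simp add: mult_ac)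
qed

lemma emeasure_PiM_shifted_norm_le:
  fixes B :: "'i set"
  assumes B: "finite B" "B \<noteq> {}" and d: "0 \<le> d"
  defines "k \<equiv> card B"
  shows "emeasure (\<Pi>\<^sub>M b\<in>B. (lborel::real measure))
     {x \<in> space (\<Pi>\<^sub>M b\<in>B. lborel). sqrt ((\<Sum>b\<in>B. (x b)\<^sup>2) + d\<^sup>2) \<le> t}
   = (if t \<le> d then 0 else ennreal (unit_ball_vol (real k) * (t\<^sup>2 - d\<^sup>2) powr (real k / 2)))"
proof -
  let ?M = "\<Pi>\<^sub>M b\<in>B. (lborel::real measure)"
  let ?C = "\<lambda>r. {x \<in> space ?M. sqrt (\<Sum>b\<in>B. (x b)\<^sup>2) \<le> r}"
  have k: "k > 0" using B by (simp add: k_def card_gt_0_iff)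
  have C: "emeasure ?M (?C r) = ennreal (unit_ball_vol (real k) * r ^ k)" if "r > 0" for r
    using emeasure_cball_aux[OF B(1) that] by (simp add: k_def Int_def conj_commute)
  have [measurable]: "(\<lambda>x. \<Sum>b\<in>B. (x b)\<^sup>2) \<in> borel_measurable ?M"
    by (intro borel_measurable_sum) measurable
  have iff: "sqrt (q + d\<^sup>2) \<le> t \<longleftrightarrow> sqrt q \<le> sqrt (t\<^sup>2 - d\<^sup>2)" if "q \<ge> 0" "t \<ge> d" for q
  proof -
    have "sqrt (q + d\<^sup>2) \<le> t \<longleftrightarrow> q + d\<^sup>2 \<le> t\<^sup>2"
      using that d by (intro real_sqrt_le_iff') auto
    then show ?thesis by auto
  qed
  show ?thesis
  proof (cases "t \<le> d")
    case True
    \<comment> \<open>For \<open>t < d\<close> the set is empty, for \<open>t = d\<close> it is the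
      origin. Either way it lies in the ball of every radius \<open>r > 0\<close>, whose volume
      tends to 0 since \<open>B \<noteq> {}\<close> makes the dimension positive.\<close>
    have "emeasure ?M {x \<in> space ?M. sqrt ((\<Sum>b\<in>B. (x b)\<^sup>2) + d\<^sup>2) \<le> t} \<le> ennreal (unit_ball_vol (real k) * r ^ k)"
      if r: "0 < r" for r
    proof -
      have "sqrt (\<Sum>b\<in>B. (x b)\<^sup>2) \<le> r" if "sqrt ((\<Sum>b\<in>B. (x b)\<^sup>2) + d\<^sup>2) \<le> t" for x
      proof -
        have "sqrt ((\<Sum>b\<in>B. (x b)\<^sup>2) + d\<^sup>2) \<le> d" using that True by simp
        then have "(\<Sum>b\<in>B. (x b)\<^sup>2) + d\<^sup>2 \<le> d\<^sup>2"
          using d by (subst (asm) real_sqrt_le_iff') (auto intro!: sum_nonneg add_nonneg_nonneg)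
        then show ?thesis using r by (smt (verit) real_sqrt_le_0_iff)
      qed
      then have "emeasure ?M {x \<in> space ?M. sqrt ((\<Sum>b\<in>B. (x b)\<^sup>2) + d\<^sup>2) \<le> t} \<le> emeasure ?M (?C r)"
        by (intro emeasure_mono) auto
      then show ?thesis using C[OF r] by simp
    qed
    then have "eventually (\<lambda>r. emeasure ?M {x \<in> space ?M. sqrt ((\<Sum>b\<in>B. (x b)\<^sup>2) + d\<^sup>2) \<le> t}
        \<le> ennreal (unit_ball_vol (real k) * r ^ k)) (at_right 0)"
      by (intro eventually_mono[OF eventually_at_right_less])
    moreover have "((\<lambda>r. ennreal (unit_ball_vol (real k) * r ^ k)) \<longlongrightarrow> ennreal (unit_ball_vol (real k) * 0 ^ k)) (at_right 0)"
      by (intro tendsto_intros tendsto_ennrealI)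
    then have "((\<lambda>r. ennreal (unit_ball_vol (real k) * r ^ k)) \<longlongrightarrow> 0) (at_right 0)"
      using k by (simp add: zero_power)
    ultimately have "emeasure ?M {x \<in> space ?M. sqrt ((\<Sum>b\<in>B. (x b)\<^sup>2) + d\<^sup>2) \<le> t} \<le> 0"
      by (intro tendsto_lowerbound[where F="at_right (0::real)" and f="\<lambda>r. ennreal (unit_ball_vol (real k) * r ^ k)"]) auto
    then show ?thesis using True by simp
  next
    case False
    then have pos: "t\<^sup>2 - d\<^sup>2 > 0" using d by (simp add: power_strict_mono)
    have "{x \<in> space ?M. sqrt ((\<Sum>b\<in>B. (x b)\<^sup>2) + d\<^sup>2) \<le> t} = ?C (sqrt (t\<^sup>2 - d\<^sup>2))"
      using iff False by (auto simp: sum_nonneg)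
    moreover have "sqrt (t\<^sup>2 - d\<^sup>2) ^ k = (t\<^sup>2 - d\<^sup>2) powr (real k / 2)"
      using pos by (simp add: powr_half_sqrt[symmetric] powr_realpow[symmetric] powr_powr)
    ultimately show ?thesis using C[of "sqrt (t\<^sup>2 - d\<^sup>2)"] pos False by simp
  qed
qed

text \<open>The primitive is the volume of the ball of radius sqrt(r^2 - d^2) in dimension
  \<open>k\<close>; its derivative produces the sphere area because the area is \<open>k\<close>
  times the unit ball volume.\<close>

lemma nn_integral_shifted_power:
  assumes k: "0 < k" and d: "0 \<le> d"
  shows "(\<integral>\<^sup>+r. ennreal (sphere_area (k - 1) * (r\<^sup>2 - d\<^sup>2) powr (real k / 2 - 1) * r) * indicator {d<..} r
      * indicator {..t} r \<partial>lborel)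
   = (if t \<le> d then 0 else ennreal (unit_ball_vol (real k) * (t\<^sup>2 - d\<^sup>2) powr (real k / 2)))"
proof (cases "t \<le> d")
  case True
  then have "x * indicator {d<..} r * indicator {..t} r = (0::ennreal)" for r x
    by (auto split: split_indicator)
  then show ?thesis using True by (simp only: nn_integral_const mult_zero_left if_True)
next
  case False
  let ?F = "\<lambda>r. unit_ball_vol (real k) * (r\<^sup>2 - d\<^sup>2) powr (real k / 2)"
  have pos: "r\<^sup>2 - d\<^sup>2 > 0" if "d < r" for r using that d by (simp add: power_strict_mono)
  have "(\<integral>\<^sup>+r. ennreal (sphere_area (k - 1) * (r\<^sup>2 - d\<^sup>2) powr (real k / 2 - 1) * r) * indicator {d<..} r
      * indicator {..t} r \<partial>lborel) =
     (\<integral>\<^sup>+r. ennreal (sphere_area (k - 1) * (r\<^sup>2 - d\<^sup>2) powr (real k / 2 - 1) * r) * indicator {d<..<t} r \<partial>lborel)"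
    by (intro nn_integral_cong_AE eventually_mono[OF AE_lborel_singleton[of t]]) (auto split: split_indicator)
  also have "\<dots> = ennreal (?F t - ?F d)"
  proof (rule nn_integral_FTC_Ioo)
    fix r assume r: "d < r" "r < t"
    note p = pos[OF r(1)]
    show "(?F has_real_derivative sphere_area (k - 1) * (r\<^sup>2 - d\<^sup>2) powr (real k / 2 - 1) * r) (at r)"
      using p k by (auto intro!: derivative_eq_intros simp: unit_ball_vol_sphere_area powr_diff field_simps)
    show "isCont (\<lambda>r. sphere_area (k - 1) * (r\<^sup>2 - d\<^sup>2) powr (real k / 2 - 1) * r) r"
      using p by (intro continuous_intros) auto
    show "0 \<le> sphere_area (k - 1) * (r\<^sup>2 - d\<^sup>2) powr (real k / 2 - 1) * r"
      using r d by (auto intro!: mult_nonneg_nonneg less_imp_le[OF sphere_area_pos])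
  next
    show "continuous_on {d..t} ?F"
      using d k by (intro continuous_intros continuous_on_powr') (auto simp: power_mono)
  qed (use False in auto)
  finally show ?thesis using False by simp
qed

text \<open>Polar coordinates without a measure on the sphere: both sides give the same mass to
  every half-line \<open>{..t}\<close>, and half-lines form an intersection-stable generator. The
  shift \<open>d\<close> is built in so that the radial variable is at once the distance of a
  shifted plane.\<close>

lemma distr_PiM_shifted_norm:
  fixes B :: "'i set"
  assumes B: "finite B" "B \<noteq> {}" and d: "0 \<le> d"
  shows "distr (\<Pi>\<^sub>M b\<in>B. (lborel::real measure)) borel (\<lambda>x. sqrt ((\<Sum>b\<in>B. (x b)\<^sup>2) + d\<^sup>2))
   = density lborel (\<lambda>r. ennreal (sphere_area (card B - 1) * (r\<^sup>2 - d\<^sup>2) powr (real (card B) / 2 - 1) * r)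
        * indicator {d<..} r)" (is "?L = ?R")
proof (rule measure_eqI_generator_eq)
  have k: "card B > 0" using B by (simp add: card_gt_0_iff)
  have [measurable]: "(\<lambda>x. \<Sum>b\<in>B. (x b)\<^sup>2) \<in> borel_measurable (\<Pi>\<^sub>M b\<in>B. (lborel::real measure))"
    by (intro borel_measurable_sum) measurable
  have L: "emeasure ?L {..t} = (if t \<le> d then 0 else ennreal (unit_ball_vol (real (card B)) * (t\<^sup>2 - d\<^sup>2) powr (real (card B) / 2)))" for t
    using emeasure_PiM_shifted_norm_le[OF B d, of t]
    by (subst emeasure_distr) (auto simp: vimage_def Int_def conj_commute)
  have R: "emeasure ?R {..t} = (if t \<le> d then 0 else ennreal (unit_ball_vol (real (card B)) * (t\<^sup>2 - d\<^sup>2) powr (real (card B) / 2)))" for t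
    using nn_integral_shifted_power[OF k d, of t] by (subst emeasure_density) auto
  show "emeasure ?L X = emeasure ?R X" if "X \<in> range atMost" for X
    using that L R by auto
  show "emeasure ?L ((\<lambda>i::nat. {..real i}) i) \<noteq> \<infinity>" for i using L[of "real i"] by auto
  show "Int_stable (range (atMost :: real \<Rightarrow> _))" by (auto simp: Int_stable_def)
  show "(\<Union>i. (\<lambda>i::nat. {..real i}) i) = (UNIV :: real set)" using real_arch_simple by auto
  have "sets (borel :: real measure) = sigma_sets UNIV (range atMost)"
    by (simp add: borel_eq_atMost)
  then show "sets ?L = sigma_sets UNIV (range atMost)" "sets ?R = sigma_sets UNIV (range atMost)"
    by auto
qed auto

lemma nn_integral_PiM_shifted_norm:
  fixes B :: "'i set"
  assumes B: "finite B" "B \<noteq> {}" and d: "0 \<le> d" and [measurable]: "\<phi> \<in> borel_measurable borel"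
  shows "(\<integral>\<^sup>+x. \<phi> (sqrt ((\<Sum>b\<in>B. (x b)\<^sup>2) + d\<^sup>2)) \<partial>(\<Pi>\<^sub>M b\<in>B. (lborel::real measure)))
   = (\<integral>\<^sup>+r. ennreal (sphere_area (card B - 1) * (r\<^sup>2 - d\<^sup>2) powr (real (card B) / 2 - 1) * r)
        * indicator {d<..} r * \<phi> r \<partial>lborel)"
proof -
  have [measurable]: "(\<lambda>x. \<Sum>b\<in>B. (x b)\<^sup>2) \<in> borel_measurable (\<Pi>\<^sub>M b\<in>B. (lborel::real measure))"
    by (intro borel_measurable_sum) measurable
  have "(\<integral>\<^sup>+x. \<phi> (sqrt ((\<Sum>b\<in>B. (x b)\<^sup>2) + d\<^sup>2)) \<partial>(\<Pi>\<^sub>M b\<in>B. (lborel::real measure)))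
     = (\<integral>\<^sup>+r. \<phi> r \<partial>distr (\<Pi>\<^sub>M b\<in>B. (lborel::real measure)) borel (\<lambda>x. sqrt ((\<Sum>b\<in>B. (x b)\<^sup>2) + d\<^sup>2)))"
    by (subst nn_integral_distr) auto
  also have "\<dots> = (\<integral>\<^sup>+r. ennreal (sphere_area (card B - 1) * (r\<^sup>2 - d\<^sup>2) powr (real (card B) / 2 - 1) * r)
        * indicator {d<..} r * \<phi> r \<partial>lborel)"
    unfolding distr_PiM_shifted_norm[OF B d] by (subst nn_integral_density) auto
  finally show ?thesis .
qed

lemma powr_minus_two_mult:
  assumes "0 < (r::real)" "0 < l"
  shows "r powr (real l - 2) * r = r ^ (l - 1)"
proof -
  have "r powr (real l - 2) * r = r powr (real l - 2) * r powr 1" using assms by simp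
  also have "\<dots> = r powr (real l - 2 + 1)" by (rule powr_add[symmetric])
  also have "real l - 2 + 1 = real (l - 1)" using assms by (simp add: of_nat_diff)
  also have "r powr \<dots> = r ^ (l - 1)" using assms by (intro powr_realpow)
  finally show ?thesis .
qed

lemma powr_square_half:
  assumes "0 < (r::real)" "0 < k"
  shows "(r\<^sup>2) powr (real k / 2 - 1) * r = r ^ (k - 1)"
proof -
  have "r\<^sup>2 = r powr 2" using assms by simp
  moreover have "2 * (real k / 2 - 1) = real k - 2" by simp
  ultimately have "(r\<^sup>2) powr (real k / 2 - 1) = r powr (real k - 2)" by (simp only: powr_powr)
  then show ?thesis using powr_minus_two_mult[OF assms] by (simp only:)
qed

lemma nn_integral_PiM_norm:
  fixes B :: "'i set"
  assumes B: "finite B" "B \<noteq> {}" and [measurable]: "\<phi> \<in> borel_measurable borel"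
  shows "(\<integral>\<^sup>+x. \<phi> (sqrt (\<Sum>b\<in>B. (x b)\<^sup>2)) \<partial>(\<Pi>\<^sub>M b\<in>B. (lborel::real measure)))
   = (\<integral>\<^sup>+r. ennreal (sphere_area (card B - 1) * r ^ (card B - 1)) * indicator {0<..} r * \<phi> r \<partial>lborel)"
proof -
  have k: "card B > 0" using B by (simp add: card_gt_0_iff)
  show ?thesis
    using nn_integral_PiM_shifted_norm[OF B order_refl, of \<phi>]
    by (auto simp: powr_square_half[OF _ k] mult.assoc intro!: nn_integral_cong split: split_indicator)
qed

lemma measurable_nn_integral_greaterThan:
  fixes g :: "real \<Rightarrow> real \<Rightarrow> ennreal"
  assumes [measurable]: "case_prod g \<in> borel_measurable (borel \<Otimes>\<^sub>M borel)"
  shows "(\<lambda>r. \<integral>\<^sup>+R. g r R * indicator {r<..} R \<partial>lborel) \<in> borel_measurable borel"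
proof -
  have "(\<lambda>r. \<integral>\<^sup>+R. g r R * (if r < R then 1 else 0) \<partial>lborel) \<in> borel_measurable borel"
    by measurable
  then show ?thesis by (simp add: indicator_def of_bool_def)
qed

text \<open>The \<open>B1\<close> coordinates are integrated with the norm \<open>r\<close> of the
  \<open>B2\<close> part as the shift, which makes \<open>R\<close> the norm of the whole vector.
  What remains depends on the \<open>B2\<close> part through \<open>r\<close> alone and is put into
  ordinary polar coordinates.\<close>

lemma nn_integral_span_lborel_blocks:
  fixes B1 B2 :: "'a::euclidean_space set" and G :: "real \<Rightarrow> real \<Rightarrow> ennreal"
  assumes B: "onb (B1 \<union> B2) V" and disj: "B1 \<inter> B2 = {}" and ne: "B1 \<noteq> {}" "B2 \<noteq> {}"
    and G [measurable]: "case_prod G \<in> borel_measurable (borel \<Otimes>\<^sub>M borel)"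
  shows "(\<integral>\<^sup>+x. G (norm x) (norm (\<Sum>b\<in>B2. (x \<bullet> b) *\<^sub>R b)) \<partial>span_lborel (B1 \<union> B2))
    = (\<integral>\<^sup>+r. ennreal (sphere_area (card B2 - 1) * r ^ (card B2 - 1)) * indicator {0<..} r *
        (\<integral>\<^sup>+R. ennreal (sphere_area (card B1 - 1) * (R\<^sup>2 - r\<^sup>2) powr (real (card B1) / 2 - 1) * R)
          * indicator {r<..} R * G R r \<partial>lborel) \<partial>lborel)"
proof -
  let ?L = "lborel :: real measure"
  let ?B = "B1 \<union> B2"
  interpret P: product_sigma_finite "\<lambda>b::'a. ?L" by standard
  have fin: "finite B1" "finite B2" using onb_finite[OF B] by auto
  let ?q = "\<lambda>S x. \<Sum>b\<in>S. (x b)\<^sup>2"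
  have qm [measurable]: "?q S \<in> borel_measurable (\<Pi>\<^sub>M b\<in>T. ?L)" if "S \<subseteq> T" for S T :: "'a set"
    by (intro borel_measurable_sum) (use that in \<open>auto simp: subset_iff\<close>)
  have n2: "norm (\<Sum>b\<in>B2. ((\<Sum>c\<in>?B. x c *\<^sub>R c) \<bullet> b) *\<^sub>R b) = sqrt (?q B2 x)" for x
  proof -
    have "(\<Sum>b\<in>B2. ((\<Sum>c\<in>?B. x c *\<^sub>R c) \<bullet> b) *\<^sub>R b) = (\<Sum>b\<in>B2. x b *\<^sub>R b)"
      by (intro sum.cong refl) (subst onb_inner_sum[OF B], auto)
    then show ?thesis by (simp add: onb_norm_sum[OF B])
  qed
  have n1: "norm (\<Sum>c\<in>?B. x c *\<^sub>R c) = sqrt (?q B1 x + ?q B2 x)" for x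
    by (subst onb_norm_sum[OF B]) (auto simp: sum.union_disjoint[OF fin disj])
  have [measurable]: "(\<lambda>x::'a. norm (\<Sum>b\<in>B2. (x \<bullet> b) *\<^sub>R b)) \<in> borel_measurable borel" by measurable
  have q1: "?q B1 (merge B1 B2 (x, y)) = ?q B1 x" and q2: "?q B2 (merge B1 B2 (x, y)) = ?q B2 y" for x y
    using disj by (auto intro!: sum.cong simp: merge_def)
  have m1 [measurable]: "(\<lambda>x. G (sqrt (?q B1 x + ?q B2 x)) (sqrt (?q B2 x))) \<in> borel_measurable (\<Pi>\<^sub>M b\<in>?B. ?L)"
  proof -
    have [measurable]: "?q B1 \<in> borel_measurable (\<Pi>\<^sub>M b\<in>?B. ?L)" "?q B2 \<in> borel_measurable (\<Pi>\<^sub>M b\<in>?B. ?L)"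
      by (auto intro: qm)
    show ?thesis by measurable
  qed
  define H where "H r = (\<integral>\<^sup>+R. ennreal (sphere_area (card B1 - 1) * (R\<^sup>2 - r\<^sup>2) powr (real (card B1) / 2 - 1) * R)
          * indicator {r<..} R * G R r \<partial>lborel)" for r
  have [measurable]: "H \<in> borel_measurable borel"
  proof -
    have "(\<lambda>r. \<integral>\<^sup>+R. (ennreal (sphere_area (card B1 - 1) * (R\<^sup>2 - r\<^sup>2) powr (real (card B1) / 2 - 1) * R)
          * G R r) * indicator {r<..} R \<partial>lborel) \<in> borel_measurable borel"
      by (rule measurable_nn_integral_greaterThan) measurable
    then show ?thesis unfolding H_def by (simp only: mult_ac)
  qed
  have "(\<integral>\<^sup>+x. G (norm x) (norm (\<Sum>b\<in>B2. (x \<bullet> b) *\<^sub>R b)) \<partial>span_lborel ?B)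
      = (\<integral>\<^sup>+x. G (sqrt (?q B1 x + ?q B2 x)) (sqrt (?q B2 x)) \<partial>(\<Pi>\<^sub>M b\<in>?B. ?L))"
    by (subst nn_integral_span_lborel) (auto simp: n1 n2)
  also have "\<dots> = (\<integral>\<^sup>+y. (\<integral>\<^sup>+x. G (sqrt (?q B1 x + ?q B2 y)) (sqrt (?q B2 y)) \<partial>(\<Pi>\<^sub>M b\<in>B1. ?L)) \<partial>(\<Pi>\<^sub>M b\<in>B2. ?L))"
  proof -
    have "B2 \<inter> B1 = {}" using disj by auto
    \<comment> \<open>Folding makes the first index set the outer one, so \<open>B2\<close> has to
      come first; disjointness lets the two arguments of \<open>merge\<close> be swapped
      back.\<close>
    note fold = P.product_nn_integral_fold[OF this fin(2,1)]
    have "merge B2 B1 (y, x) = merge B1 B2 (x, y)" for x y :: "'a \<Rightarrow> real"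
      using disj by (auto simp: merge_def fun_eq_iff)
    then show ?thesis
      using fold[of "\<lambda>x. G (sqrt (?q B1 x + ?q B2 x)) (sqrt (?q B2 x))"] m1
      by (simp add: q1 q2 Un_commute)
  qed
  also have "\<dots> = (\<integral>\<^sup>+y. H (sqrt (?q B2 y)) \<partial>(\<Pi>\<^sub>M b\<in>B2. ?L))"
  proof (intro nn_integral_cong)
    fix y
    have "(\<lambda>R. G R (sqrt (?q B2 y))) \<in> borel_measurable borel" by measurable
    from nn_integral_PiM_shifted_norm[OF fin(1) ne(1) _ this, of "sqrt (?q B2 y)"]
    show "(\<integral>\<^sup>+x. G (sqrt (?q B1 x + ?q B2 y)) (sqrt (?q B2 y)) \<partial>(\<Pi>\<^sub>M b\<in>B1. ?L)) = H (sqrt (?q B2 y))"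
      by (simp add: H_def sum_nonneg)
  qed
  also have "\<dots> = (\<integral>\<^sup>+r. ennreal (sphere_area (card B2 - 1) * r ^ (card B2 - 1)) * indicator {0<..} r * H r \<partial>lborel)"
    by (rule nn_integral_PiM_norm[OF fin(2) ne(2)]) measurable
  finally show ?thesis unfolding H_def .
qed

lemma ennreal_mult3:
  "0 \<le> x \<Longrightarrow> 0 \<le> y \<Longrightarrow> 0 \<le> z \<Longrightarrow> ennreal x * (ennreal y * (ennreal z * p)) = ennreal (x * y * z) * p"
  by (simp add: ennreal_mult mult_ac)

text \<open>For fixed \<open>R\<close> the substitution of \<open>R / s * r\<close> for
  \<open>r\<close> turns the argument of \<phi> into \<open>r\<close>, and by homogeneity the powers
  of \<open>R\<close> and \<open>s\<close> factor out. The remaining integral of R^(j+l-1) over 0 <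
  R < 1 is the source of the factor 1 / (j+l).\<close>

lemma angular_integral:
  fixes \<phi> :: "real \<Rightarrow> ennreal"
  assumes j: "0 < j" and l: "0 < l" and s: "0 < s" and [measurable]: "\<phi> \<in> borel_measurable borel"
  shows "(\<integral>\<^sup>+r. ennreal (r ^ (l - 1)) * indicator {0<..} r *
        (\<integral>\<^sup>+R. ennreal ((R\<^sup>2 - r\<^sup>2) powr (real j / 2 - 1) * R)
          * indicator {r<..} R * (indicator {..1} R * \<phi> (s * r / R)) \<partial>lborel) \<partial>lborel)
    = ennreal (1 / (real (j + l) * s ^ (j + l - 2))) *
      (\<integral>\<^sup>+r. ennreal ((s\<^sup>2 - r\<^sup>2) powr (real j / 2 - 1) * r ^ (l - 1)) * indicator {0<..<s} r * \<phi> r \<partial>lborel)"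
    (is "?L = ennreal ?c * ?I")
proof -
  \<comment> \<open>Indicators become conditionals, the form in which joint measurability in
    \<open>r\<close> and \<open>R\<close> is derived.\<close>
  let ?f = "\<lambda>r R. ennreal (r ^ (l - 1)) * (if 0 < r then 1 else 0) *
          (ennreal ((R\<^sup>2 - r\<^sup>2) powr (real j / 2 - 1) * R)
          * (if r < R then 1 else 0) * ((if R \<le> 1 then 1 else 0) * \<phi> (s * r / R)))"
  have "?L = (\<integral>\<^sup>+r. (\<integral>\<^sup>+R. ?f r R \<partial>lborel) \<partial>lborel)"
    by (intro nn_integral_cong, subst nn_integral_cmult[symmetric])
       (auto simp: indicator_def of_bool_def cong: if_cong)
  also have "\<dots> = (\<integral>\<^sup>+R. (\<integral>\<^sup>+r. ?f r R \<partial>lborel) \<partial>lborel)"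
    by (rule lborel_pair.Fubini') simp
  also have "\<dots> = (\<integral>\<^sup>+R. ennreal (R ^ (j + l - 1) / s ^ (j + l - 2)) * indicator {0<..<1} R * ?I \<partial>lborel)"
  proof (intro nn_integral_cong_AE eventually_mono[OF AE_lborel_singleton[of 1]])
    fix R :: real assume R1: "R \<noteq> 1"
    show "(\<integral>\<^sup>+r. ?f r R \<partial>lborel) = ennreal (R ^ (j + l - 1) / s ^ (j + l - 2)) * indicator {0<..<1} R * ?I"
    proof (cases "0 < R \<and> R < 1")
      case False
      then have "?f r R = 0" for r using R1 by auto
      then have "(\<integral>\<^sup>+r. ?f r R \<partial>lborel) = 0" by (simp only: nn_integral_const mult_zero_left)
      then show ?thesis using False by (simp add: indicator_def)
    next
      case True
      have eq: "ennreal \<bar>R / s\<bar> * ?f (0 + (R / s) * r) R = ennreal (R ^ (j + l - 1) / s ^ (j + l - 2)) *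
          (ennreal ((s\<^sup>2 - r\<^sup>2) powr (real j / 2 - 1) * r ^ (l - 1)) * indicator {0<..<s} r * \<phi> r)" for r
      proof (cases "0 < r \<and> r < s")
        case r: False
        have "R * r / s < R \<longleftrightarrow> r < s" "0 < R * r / s \<longleftrightarrow> 0 < r"
          using s True by (auto simp: field_simps zero_less_mult_iff)
        then show ?thesis using r by (auto simp: indicator_def)
      next
        case r: True
        have d: "s\<^sup>2 - r\<^sup>2 > 0" using r by (simp add: power_strict_mono)
        have "R\<^sup>2 - (R / s * r)\<^sup>2 = (R / s)\<^sup>2 * (s\<^sup>2 - r\<^sup>2)"
          using s by (simp add: field_simps power2_eq_square)
        then have p: "(R\<^sup>2 - (R / s * r)\<^sup>2) powr (real j / 2 - 1) = ((R / s)\<^sup>2) powr (real j / 2 - 1) * (s\<^sup>2 - r\<^sup>2) powr (real j / 2 - 1)"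
          using d by (simp add: powr_mult)
        have R0: "R / s > 0" using True s by simp
        have "(R / s) * (R / s * r) ^ (l - 1) * (R\<^sup>2 - (R / s * r)\<^sup>2) powr (real j / 2 - 1) * R
            = (((R / s)\<^sup>2) powr (real j / 2 - 1) * (R / s)) * (R / s) ^ (l - 1) * R * ((s\<^sup>2 - r\<^sup>2) powr (real j / 2 - 1) * r ^ (l - 1))"
          unfolding p power_mult_distrib[of "R / s" r "l - 1"] by (simp only: mult_ac)
        also have "((R / s)\<^sup>2) powr (real j / 2 - 1) * (R / s) = (R / s) ^ (j - 1)"
          by (rule powr_square_half[OF R0 j])
        also have "(R / s) ^ (j - 1) * (R / s) ^ (l - 1) * R = R ^ (j + l - 1) / s ^ (j + l - 2)"
        proof -
          have "(R / s) ^ (j - 1) * (R / s) ^ (l - 1) = (R / s) ^ (j + l - 2)"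
            using j l by (simp add: power_add[symmetric] numeral_2_eq_2)
          moreover have "j + l - 1 = Suc (j + l - 2)" using j l by simp
          then have "R ^ (j + l - 1) = R ^ (j + l - 2) * R" by (simp only: power_Suc2)
          ultimately show ?thesis by (simp add: power_divide)
        qed
        finally have E: "(R / s) * (R / s * r) ^ (l - 1) * (R\<^sup>2 - (R / s * r)\<^sup>2) powr (real j / 2 - 1) * R
            = R ^ (j + l - 1) / s ^ (j + l - 2) * ((s\<^sup>2 - r\<^sup>2) powr (real j / 2 - 1) * r ^ (l - 1))" .
        have c: "0 < R * r / s" "R * r / s < R" "s * (R * r / s) / R = r" "\<bar>R / s\<bar> = R / s"
          using r True s by (auto simp: field_simps)
        have "ennreal \<bar>R / s\<bar> * ?f (0 + (R / s) * r) R
          = ennreal (R / s) * (ennreal ((R / s * r) ^ (l - 1)) * (ennreal ((R\<^sup>2 - (R / s * r)\<^sup>2) powr (real j / 2 - 1) * R) * \<phi> r))"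
          using c True by simp
        also have "\<dots> = ennreal ((R / s) * (R / s * r) ^ (l - 1) * (R\<^sup>2 - (R / s * r)\<^sup>2) powr (real j / 2 - 1) * R) * \<phi> r"
          using r True s by (subst ennreal_mult3) (auto simp: mult.assoc)
        also have "\<dots> = ennreal (R ^ (j + l - 1) / s ^ (j + l - 2)) *
          (ennreal ((s\<^sup>2 - r\<^sup>2) powr (real j / 2 - 1) * r ^ (l - 1)) * indicator {0<..<s} r * \<phi> r)"
          unfolding E using r True s by (subst ennreal_mult) (auto simp: mult.assoc)
        finally show ?thesis .
      qed
      have "(\<integral>\<^sup>+r. ?f r R \<partial>lborel) = (\<integral>\<^sup>+r. ennreal \<bar>R / s\<bar> * ?f (0 + (R / s) * r) R \<partial>lborel)"
        using True s by (subst nn_integral_real_affine[of _ "R / s" 0], measurable) (auto simp: nn_integral_cmult)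
      also have "\<dots> = ennreal (R ^ (j + l - 1) / s ^ (j + l - 2)) * ?I"
        unfolding eq by (rule nn_integral_cmult) measurable
      finally show ?thesis using True by simp
    qed
  qed
  also have "\<dots> = (\<integral>\<^sup>+R. ennreal (R ^ (j + l - 1) / s ^ (j + l - 2)) * indicator {0<..<1} R \<partial>lborel) * ?I"
    by (rule nn_integral_multc) measurable
  also have "(\<integral>\<^sup>+R. ennreal (R ^ (j + l - 1) / s ^ (j + l - 2)) * indicator {0<..<1} R \<partial>lborel) = ennreal ?c"
  proof (subst nn_integral_FTC_Ioo[where F="\<lambda>R. R ^ (j + l) / (real (j + l) * s ^ (j + l - 2))"])
    show "((\<lambda>R. R ^ (j + l) / (real (j + l) * s ^ (j + l - 2))) has_real_derivative x ^ (j + l - 1) / s ^ (j + l - 2)) (at x)" for x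
      using j s by (auto intro!: derivative_eq_intros simp del: of_nat_add)
    show "isCont (\<lambda>R. R ^ (j + l - 1) / s ^ (j + l - 2)) x" for x
      using s by (intro continuous_intros) auto
    show "continuous_on {0..1} (\<lambda>R. R ^ (j + l) / (real (j + l) * s ^ (j + l - 2)))"
      using s j by (intro continuous_intros) auto
  qed (use s j in \<open>auto simp: zero_power\<close>)
  finally show ?thesis .
qed

section \<open>Orthogonal projections\<close>

lemma closest_point_subspace_eqI:
  fixes S :: "'a::euclidean_space set"
  assumes S: "subspace S" and y: "y \<in> S" and orth: "\<And>z. z \<in> S \<Longrightarrow> (x - y) \<bullet> z = 0"
  shows "closest_point S x = y"
proof (rule closest_point_unique[symmetric])
  show "\<forall>z\<in>S. dist x y \<le> dist x z"
  proof
    fix z assume "z \<in> S"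
    then have "y - z \<in> S" using S y by (simp add: subspace_diff)
    then have "orthogonal (x - y) (y - z)" using orth by (simp add: orthogonal_def)
    then have "(norm (x - y + (y - z)))\<^sup>2 = (norm (x - y))\<^sup>2 + (norm (y - z))\<^sup>2"
      by (rule norm_add_Pythagorean)
    then have "(norm (x - y))\<^sup>2 \<le> (norm (x - z))\<^sup>2" by simp
    then show "dist x y \<le> dist x z" by (simp add: dist_norm)
  qed
qed (use S y in \<open>auto simp: subspace_imp_convex closed_subspace\<close>)

lemma onb_sum_in:
  assumes "onb B V" shows "(\<Sum>b\<in>B. u b *\<^sub>R b) \<in> V"
  using onb_in[OF assms] onb_subspace[OF assms] by (auto intro!: subspace_sum subspace_scale)

lemma onb_residual_orth:
  assumes B: "onb B S" and z: "z \<in> S"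
  shows "(x - (\<Sum>b\<in>B. (x \<bullet> b) *\<^sub>R b)) \<bullet> z = 0"
proof -
  let ?y = "\<Sum>b\<in>B. (x \<bullet> b) *\<^sub>R b"
  have 1: "orthogonal (x - ?y) b" if "b \<in> B" for b
    unfolding orthogonal_def inner_diff_left onb_inner_sum[OF B subset_refl that, of "\<lambda>b. x \<bullet> b"]
    by (simp only: that if_True diff_self)
  have "z \<in> span B" using B z by (simp add: onb_def)
  then have "orthogonal (x - ?y) z" by (rule orthogonal_to_span) (rule 1)
  then show ?thesis by (simp only: orthogonal_def)
qed

lemma closest_point_onb:
  assumes B: "onb B S"
  shows "closest_point S x = (\<Sum>b\<in>B. (x \<bullet> b) *\<^sub>R b)"
  by (rule closest_point_subspace_eqI[OF onb_subspace[OF B] onb_sum_in[OF B] onb_residual_orth[OF B]])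

lemma closest_point_subspace_in:
  fixes S :: "'a::euclidean_space set"
  assumes "subspace S" shows "closest_point S x \<in> S"
proof -
  obtain B where B: "onb B S" using onb_exists assms by blast
  show ?thesis unfolding closest_point_onb[OF B] by (rule onb_sum_in[OF B])
qed

lemma closest_point_subspace_orth:
  fixes S :: "'a::euclidean_space set"
  assumes "subspace S" "z \<in> S"
  shows "(x - closest_point S x) \<bullet> z = 0"
proof -
  obtain B where B: "onb B S" using onb_exists assms by blast
  show ?thesis unfolding closest_point_onb[OF B] by (rule onb_residual_orth[OF B assms(2)])
qed

lemma linear_closest_point:
  fixes S :: "'a::euclidean_space set"
  assumes "subspace S" shows "linear (closest_point S)"
proof -
  obtain B where B: "onb B S" using onb_exists assms by blast
  show ?thesis
    unfolding linear_iff closest_point_onb[OF B]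
    by (simp add: inner_add_left scaleR_add_left sum.distrib scaleR_sum_right)
qed

lemma closest_point_subspace_eq_iff:
  fixes S :: "'a::euclidean_space set"
  assumes "subspace S"
  shows "x \<in> S \<longleftrightarrow> closest_point S x = x"
  using assms closed_subspace subspace_0 by (metis closest_point_refl empty_iff)

lemma infdist_subspace:
  fixes S :: "'a::euclidean_space set"
  assumes "subspace S"
  shows "infdist x S = norm (x - closest_point S x)"
  using setdist_closest_point[of S x] closed_subspace[OF assms] subspace_0[OF assms]
  by (auto simp: infdist_eq_setdist dist_norm)

lemma infdist_subspace_scale:
  fixes S :: "'a::euclidean_space set"
  assumes "subspace S"
  shows "infdist (c *\<^sub>R x) S = \<bar>c\<bar> * infdist x S"
  using linear_closest_point[OF assms]
  by (simp add: infdist_subspace[OF assms] linear_scale flip: scaleR_diff_right)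

lemma onb_extend:
  fixes V :: "'a::euclidean_space set"
  assumes B1: "onb B1 S" and SV: "S \<subseteq> V" and V: "subspace V"
  obtains B2 where "onb (B1 \<union> B2) V" "B1 \<inter> B2 = {}"
proof -
  have S: "subspace S" using onb_subspace[OF B1] .
  define W where "W = {x \<in> V. \<forall>y\<in>S. x \<bullet> y = 0}"
  have "subspace W"
    using V unfolding W_def subspace_def by (auto simp: inner_add_left)
  then obtain B2 where B2: "onb B2 W" using onb_exists by blast
  have 1: "b \<bullet> c = 0" if "b \<in> B1" "c \<in> B2" for b c
    using onb_in[OF B1 that(1)] onb_in[OF B2 that(2)] by (simp add: W_def inner_commute)
  have "span (B1 \<union> B2) = V"
  proof
    have "B1 \<union> B2 \<subseteq> V" using onb_in[OF B1] onb_in[OF B2] SV by (auto simp: W_def)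
    then show "span (B1 \<union> B2) \<subseteq> V" using V by (rule span_minimal)
    show "V \<subseteq> span (B1 \<union> B2)"
    proof
      fix v assume v: "v \<in> V"
      let ?p = "closest_point S v"
      have p: "?p \<in> S" by (rule closest_point_subspace_in[OF S])
      then have "v - ?p \<in> W"
        using v SV V closest_point_subspace_orth[OF S] by (auto simp: W_def subspace_diff)
      then have "v - ?p \<in> span (B1 \<union> B2)"
        using B2 span_mono[of B2 "B1 \<union> B2"] by (auto simp: onb_def)
      moreover have "?p \<in> span (B1 \<union> B2)"
        using p B1 span_mono[of B1 "B1 \<union> B2"] by (auto simp: onb_def)
      ultimately have "?p + (v - ?p) \<in> span (B1 \<union> B2)" by (rule span_add[rotated])
      then show "v \<in> span (B1 \<union> B2)" by simp
    qed
  qed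
  moreover have "pairwise orthogonal (B1 \<union> B2)"
    using B1 B2 1 unfolding onb_def pairwise_def orthogonal_def by (metis Un_iff inner_commute)
  moreover have "B1 \<inter> B2 = {}"
    using 1 B1 unfolding onb_def by (metis disjoint_iff norm_eq_1 zero_neq_one)
  ultimately show thesis using that[of B2] B1 B2 by (auto simp: onb_def)
qed

text \<open>In a basis extending one of \<open>S\<close>, some coordinate vanishes on all of
  \<open>S\<close>, so \<open>S\<close> is contained in a coordinate hyperplane. Independence of the
  basis allows this one to replace \<open>B\<close>.\<close>

lemma AE_span_lborel_not_in:
  assumes B: "onb B V" and S: "subspace S" "S \<subseteq> V" "dim S < dim V"
  shows "AE x in span_lborel B. x \<notin> S"
proof -
  obtain B1 where B1: "onb B1 S" using onb_exists S by blast
  obtain B2 where B2: "onb (B1 \<union> B2) V" "B1 \<inter> B2 = {}"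
    using onb_extend[OF B1 S(2) onb_subspace[OF B]] .
  have "B2 \<noteq> {}" using onb_card[OF B1] onb_card[OF B2(1)] S(3) by auto
  then obtain e where e: "e \<in> B2" by blast
  let ?C = "B1 \<union> B2"
  let ?P = "\<Pi>\<^sub>M b\<in>?C. (lborel :: real measure)"
  have fin: "finite ?C" using onb_finite[OF B2(1)] .
  have e0: "x \<bullet> e = 0" if "x \<in> S" for x
  proof -
    have "x \<bullet> e = (\<Sum>b\<in>B1. (x \<bullet> b) *\<^sub>R b) \<bullet> e" by (simp only: onb_expand[OF B1 that])
    also have "\<dots> = 0" using e B2 by (subst onb_inner_sum[OF B2(1)]) auto
    finally show ?thesis .
  qed
  interpret P: product_sigma_finite "\<lambda>b::'a. lborel :: real measure" by standard
  let ?N = "Pi\<^sub>E ?C (\<lambda>b. if b = e then {0} else UNIV :: real set)"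
  have "emeasure ?P ?N = 0"
  proof -
    \<comment> \<open>The other sides of the box have infinite length, but a single factor 0 makes
      an extended nonnegative product vanish.\<close>
    have "(\<Prod>b\<in>?C. emeasure lborel (if b = e then {0} else UNIV :: real set)) = 0"
      using fin e by (intro prod_zero) (auto intro: bexI[of _ e])
    then show ?thesis using fin by (subst P.emeasure_PiM) simp_all
  qed
  moreover have "?N \<in> sets ?P" by (rule sets_PiM_I_finite[OF fin]) simp
  ultimately have "AE x in ?P. x \<notin> ?N" by (intro AE_not_in null_setsI)
  then have "AE x in ?P. (\<Sum>b\<in>?C. x b *\<^sub>R b) \<notin> S"
    using AE_space[of ?P]
  proof (eventually_elim, intro notI)
    fix x assume x: "x \<notin> ?N" "x \<in> space ?P" and xS: "(\<Sum>b\<in>?C. x b *\<^sub>R b) \<in> S"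
    from xS have "(\<Sum>b\<in>?C. x b *\<^sub>R b) \<bullet> e = 0" by (rule e0)
    then have "x e = 0" using e by (subst (asm) onb_inner_sum[OF B2(1)]) auto
    then show False using x by (auto simp: space_PiM PiE_iff split: if_splits)
  qed
  moreover have "{x. x \<notin> S} \<in> sets borel"
    using borel_closed[OF closed_subspace[OF S(1)]] by (simp flip: Compl_eq)
  ultimately have "AE x in span_lborel ?C. x \<notin> S"
    unfolding span_lborel_def by (subst AE_distr_iff) (auto intro: measurable_span_lborel_sum)
  then show ?thesis by (simp only: span_lborel_basis_independent[OF B B2(1)])
qed

text \<open>The witness is the reflection in the hyperplane orthogonal to \<open>v - w\<close>. It
  preserves \<open>V\<close> because \<open>v - w\<close> lies in \<open>V\<close>, and equality of
  the norms gives \<open>u \<bullet> u = 2 * (v \<bullet> u)\<close>, which is what sends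
  \<open>v\<close> to \<open>v - u\<close>.\<close>

lemma orthogonal_transformation_swap:
  fixes V :: "'a::euclidean_space set"
  assumes V: "subspace V" and vw: "v \<in> V" "w \<in> V" and n: "norm v = norm w"
  obtains T where "orthogonal_transformation T" "T ` V = V" "T v = w"
proof (cases "v = w")
  case True
  then show thesis using that[of id] by (simp add: orthogonal_transformation_def linear_id id_def)
next
  case False
  define u where "u = v - w"
  have u0: "u \<noteq> 0" using False by (simp add: u_def)
  have uV: "u \<in> V" using V vw by (simp add: u_def subspace_diff)
  define T where "T x = x - (2 * (x \<bullet> u) / (u \<bullet> u)) *\<^sub>R u" for x
  have lin: "linear T"
    by (rule linearI) (simp_all add: T_def inner_add_left algebra_simps add_divide_distrib)
  have orth: "T x \<bullet> T y = x \<bullet> y" for x y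
    using u0 by (simp add: T_def inner_diff_left inner_diff_right inner_commute field_simps)
  have TT: "T (T x) = x" for x
    using u0 by (simp add: T_def inner_diff_left algebra_simps)
  have TV: "T x \<in> V" if "x \<in> V" for x
    using that uV V by (simp add: T_def subspace_diff subspace_scale)
  have "u \<bullet> u = 2 * (v \<bullet> u)"
    using n unfolding u_def by (simp add: inner_diff_left inner_diff_right inner_commute norm_eq)
  moreover have "u \<bullet> u \<noteq> 0" using u0 by simp
  ultimately have "2 * (v \<bullet> u) / (u \<bullet> u) = 1" by (metis divide_self)
  then have "T v = v - u" by (simp only: T_def scaleR_one)
  then have "T v = w" by (simp add: u_def)
  moreover have "T ` V = V" using TV TT by (metis image_iff subsetI subset_antisym image_subsetI)
  moreover have "orthogonal_transformation T" using lin orth by (simp add: orthogonal_transformation_def)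
  ultimately show thesis using that by blast
qed

lemma closest_point_orthogonal_image:
  fixes S :: "'a::euclidean_space set" and T :: "'a \<Rightarrow> 'a"
  assumes T: "orthogonal_transformation T" and S: "subspace S"
  shows "closest_point (T ` S) (T x) = T (closest_point S x)"
proof (rule closest_point_subspace_eqI)
  have lin: "linear T" using T orthogonal_transformation_linear by blast
  show "subspace (T ` S)" using S lin by (simp add: linear_subspace_image)
  show "T (closest_point S x) \<in> T ` S" using closest_point_subspace_in[OF S] by blast
  show "(T x - T (closest_point S x)) \<bullet> z = 0" if "z \<in> T ` S" for z
    using that closest_point_subspace_orth[OF S] T
    by (auto simp: orthogonal_transformation_def simp flip: linear_diff[OF lin])
qed

lemma infdist_orthogonal_image:
  fixes S :: "'a::euclidean_space set" and T :: "'a \<Rightarrow> 'a"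
  assumes T: "orthogonal_transformation T" and S: "subspace S"
  shows "infdist (T x) (T ` S) = infdist x S"
proof -
  have lin: "linear T" using T orthogonal_transformation_linear by blast
  then have "subspace (T ` S)" using S by (simp add: linear_subspace_image)
  then show ?thesis
    using T by (simp add: infdist_subspace[OF S] infdist_subspace closest_point_orthogonal_image[OF T S]
        orthogonal_transformation_norm flip: linear_diff[OF lin])
qed

text \<open>One Gram-Schmidt step. If \<open>w\<close> lies in \<open>S\<close>, then
  \<open>u = 0\<close> and division by zero yields the correct projection. The explicit formula is
  what makes the span of a random subspace and a random vector measurable.\<close>

lemma closest_point_span_insert:
  fixes S :: "'a::euclidean_space set" and w :: 'a
  assumes S: "subspace S"
  defines "u \<equiv> w - closest_point S w"
  shows "closest_point (span (insert w S)) y = closest_point S y + ((y \<bullet> u) / (u \<bullet> u)) *\<^sub>R u"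
proof (rule closest_point_subspace_eqI)
  have pS: "closest_point S x \<in> S" for x by (rule closest_point_subspace_in[OF S])
  have in1: "x \<in> span (insert w S)" if "x \<in> S" for x using that by (simp add: span_base)
  have u_in: "u \<in> span (insert w S)"
    unfolding u_def by (intro span_diff in1 pS span_base) simp
  show "closest_point S y + ((y \<bullet> u) / (u \<bullet> u)) *\<^sub>R u \<in> span (insert w S)"
    by (rule span_add[OF in1[OF pS] span_scale[OF u_in]])
  let ?d = "y - (closest_point S y + ((y \<bullet> u) / (u \<bullet> u)) *\<^sub>R u)"
  have uS: "u \<bullet> z = 0" if "z \<in> S" for z
    using closest_point_subspace_orth[OF S that] by (simp add: u_def)
  have dS: "?d \<bullet> z = 0" if "z \<in> S" for z
    using closest_point_subspace_orth[OF S that, of y] uS[OF that]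
    by (simp add: inner_diff_left inner_add_left)
  have du: "?d \<bullet> u = 0"
    using uS[OF pS, of y] by (cases "u = 0") (simp_all add: inner_diff_left inner_add_left inner_diff_right inner_add_right inner_commute)
  have dw: "?d \<bullet> w = 0"
  proof -
    have "w = u + closest_point S w" by (simp add: u_def)
    then have "?d \<bullet> w = ?d \<bullet> u + ?d \<bullet> closest_point S w" by (metis inner_add_right)
    then show ?thesis using du dS[OF pS] by simp
  qed
  show "?d \<bullet> z = 0" if "z \<in> span (insert w S)" for z
    using that
  proof (induction rule: span_induct)
    case base
    show ?case by (auto simp: subspace_def inner_add_right)
  next
    case (step x)
    then show ?case using dS dw by auto
  qed
qed (rule subspace_span)

section \<open>Invariant measures on the Grassmannian\<close>

lemma space_grassmannian_borel:
  "space (grassmannian_borel V j) = grassmannian V j"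
  by (simp add: grassmannian_borel_def)

lemma grassmannian_memD:
  assumes "\<xi> \<in> grassmannian V j"
  shows "subspace \<xi>" "\<xi> \<subseteq> V" "dim \<xi> = j"
  using assms by (auto simp: grassmannian_def)

lemma matrix_closest_point:
  "subspace \<xi> \<Longrightarrow> matrix (closest_point \<xi>) *v x = closest_point \<xi> (x::real^'n)"
  by (simp add: linear_closest_point matrix_works)

section \<open>Measurability through projection matrices\<close>

lemma measurable_matrix_vector_mult [measurable]:
  fixes f :: "'a \<Rightarrow> real^'n^'m" and g :: "'a \<Rightarrow> real^'n"
  assumes "f \<in> borel_measurable M" "g \<in> borel_measurable M"
  shows "(\<lambda>x. f x *v g x) \<in> borel_measurable M"
proof -
  have "continuous_on UNIV (\<lambda>p::(real^'n^'m) \<times> (real^'n). fst p *v snd p)"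
    unfolding matrix_vector_mult_def by (intro continuous_intros)
  from borel_measurable_continuous_Pair[OF assms this] show ?thesis by simp
qed

lemma borel_measurable_matrixI:
  fixes f :: "'a \<Rightarrow> real^'n^'m"
  assumes "\<And>i k. (\<lambda>x. f x $ i $ k) \<in> borel_measurable M"
  shows "f \<in> borel_measurable M"
  using assms
  by (subst borel_measurable_euclidean_space) (auto simp: Basis_vec_def inner_axis)

text \<open>The \<sigma>-algebra is generated by the projection matrix, and applying a matrix to a
  vector is jointly continuous. The matrix represents the projection only for subspaces, hence the
  restriction to points of \<open>space N\<close>.\<close>

lemma measurable_closest_point [measurable (raw)]:
  fixes V :: "(real^'n) set"
  assumes f: "f \<in> N \<rightarrow>\<^sub>M grassmannian_borel V j" and [measurable]: "g \<in> borel_measurable N"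
  shows "(\<lambda>\<omega>. closest_point (f \<omega>) (g \<omega>)) \<in> borel_measurable N"
proof -
  have "(\<lambda>\<xi>. matrix (closest_point \<xi>)) \<in> grassmannian_borel V j \<rightarrow>\<^sub>M (borel :: (real^'n^'n) measure)"
    unfolding grassmannian_borel_def by (rule measurable_vimage_algebra1) simp
  from measurable_compose[OF f this]
  have "(\<lambda>\<omega>. matrix (closest_point (f \<omega>)) *v g \<omega>) \<in> borel_measurable N" by measurable
  moreover have "subspace (f \<omega>)" if "\<omega> \<in> space N" for \<omega>
    using measurable_space[OF f that] by (simp add: space_grassmannian_borel grassmannian_def)
  ultimately show ?thesis
    by (subst measurable_cong[where g="\<lambda>\<omega>. matrix (closest_point (f \<omega>)) *v g \<omega>"])
      (auto simp: matrix_closest_point)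
qed

lemma measurable_infdist_grassmannian [measurable (raw)]:
  fixes V :: "(real^'n) set"
  assumes f: "f \<in> N \<rightarrow>\<^sub>M grassmannian_borel V j" and [measurable]: "g \<in> borel_measurable N"
  shows "(\<lambda>\<omega>. infdist (g \<omega>) (f \<omega>)) \<in> borel_measurable N"
proof -
  note [measurable] = f
  have "infdist (g \<omega>) (f \<omega>) = norm (g \<omega> - closest_point (f \<omega>) (g \<omega>))" if "\<omega> \<in> space N" for \<omega>
    using measurable_space[OF f that]
    by (intro infdist_subspace) (simp add: space_grassmannian_borel grassmannian_def)
  then show ?thesis
    by (subst measurable_cong[where g="\<lambda>\<omega>. norm (g \<omega> - closest_point (f \<omega>) (g \<omega>))"]) auto
qed

text \<open>The columns of the projection matrix are the projections of the axis vectors, so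
  measurability of the projection at each fixed vector suffices.\<close>

lemma measurable_grassmannianI:
  fixes V :: "(real^'n) set"
  assumes sp: "\<And>\<omega>. \<omega> \<in> space N \<Longrightarrow> f \<omega> \<in> grassmannian V j"
    and ms: "\<And>x. (\<lambda>\<omega>. closest_point (f \<omega>) x) \<in> borel_measurable N"
  shows "f \<in> N \<rightarrow>\<^sub>M grassmannian_borel V j"
  unfolding grassmannian_borel_def
proof (rule measurable_vimage_algebra2)
  show "f \<in> space N \<rightarrow> grassmannian V j" using sp by auto
  show "(\<lambda>\<omega>. matrix (closest_point (f \<omega>))) \<in> borel_measurable N"
  proof (rule borel_measurable_matrixI)
    fix i k
    note [measurable] = ms
    have "(\<lambda>\<omega>. closest_point (f \<omega>) (axis k 1) $ i) \<in> borel_measurable N"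
      by (rule measurable_compose[OF ms])
        (intro borel_measurable_continuous_onI continuous_on_component continuous_on_id)
    then show "(\<lambda>\<omega>. matrix (closest_point (f \<omega>)) $ i $ k) \<in> borel_measurable N"
      by (simp add: matrix_def)
  qed
qed

lemma grassmannian_image:
  assumes T: "orthogonal_transformation T" "T ` V = V" and "\<xi> \<in> grassmannian V j"
  shows "T ` \<xi> \<in> grassmannian V j"
proof -
  have lin: "linear T" using T orthogonal_transformation_linear by blast
  have "dim (T ` \<xi>) = dim \<xi>"
    using T(1) lin by (intro dim_image_eq) (auto intro: inj_on_subset orthogonal_transformation_inj)
  then show ?thesis
    using assms lin by (auto simp: grassmannian_def linear_subspace_image)
qed

lemma measurable_grassmannian_image:
  fixes V :: "(real^'n) set"
  assumes T: "orthogonal_transformation T" "T ` V = V"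
  shows "(`) T \<in> grassmannian_borel V j \<rightarrow>\<^sub>M grassmannian_borel V j"
proof (rule measurable_grassmannianI)
  show "T ` \<xi> \<in> grassmannian V j" if "\<xi> \<in> space (grassmannian_borel V j)" for \<xi>
    using grassmannian_image[OF T] that by (simp add: space_grassmannian_borel)
  show "(\<lambda>\<xi>. closest_point (T ` \<xi>) x) \<in> borel_measurable (grassmannian_borel V j)" for x
  proof -
    \<comment> \<open>At \<open>T y\<close> the projection onto the image of \<xi> is
      \<open>T\<close> applied to the projection of \<open>y\<close> onto \<xi>; surjectivity of
      \<open>T\<close> brings every \<open>x\<close> into this form.\<close>
    obtain y where y: "x = T y" using orthogonal_transformation_surj[OF T(1)] by blast
    have [measurable]: "T \<in> borel_measurable borel"
      using orthogonal_transformation_linear[OF T(1)]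
      by (simp add: borel_measurable_continuous_onI linear_continuous_on linear_linear)
    have "(\<lambda>\<xi>. T (closest_point \<xi> y)) \<in> borel_measurable (grassmannian_borel V j)" by measurable
    then show ?thesis
      by (subst measurable_cong[where g="\<lambda>\<xi>. T (closest_point \<xi> y)"])
        (auto simp: y space_grassmannian_borel grassmannian_def closest_point_orthogonal_image[OF T(1)])
  qed
qed

section \<open>Existence of an invariant measure\<close>

lemma grassmannian_span_insert:
  assumes V: "subspace V" and x: "x \<in> V" "x \<notin> \<xi>" and \<xi>: "\<xi> \<in> grassmannian V j"
  shows "span (insert x \<xi>) \<in> grassmannian V (Suc j)"
proof -
  have sp: "span \<xi> = \<xi>" using grassmannian_memD(1)[OF \<xi>] by (rule span_eq_iff[THEN iffD2])
  have "dim (span (insert x \<xi>)) = Suc j"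
    using x grassmannian_memD(3)[OF \<xi>] by (simp add: dim_insert sp)
  moreover have "span (insert x \<xi>) \<subseteq> V"
    using x grassmannian_memD[OF \<xi>] V by (intro span_minimal) auto
  ultimately show ?thesis by (simp add: grassmannian_def)
qed

text \<open>Extend a random \<open>j\<close>-dimensional subspace by a random vector of the unit ball of \<open>V\<close>,
  which almost surely lies outside it.\<close>

lemma invariant_prob_Suc:
  fixes V :: "(real^'n) set"
  assumes V: "subspace V" and j: "Suc j \<le> dim V" and M: "invariant_prob V j M"
  shows "\<exists>N. invariant_prob V (Suc j) N"
proof -
  have sM [measurable_cong]: "sets M = sets (grassmannian_borel V j)" and pM: "prob_space M"
    and iM: "\<And>T. orthogonal_transformation T \<Longrightarrow> T ` V = V \<Longrightarrow> distr M M ((`) T) = M"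
    using M by (auto simp: invariant_prob_def)
  have spM: "space M = grassmannian V j"
    using sets_eq_imp_space_eq[OF sM] by (simp add: space_grassmannian_borel)
  obtain B where B: "onb B V" using onb_exists[OF V] by blast
  let ?b = "cball (0::real^'n) 1"
  have bm [measurable]: "?b \<in> sets borel" by (simp add: borel_closed)
  have b0: "emeasure (span_lborel B) ?b \<noteq> 0" "emeasure (span_lborel B) ?b \<noteq> \<infinity>"
    using emeasure_span_lborel_cball[OF B, of 1] unit_ball_vol_pos[of "card B"] by (auto simp: ennreal_eq_0_iff not_le)
  \<comment> \<open>The uniform distribution on the unit ball of \<open>V\<close>, since
    \<open>span_lborel B\<close> is carried by \<open>V\<close>. Ball and measure are both invariant
    under the orthogonal maps preserving \<open>V\<close>, hence so is \<open>U\<close>.\<close>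
  define U where "U = uniform_measure (span_lborel B) ?b"
  have pU: "prob_space U" unfolding U_def by (rule prob_space_uniform_measure[OF b0])
  have sU [measurable_cong]: "sets U = sets borel" by (simp add: U_def)
  interpret M: prob_space M by fact
  interpret U: prob_space U by fact
  interpret MU: pair_prob_space M U ..
  have Vm [measurable]: "V \<in> sets borel" using closed_subspace[OF V] by simp
  \<comment> \<open>A default for exceptional pairs: the extension map must take values in the
    Grassmannian everywhere, not just almost everywhere.\<close>
  obtain \<xi>0 where \<xi>0: "\<xi>0 \<in> grassmannian V (Suc j)"
  proof -
    obtain W where "subspace W" "W \<subseteq> span V" "dim W = Suc j"
      using choose_subspace_of_subspace[OF j] by metis
    moreover have "span V = V" using V by (rule span_eq_iff[THEN iffD2])
    ultimately show thesis using that[of W] by (simp only: grassmannian_def mem_Collect_eq)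
  qed
  \<comment> \<open>The inequality expresses that the vector is outside the subspace, in terms of a
    projection whose measurability is known.\<close>
  define good where "good p \<longleftrightarrow> snd p \<in> V \<and> snd p \<noteq> closest_point (fst p) (snd p)" for p :: "(real^'n) set \<times> (real^'n)"
  define \<Psi> where "\<Psi> p = (if good p then span (insert (snd p) (fst p)) else \<xi>0)" for p
  have [measurable]: "fst \<in> M \<Otimes>\<^sub>M U \<rightarrow>\<^sub>M grassmannian_borel V j" by measurable
  have sndm [measurable]: "snd \<in> M \<Otimes>\<^sub>M U \<rightarrow>\<^sub>M borel" by measurable
  have good_m [measurable]: "Measurable.pred (M \<Otimes>\<^sub>M U) good"
    unfolding good_def by measurable
  have fst_sp: "fst p \<in> grassmannian V j" if "p \<in> space (M \<Otimes>\<^sub>M U)" for p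
    using that by (simp add: space_pair_measure mem_Times_iff spM)
  have \<Psi>_sp: "\<Psi> p \<in> grassmannian V (Suc j)" if "p \<in> space (M \<Otimes>\<^sub>M U)" for p
  proof (cases "good p")
    case True
    have "fst p \<in> grassmannian V j" using that by (rule fst_sp)
    moreover have "snd p \<notin> fst p" "snd p \<in> V"
      using True closest_point_subspace_eq_iff[of "fst p" "snd p"] grassmannian_memD[OF \<open>fst p \<in> grassmannian V j\<close>]
      by (auto simp: good_def)
    ultimately show ?thesis using grassmannian_span_insert[OF V] True by (simp add: \<Psi>_def)
  qed (simp add: \<Psi>_def \<xi>0)
  have \<Psi>_m [measurable]: "\<Psi> \<in> M \<Otimes>\<^sub>M U \<rightarrow>\<^sub>M grassmannian_borel V (Suc j)"
  proof (rule measurable_grassmannianI[OF \<Psi>_sp])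
    fix y
    let ?u = "\<lambda>p. snd p - closest_point (fst p) (snd p)"
    let ?g = "\<lambda>p. if good p then closest_point (fst p) y + ((y \<bullet> ?u p) / (?u p \<bullet> ?u p)) *\<^sub>R ?u p
        else closest_point \<xi>0 y"
    have "?g \<in> borel_measurable (M \<Otimes>\<^sub>M U)" by measurable
    moreover have "closest_point (\<Psi> p) y = ?g p" if "p \<in> space (M \<Otimes>\<^sub>M U)" for p
    proof -
      have "fst p \<in> grassmannian V j" using that by (rule fst_sp)
      then show ?thesis by (simp add: \<Psi>_def closest_point_span_insert grassmannian_memD(1))
    qed
    ultimately show "(\<lambda>p. closest_point (\<Psi> p) y) \<in> borel_measurable (M \<Otimes>\<^sub>M U)"
      by (subst measurable_cong[where g="?g"]) auto
  qed
  have AE_good: "AE p in M \<Otimes>\<^sub>M U. good p"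
  proof (rule MU.AE_pair_measure)
    show "AE \<xi> in M. AE x in U. good (\<xi>, x)"
    proof (rule AE_I2)
      fix \<xi> assume "\<xi> \<in> space M"
      then have \<xi>: "\<xi> \<in> grassmannian V j" by (simp add: spM)
      then have "AE x in span_lborel B. x \<notin> \<xi>"
        using j grassmannian_memD[OF \<xi>] by (intro AE_span_lborel_not_in[OF B]) auto
      then have "AE x in span_lborel B. x \<in> ?b \<longrightarrow> good (\<xi>, x)"
        using AE_span_lborel_in[OF B]
        by eventually_elim (use closest_point_subspace_eq_iff[OF grassmannian_memD(1)[OF \<xi>]] in \<open>force simp: good_def\<close>)
      then show "AE x in U. good (\<xi>, x)"
        unfolding U_def by (intro AE_uniform_measureI) auto
    qed
  qed measurable
  define N where "N = distr (M \<Otimes>\<^sub>M U) (grassmannian_borel V (Suc j)) \<Psi>"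
  have "invariant_prob V (Suc j) N"
    unfolding invariant_prob_def
  proof (intro conjI allI impI)
    show "sets N = sets (grassmannian_borel V (Suc j))" by (simp add: N_def)
    show "prob_space N" unfolding N_def by (rule MU.prob_space_distr[OF \<Psi>_m])
    fix T :: "real^'n \<Rightarrow> real^'n" assume "orthogonal_transformation T \<and> T ` V = V"
    then have T: "orthogonal_transformation T" "T ` V = V" by auto
    have lin: "linear T" using T orthogonal_transformation_linear by blast
    have inj: "inj T" using T orthogonal_transformation_inj by blast
    have Tm [measurable]: "T \<in> borel_measurable borel"
      using lin by (simp add: borel_measurable_continuous_onI linear_continuous_on linear_linear)
    have Tim: "(`) T \<in> M \<rightarrow>\<^sub>M M"
      using measurable_grassmannian_image[OF T, of j] by (simp add: measurable_cong_sets[OF sM sM])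
    have Tin [measurable]: "(`) T \<in> grassmannian_borel V (Suc j) \<rightarrow>\<^sub>M grassmannian_borel V (Suc j)"
      by (rule measurable_grassmannian_image[OF T])
    have iU: "distr U borel T = U"
    proof (rule measure_eqI)
      fix A assume "A \<in> sets (distr U borel T)"
      then have A [measurable]: "A \<in> sets borel" by simp
      have pre: "?b \<inter> T -` A = T -` (?b \<inter> A)"
        using T by (auto simp: orthogonal_transformation_norm)
      have "emeasure (distr U borel T) A = emeasure U (T -` A)"
        by (subst emeasure_distr) (auto simp: measurable_cong_sets[OF sU refl] U_def)
      also have "\<dots> = emeasure (span_lborel B) (T -` (?b \<inter> A)) / emeasure (span_lborel B) ?b"
        using measurable_sets[OF Tm A] unfolding U_def pre[symmetric]
        by (subst emeasure_uniform_measure) auto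
      also have "emeasure (span_lborel B) (T -` (?b \<inter> A)) = emeasure (distr (span_lborel B) borel T) (?b \<inter> A)"
        by (subst emeasure_distr) auto
      also have "\<dots> = emeasure (span_lborel B) (?b \<inter> A)"
        by (simp only: span_lborel_orthogonal_invariant[OF B T])
      also have "\<dots> / emeasure (span_lborel B) ?b = emeasure U A"
        unfolding U_def by (subst emeasure_uniform_measure) auto
      finally show "emeasure (distr U borel T) A = emeasure U A" .
    qed (simp add: sU)
    let ?TT = "\<lambda>p. (T ` fst p, T (snd p))"
    have TTm [measurable]: "?TT \<in> M \<Otimes>\<^sub>M U \<rightarrow>\<^sub>M M \<Otimes>\<^sub>M U"
      by (intro measurable_Pair measurable_compose[OF _ Tim] measurable_compose[OF sndm])
         (auto simp: measurable_cong_sets[OF refl sU])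
    have inv: "distr (M \<Otimes>\<^sub>M U) (M \<Otimes>\<^sub>M U) ?TT = M \<Otimes>\<^sub>M U"
    proof -
      have TU: "T \<in> U \<rightarrow>\<^sub>M borel" by (simp add: measurable_cong_sets[OF sU refl])
      have sf: "sigma_finite_measure (distr U borel T)" unfolding iU by unfold_locales
      have "distr M M ((`) T) \<Otimes>\<^sub>M distr U borel T = distr (M \<Otimes>\<^sub>M U) (M \<Otimes>\<^sub>M borel) (\<lambda>(x, y). (T ` x, T y))"
        by (rule pair_measure_distr[OF Tim TU sf])
      also have "\<dots> = distr (M \<Otimes>\<^sub>M U) (M \<Otimes>\<^sub>M U) ?TT"
        by (rule distr_cong) (auto intro!: sets_pair_measure_cong simp: sU)
      finally show ?thesis by (simp add: iU iM[OF T])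
    qed
    \<comment> \<open>Equivariance is restricted to good pairs, since \<open>T\<close> need not fix
      the default \<open>\<xi>0\<close>; the other pairs form a null set.\<close>
    have eq: "T ` \<Psi> p = \<Psi> (?TT p)" if g: "good p" and p: "p \<in> space (M \<Otimes>\<^sub>M U)" for p
    proof -
      have sub: "subspace (fst p)" using fst_sp[OF p] by (rule grassmannian_memD(1))
      have "good (?TT p)"
        using g T inj by (auto simp: good_def closest_point_orthogonal_image[OF T(1) sub] inj_eq)
      then show ?thesis
        using g by (simp add: \<Psi>_def linear_span_image[OF lin] flip: image_insert)
    qed
    have "distr N N ((`) T) = distr N (grassmannian_borel V (Suc j)) ((`) T)"
      by (rule distr_cong) (auto simp: N_def)
    also have "\<dots> = distr (M \<Otimes>\<^sub>M U) (grassmannian_borel V (Suc j)) (\<lambda>p. T ` \<Psi> p)"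
      unfolding N_def by (subst distr_distr) (auto simp: comp_def)
    also have "\<dots> = distr (M \<Otimes>\<^sub>M U) (grassmannian_borel V (Suc j)) (\<lambda>p. \<Psi> (?TT p))"
    proof (rule distr_cong_AE)
      show "AE p in M \<Otimes>\<^sub>M U. T ` \<Psi> p = \<Psi> (?TT p)"
        using AE_good AE_space[of "M \<Otimes>\<^sub>M U"] by eventually_elim (rule eq)
    qed measurable
    also have "\<dots> = distr (distr (M \<Otimes>\<^sub>M U) (M \<Otimes>\<^sub>M U) ?TT) (grassmannian_borel V (Suc j)) \<Psi>"
      by (subst distr_distr) (auto simp: comp_def)
    also have "\<dots> = N" unfolding inv N_def ..
    finally show "distr N N ((`) T) = N" .
  qed
  then show ?thesis by blast
qed

lemma invariant_prob_0:
  fixes V :: "(real^'n) set"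
  assumes V: "subspace V"
  shows "invariant_prob V 0 (return (grassmannian_borel V 0) {0})"
proof -
  let ?M = "return (grassmannian_borel V 0) {0}"
  have z: "{0} \<in> space (grassmannian_borel V 0)"
    using subspace_0[OF V] by (simp add: space_grassmannian_borel grassmannian_def)
  show ?thesis
    unfolding invariant_prob_def
  proof (intro conjI allI impI)
    show "prob_space ?M" by (rule prob_space_return[OF z])
    fix T :: "real^'n \<Rightarrow> real^'n" assume T: "orthogonal_transformation T \<and> T ` V = V"
    then have "T 0 = 0" using linear_0 orthogonal_transformation_linear by blast
    have "distr ?M ?M ((`) T) = distr ?M (grassmannian_borel V 0) ((`) T)"
      by (rule distr_cong) auto
    also have "\<dots> = return (grassmannian_borel V 0) (T ` {0})"
      using T by (intro distr_return measurable_grassmannian_image z) auto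
    finally show "distr ?M ?M ((`) T) = ?M" using \<open>T 0 = 0\<close> by simp
  qed simp
qed

lemma invariant_prob_exists:
  fixes V :: "(real^'n) set"
  assumes V: "subspace V"
  shows "j \<le> dim V \<Longrightarrow> \<exists>M. invariant_prob V j M"
proof (induction j)
  case 0
  then show ?case using invariant_prob_0[OF V] by blast
next
  case (Suc j)
  then show ?case using invariant_prob_Suc[OF V] by (meson Suc_leD)
qed

lemma invariant_prob_grassmannian_measure:
  fixes V :: "(real^'n) set"
  assumes "subspace V" "j \<le> dim V"
  shows "invariant_prob V j (grassmannian_measure V j)"
  unfolding grassmannian_measure_def using invariant_prob_exists[OF assms] by (rule someI_ex)

section \<open>Distance from a fixed vector to a random subspace\<close>

lemma nn_integral_invariant_sphere:
  fixes V :: "(real^'n) set"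
  assumes M: "invariant_prob V j M" and V: "subspace V" and vw: "v \<in> V" "w \<in> V" "norm v = norm w"
    and [measurable]: "\<phi> \<in> borel_measurable borel"
  shows "(\<integral>\<^sup>+\<xi>. \<phi> (infdist w \<xi>) \<partial>M) = (\<integral>\<^sup>+\<xi>. \<phi> (infdist v \<xi>) \<partial>M)"
proof -
  have sM [measurable_cong]: "sets M = sets (grassmannian_borel V j)"
    and iM: "\<And>T. orthogonal_transformation T \<Longrightarrow> T ` V = V \<Longrightarrow> distr M M ((`) T) = M"
    using M by (auto simp: invariant_prob_def)
  have spM: "space M = grassmannian V j"
    using sets_eq_imp_space_eq[OF sM] by (simp add: space_grassmannian_borel)
  obtain T where T: "orthogonal_transformation T" "T ` V = V" "T v = w"
    using orthogonal_transformation_swap[OF V vw] .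
  have Tim: "(`) T \<in> M \<rightarrow>\<^sub>M M"
    using measurable_grassmannian_image[OF T(1,2), of j] by (simp add: measurable_cong_sets[OF sM sM])
  have [measurable]: "(\<lambda>\<xi>. \<xi>) \<in> M \<rightarrow>\<^sub>M grassmannian_borel V j"
    by (simp add: measurable_cong_sets[OF sM refl])
  have "(\<integral>\<^sup>+\<xi>. \<phi> (infdist w \<xi>) \<partial>M) = (\<integral>\<^sup>+\<xi>. \<phi> (infdist w \<xi>) \<partial>distr M M ((`) T))"
    by (simp only: iM[OF T(1,2)])
  also have "\<dots> = (\<integral>\<^sup>+\<xi>. \<phi> (infdist w (T ` \<xi>)) \<partial>M)"
    by (rule nn_integral_distr[OF Tim]) measurable
  also have "\<dots> = (\<integral>\<^sup>+\<xi>. \<phi> (infdist v \<xi>) \<partial>M)"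
    by (intro nn_integral_cong)
      (auto simp: spM grassmannian_def infdist_orthogonal_image[OF T(1)] simp flip: T(3))
  finally show ?thesis .
qed

text \<open>Average over \<open>v\<close> in the unit ball of \<open>V\<close>: the integral over \<open>M\<close> depends on \<open>norm v\<close> only,
  and for each fixed \<open>\<xi>\<close> the average splits along \<open>V = \<xi> + \<xi>\<^sup>\<bottom>\<close>.\<close>

lemma nn_integral_infdist_grassmannian:
  fixes V :: "(real^'n) set"
  assumes M: "invariant_prob V j M" and V: "subspace V" and j: "0 < j" and l: "0 < l" and jl: "dim V = j + l"
    and v: "v \<in> V" "v \<noteq> 0" and \<phi> [measurable]: "\<phi> \<in> borel_measurable borel"
  defines "s \<equiv> norm v"
  shows "(\<integral>\<^sup>+\<xi>. \<phi> (infdist v \<xi>) \<partial>M) =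
    ennreal (sphere_area (j - 1) * sphere_area (l - 1) / sphere_area (j + l - 1) / s ^ (j + l - 2)) *
      (\<integral>\<^sup>+r. ennreal ((s\<^sup>2 - r\<^sup>2) powr (real j / 2 - 1) * r ^ (l - 1)) * indicator {0<..<s} r * \<phi> r \<partial>lborel)"
    (is "?\<Phi> = _ * ?I")
proof -
  have sM [measurable_cong]: "sets M = sets (grassmannian_borel V j)" and pM: "prob_space M"
    using M by (auto simp: invariant_prob_def)
  have spM: "space M = grassmannian V j"
    using sets_eq_imp_space_eq[OF sM] by (simp add: space_grassmannian_borel)
  have [measurable]: "(\<lambda>\<xi>. \<xi>) \<in> M \<rightarrow>\<^sub>M grassmannian_borel V j"
    by (simp add: measurable_cong_sets[OF sM refl])
  have s: "s > 0" using v by (simp add: s_def)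
  obtain B where B: "onb B V" using onb_exists[OF V] by blast
  have cB: "card B = j + l" using onb_card[OF B] jl by simp
  interpret M: prob_space M by fact
  interpret E: sigma_finite_measure "span_lborel B" by (rule sigma_finite_span_lborel[OF B])
  interpret EM: pair_sigma_finite "span_lborel B" M ..
  let ?b = "cball (0::real^'n) 1"
  have bm [measurable]: "?b \<in> sets borel" by (simp add: borel_closed)
  \<comment> \<open>\<open>s * infdist x \<xi> / norm x\<close> is the distance to \<xi> from
    \<open>x\<close> rescaled to norm \<open>s\<close>. By invariance its integral over \<xi> is the
    same for all nonzero \<open>x\<close> in \<open>V\<close>, so averaging over the ball only
    contributes the volume of the ball.\<close>
  let ?G = "\<lambda>x \<xi>. indicator ?b x * \<phi> (s * infdist x \<xi> / norm x)"
  have Gm: "case_prod ?G \<in> borel_measurable (span_lborel B \<Otimes>\<^sub>M M)"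
  proof -
    have [measurable]: "fst \<in> span_lborel B \<Otimes>\<^sub>M M \<rightarrow>\<^sub>M borel" "snd \<in> span_lborel B \<Otimes>\<^sub>M M \<rightarrow>\<^sub>M grassmannian_borel V j"
      by measurable
    have "(\<lambda>p. indicator ?b (fst p) * \<phi> (s * infdist (fst p) (snd p) / norm (fst p))) \<in> borel_measurable (span_lborel B \<Otimes>\<^sub>M M)"
      by measurable
    then show ?thesis by (simp add: split_beta')
  qed
  \<comment> \<open>The rescaling fails at the origin, which is null because \<open>V\<close> has
    positive dimension.\<close>
  have x0: "AE x in span_lborel B. x \<noteq> 0"
    using AE_span_lborel_not_in[OF B, of "{0}"] subspace_0[OF V] jl j by (simp add: subspace_single_0)
  have "?\<Phi> * ennreal (unit_ball_vol (real (j + l))) = (\<integral>\<^sup>+x. ?\<Phi> * indicator ?b x \<partial>span_lborel B)"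
    using emeasure_span_lborel_cball[OF B, of 1] cB by (simp add: nn_integral_cmult)
  also have "\<dots> = (\<integral>\<^sup>+x. (\<integral>\<^sup>+\<xi>. ?G x \<xi> \<partial>M) \<partial>span_lborel B)"
    using AE_span_lborel_in[OF B] x0
  proof (intro nn_integral_cong_AE, eventually_elim)
    case (elim x)
    let ?w = "(s / norm x) *\<^sub>R x"
    have w: "?w \<in> V" "norm v = norm ?w"
      using elim V s by (auto simp: subspace_scale s_def)
    have "infdist ?w \<xi> = s * infdist x \<xi> / norm x" if "\<xi> \<in> space M" for \<xi>
      using that s by (simp add: spM grassmannian_def infdist_subspace_scale)
    then have "(\<integral>\<^sup>+\<xi>. \<phi> (s * infdist x \<xi> / norm x) \<partial>M) = (\<integral>\<^sup>+\<xi>. \<phi> (infdist ?w \<xi>) \<partial>M)"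
      by (intro nn_integral_cong) simp
    also have "\<dots> = ?\<Phi>" by (rule nn_integral_invariant_sphere[OF M V v(1) w \<phi>])
    finally have *: "(\<integral>\<^sup>+\<xi>. \<phi> (s * infdist x \<xi> / norm x) \<partial>M) = ?\<Phi>" .
    show ?case by (subst nn_integral_cmult) (auto simp: * mult.commute)
  qed
  also have "\<dots> = (\<integral>\<^sup>+\<xi>. (\<integral>\<^sup>+x. ?G x \<xi> \<partial>span_lborel B) \<partial>M)"
    by (rule EM.Fubini'[symmetric, OF Gm])
  also have "\<dots> = (\<integral>\<^sup>+\<xi>. ennreal (sphere_area (j - 1) * sphere_area (l - 1) / (real (j + l) * s ^ (j + l - 2))) * ?I \<partial>M)"
  proof (intro nn_integral_cong)
    fix \<xi> assume "\<xi> \<in> space M"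
    then have \<xi>: "subspace \<xi>" "\<xi> \<subseteq> V" "dim \<xi> = j" by (auto simp: spM grassmannian_def)
    \<comment> \<open>The basis adapted to \<xi> varies with \<xi>, but it computes the same measure
      as \<open>B\<close>. The value found no longer involves \<xi>, so the outer integral over the
      probability measure \<open>M\<close> is trivial.\<close>
    obtain B1 where B1: "onb B1 \<xi>" using onb_exists[OF \<xi>(1)] by blast
    obtain B2 where B2: "onb (B1 \<union> B2) V" "B1 \<inter> B2 = {}" using onb_extend[OF B1 \<xi>(2) V] .
    have c1: "card B1 = j" using onb_card[OF B1] \<xi> by simp
    have "card B1 + card B2 = j + l"
      using onb_card[OF B2(1)] onb_finite[OF B2(1)] B2(2) jl by (simp add: card_Un_disjoint)
    then have c2: "card B2 = l" using c1 by simp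
    have ne: "B1 \<noteq> {}" "B2 \<noteq> {}" using c1 c2 j l by auto
    let ?q = "\<lambda>x. norm (\<Sum>b\<in>B2. (x \<bullet> b) *\<^sub>R b)"
    have q: "infdist x \<xi> = ?q x" if "x \<in> V" for x
    proof -
      have "x = (\<Sum>b\<in>B1 \<union> B2. (x \<bullet> b) *\<^sub>R b)" by (rule onb_expand[OF B2(1) that, symmetric])
      also have "\<dots> = closest_point \<xi> x + (\<Sum>b\<in>B2. (x \<bullet> b) *\<^sub>R b)"
        using onb_finite[OF B2(1)] B2(2) by (simp add: sum.union_disjoint closest_point_onb[OF B1])
      finally have "x - closest_point \<xi> x = (\<Sum>b\<in>B2. (x \<bullet> b) *\<^sub>R b)" by (metis add_diff_cancel_left')
      then show ?thesis by (simp add: infdist_subspace[OF \<xi>(1)])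
    qed
    let ?H = "\<lambda>R r. indicator {..1} R * \<phi> (s * r / R)"
    have "(\<integral>\<^sup>+x. ?G x \<xi> \<partial>span_lborel B) = (\<integral>\<^sup>+x. ?H (norm x) (?q x) \<partial>span_lborel B)"
      using AE_span_lborel_in[OF B] by (intro nn_integral_cong_AE, eventually_elim) (auto simp: q indicator_def)
    also have "\<dots> = (\<integral>\<^sup>+x. ?H (norm x) (?q x) \<partial>span_lborel (B1 \<union> B2))"
      by (simp only: span_lborel_basis_independent[OF B B2(1)])
    also have "\<dots> = (\<integral>\<^sup>+r. ennreal (sphere_area (l - 1) * r ^ (l - 1)) * indicator {0<..} r *
        (\<integral>\<^sup>+R. ennreal (sphere_area (j - 1) * (R\<^sup>2 - r\<^sup>2) powr (real j / 2 - 1) * R)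
          * indicator {r<..} R * ?H R r \<partial>lborel) \<partial>lborel)"
      unfolding c1[symmetric] c2[symmetric]
      by (rule nn_integral_span_lborel_blocks[OF B2 ne]) measurable
    also have "\<dots> = (\<integral>\<^sup>+r. ennreal (sphere_area (j - 1) * sphere_area (l - 1)) * (ennreal (r ^ (l - 1)) * indicator {0<..} r *
        (\<integral>\<^sup>+R. ennreal ((R\<^sup>2 - r\<^sup>2) powr (real j / 2 - 1) * R) * indicator {r<..} R * ?H R r \<partial>lborel)) \<partial>lborel)"
    proof (intro nn_integral_cong)
      fix r
      have "(\<integral>\<^sup>+R. ennreal (sphere_area (j - 1) * (R\<^sup>2 - r\<^sup>2) powr (real j / 2 - 1) * R)
          * indicator {r<..} R * ?H R r \<partial>lborel)
        = (\<integral>\<^sup>+R. ennreal (sphere_area (j - 1)) * (ennreal ((R\<^sup>2 - r\<^sup>2) powr (real j / 2 - 1) * R)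
          * indicator {r<..} R * ?H R r) \<partial>lborel)"
        by (simp only: mult.assoc ennreal_mult'[OF less_imp_le[OF sphere_area_pos]])
      also have "\<dots> = ennreal (sphere_area (j - 1)) * (\<integral>\<^sup>+R. ennreal ((R\<^sup>2 - r\<^sup>2) powr (real j / 2 - 1) * R)
          * indicator {r<..} R * ?H R r \<partial>lborel)"
        by (rule nn_integral_cmult) measurable
      finally show "ennreal (sphere_area (l - 1) * r ^ (l - 1)) * indicator {0<..} r *
        (\<integral>\<^sup>+R. ennreal (sphere_area (j - 1) * (R\<^sup>2 - r\<^sup>2) powr (real j / 2 - 1) * R)
          * indicator {r<..} R * ?H R r \<partial>lborel)
        = ennreal (sphere_area (j - 1) * sphere_area (l - 1)) * (ennreal (r ^ (l - 1)) * indicator {0<..} r *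
        (\<integral>\<^sup>+R. ennreal ((R\<^sup>2 - r\<^sup>2) powr (real j / 2 - 1) * R) * indicator {r<..} R * ?H R r \<partial>lborel))"
        by (simp only: ennreal_mult'[OF less_imp_le[OF sphere_area_pos]] mult_ac)
    qed
    also have "\<dots> = ennreal (sphere_area (j - 1) * sphere_area (l - 1)) *
        (\<integral>\<^sup>+r. ennreal (r ^ (l - 1)) * indicator {0<..} r *
        (\<integral>\<^sup>+R. ennreal ((R\<^sup>2 - r\<^sup>2) powr (real j / 2 - 1) * R) * indicator {r<..} R * ?H R r \<partial>lborel) \<partial>lborel)"
    proof (rule nn_integral_cmult)
      have "(\<lambda>r. \<integral>\<^sup>+R. (ennreal ((R\<^sup>2 - r\<^sup>2) powr (real j / 2 - 1) * R) * ?H R r) * indicator {r<..} R \<partial>lborel)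
          \<in> borel_measurable borel"
        by (rule measurable_nn_integral_greaterThan) measurable
      then have [measurable]: "(\<lambda>r. \<integral>\<^sup>+R. ennreal ((R\<^sup>2 - r\<^sup>2) powr (real j / 2 - 1) * R) * indicator {r<..} R * ?H R r \<partial>lborel)
          \<in> borel_measurable borel"
        by (simp only: mult_ac)
      show "(\<lambda>r. ennreal (r ^ (l - 1)) * indicator {0<..} r *
        (\<integral>\<^sup>+R. ennreal ((R\<^sup>2 - r\<^sup>2) powr (real j / 2 - 1) * R) * indicator {r<..} R * ?H R r \<partial>lborel)) \<in> borel_measurable lborel"
        by measurable
    qed
    also have "\<dots> = ennreal (sphere_area (j - 1) * sphere_area (l - 1)) *
        (ennreal (1 / (real (j + l) * s ^ (j + l - 2))) * ?I)"
      by (simp only: angular_integral[OF j l s \<phi>])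
    also have "\<dots> = ennreal (sphere_area (j - 1) * sphere_area (l - 1) / (real (j + l) * s ^ (j + l - 2))) * ?I"
      using s less_imp_le[OF sphere_area_pos] by (simp add: mult.assoc[symmetric] ennreal_mult[symmetric])
    finally show "(\<integral>\<^sup>+x. ?G x \<xi> \<partial>span_lborel B)
      = ennreal (sphere_area (j - 1) * sphere_area (l - 1) / (real (j + l) * s ^ (j + l - 2))) * ?I" .
  qed
  also have "\<dots> = ennreal (sphere_area (j - 1) * sphere_area (l - 1) / (real (j + l) * s ^ (j + l - 2))) * ?I"
    by (simp add: M.emeasure_space_1)
  finally have main: "?\<Phi> * ennreal (unit_ball_vol (real (j + l))) =
    ennreal (sphere_area (j - 1) * sphere_area (l - 1) / (real (j + l) * s ^ (j + l - 2))) * ?I" .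
  let ?\<omega> = "unit_ball_vol (real (j + l))"
  have \<omega>: "?\<omega> > 0" "?\<omega> = sphere_area (j + l - 1) / real (j + l)"
    using j unit_ball_vol_sphere_area[of "j + l"] unit_ball_vol_pos[of "real (j + l)"]
    by (simp_all del: of_nat_add)
  have \<omega>0: "0 \<le> 1 / ?\<omega>" "0 \<le> ?\<omega>" "?\<omega> * (1 / ?\<omega>) = 1"
    using \<omega>(1) less_imp_neq[OF \<omega>(1), symmetric] by (simp_all del: of_nat_add)
  \<comment> \<open>\<open>?\<Phi>\<close> may be infinite, so the ball volume is removed by
    multiplying with its inverse. The volume equals the sphere area divided by j+l, which cancels
    the 1 / (j+l) of \<open>angular_integral\<close>.\<close>
  have "?\<Phi> = ?\<Phi> * ennreal (?\<omega> * (1 / ?\<omega>))" by (simp only: \<omega>0(3) ennreal_1 mult_1_right)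
  also have "\<dots> = (?\<Phi> * ennreal ?\<omega>) * ennreal (1 / ?\<omega>)"
    by (simp only: ennreal_mult[OF \<omega>0(2,1)] mult.assoc)
  also have "\<dots> = ennreal (1 / ?\<omega> * (sphere_area (j - 1) * sphere_area (l - 1) / (real (j + l) * s ^ (j + l - 2)))) * ?I"
    unfolding main ennreal_mult'[OF \<omega>0(1)] by (simp only: mult_ac)
  also have "1 / ?\<omega> * (sphere_area (j - 1) * sphere_area (l - 1) / (real (j + l) * s ^ (j + l - 2)))
      = sphere_area (j - 1) * sphere_area (l - 1) / sphere_area (j + l - 1) / s ^ (j + l - 2)"
    unfolding \<omega>(2) using s j by simp
  finally show ?thesis .
qed

section \<open>Pushforwards and kernel estimates\<close>

lemma measurable_indicator_greaterThan [measurable (raw)]: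
  fixes f g :: "'a \<Rightarrow> real"
  assumes [measurable]: "f \<in> borel_measurable M" "g \<in> borel_measurable M"
  shows "(\<lambda>x. indicator {f x<..} (g x) :: 'b::{zero_neq_one, second_countable_topology}) \<in> borel_measurable M"
    and "(\<lambda>x. indicator {h<..<f x} (g x) :: 'b) \<in> borel_measurable M"
  unfolding indicator_def of_bool_def greaterThan_iff greaterThanLessThan_iff by measurable

text \<open>The bridge from integrals over \<open>lebesgue\<close> or
  \<open>subspace_lebesgue\<close> to Borel ones. Measurability of \<open>f\<close> is a conclusion:
  where preimages under \<open>f\<close> and \<open>h\<close> differ is a subset of a null set,
  hence measurable in the completion.\<close>

lemma completion_AE_eq:
  fixes f h :: "'a \<Rightarrow> real"
  assumes h [measurable]: "h \<in> borel_measurable M" and eq: "AE x in M. f x = h x"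
  shows "f \<in> borel_measurable (completion M)"
    and "integrable (completion M) f \<longleftrightarrow> integrable M h"
    and "integral\<^sup>L (completion M) f = integral\<^sup>L M h"
proof -
  have hc [measurable]: "h \<in> borel_measurable (completion M)" by (rule measurable_completion[OF h])
  show f: "f \<in> borel_measurable (completion M)"
  proof (rule measurableI)
    fix A :: "real set" assume [measurable]: "A \<in> sets borel"
    have "AE x in M. \<not> ((f x \<in> A) \<noteq> (h x \<in> A))" using eq by eventually_elim simp
    then have [measurable]: "Measurable.pred (completion M) (\<lambda>x. (f x \<in> A) \<noteq> (h x \<in> A))"
      by (rule sets_completion_AE)
    \<comment> \<open>\<open>f x \<in> A\<close> is recovered as the exclusive or of
      \<open>h x \<in> A\<close> and the disagreement of the two.\<close>
    have "Measurable.pred (completion M) (\<lambda>x. (h x \<in> A) \<noteq> ((f x \<in> A) \<noteq> (h x \<in> A)))"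
      by measurable
    moreover have "(\<lambda>x. (h x \<in> A) \<noteq> ((f x \<in> A) \<noteq> (h x \<in> A))) = (\<lambda>x. f x \<in> A)" by auto
    ultimately have "Measurable.pred (completion M) (\<lambda>x. f x \<in> A)" by simp
    then show "f -` A \<inter> space (completion M) \<in> sets (completion M)"
      by (simp add: pred_def vimage_def Int_def conj_commute)
  qed simp
  have eqc: "AE x in completion M. f x = h x" using eq by (rule AE_completion)
  show "integrable (completion M) f \<longleftrightarrow> integrable M h"
    using integrable_cong_AE[OF f hc eqc] integrable_completion[OF h] by simp
  show "integral\<^sup>L (completion M) f = integral\<^sup>L M h"
    using integral_cong_AE[OF f hc eqc] integral_completion[OF h] by simp
qed

lemma distr_span_lborel_shifted_norm:
  assumes B: "onb B V" "B \<noteq> {}" and d: "0 \<le> d"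
  shows "distr (span_lborel B) borel (\<lambda>u. sqrt ((norm u)\<^sup>2 + d\<^sup>2)) = density lborel (\<lambda>t. ennreal
    (sphere_area (card B - 1) * (indicator {d<..} t * ((t\<^sup>2 - d\<^sup>2) powr (real (card B) / 2 - 1) * t))))"
proof -
  have "distr (span_lborel B) borel (\<lambda>u. sqrt ((norm u)\<^sup>2 + d\<^sup>2))
    = distr (\<Pi>\<^sub>M b\<in>B. lborel) borel (\<lambda>x. sqrt ((norm (\<Sum>b\<in>B. x b *\<^sub>R b))\<^sup>2 + d\<^sup>2))"
    unfolding span_lborel_def by (subst distr_distr) (auto simp: comp_def intro: measurable_span_lborel_sum)
  also have "\<dots> = distr (\<Pi>\<^sub>M b\<in>B. lborel) borel (\<lambda>x. sqrt ((\<Sum>b\<in>B. (x b)\<^sup>2) + d\<^sup>2))"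
    by (simp add: onb_norm_sum[OF B(1)] sum_nonneg)
  also have "\<dots> = density lborel (\<lambda>t. ennreal (sphere_area (card B - 1) * (t\<^sup>2 - d\<^sup>2) powr (real (card B) / 2 - 1) * t)
        * indicator {d<..} t)"
    by (rule distr_PiM_shifted_norm[OF onb_finite[OF B(1)] B(2) d])
  also have "\<dots> = density lborel (\<lambda>t. ennreal
    (sphere_area (card B - 1) * (indicator {d<..} t * ((t\<^sup>2 - d\<^sup>2) powr (real (card B) / 2 - 1) * t))))"
    by (intro arg_cong2[where f=density] ext) (auto split: split_indicator simp: mult_ac)
  finally show ?thesis .
qed

text \<open>Both sides are integrals of \<open>g\<close> against one and the same measure on the
  line, so integrability and value are transported together, and the values agree in the divergent
  case as well.\<close>

lemma span_lborel_shifted_norm: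
  fixes g :: "real \<Rightarrow> real"
  assumes B: "onb B V" "B \<noteq> {}" and d: "0 \<le> d" and [measurable]: "g \<in> borel_measurable borel"
  defines "k \<equiv> card B"
  shows "integrable (span_lborel B) (\<lambda>u. g (sqrt ((norm u)\<^sup>2 + d\<^sup>2))) \<longleftrightarrow>
      integrable lborel (\<lambda>t. indicator {d<..} t * (g t * (t\<^sup>2 - d\<^sup>2) powr (real k / 2 - 1) * t))"
    and "(\<integral>u. g (sqrt ((norm u)\<^sup>2 + d\<^sup>2)) \<partial>span_lborel B) = sphere_area (k - 1) *
      (\<integral>t. indicator {d<..} t * (g t * (t\<^sup>2 - d\<^sup>2) powr (real k / 2 - 1) * t) \<partial>lborel)"
proof -
  let ?w = "\<lambda>t. sphere_area (k - 1) * (indicator {d<..} t * ((t\<^sup>2 - d\<^sup>2) powr (real k / 2 - 1) * t))"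
  let ?p = "\<lambda>u::'a. sqrt ((norm u)\<^sup>2 + d\<^sup>2)"
  have w: "?w t \<ge> 0" for t
    using d by (auto split: split_indicator intro!: mult_nonneg_nonneg less_imp_le[OF sphere_area_pos])
  have D: "distr (span_lborel B) borel ?p = density lborel ?w"
    unfolding k_def by (rule distr_span_lborel_shifted_norm[OF B d])
  have eq: "?w t *\<^sub>R g t = sphere_area (k - 1) * (indicator {d<..} t * (g t * (t\<^sup>2 - d\<^sup>2) powr (real k / 2 - 1) * t))" for t
    by (simp add: mult_ac)
  have "integrable (span_lborel B) (\<lambda>u. g (?p u)) \<longleftrightarrow> integrable (density lborel ?w) g"
    unfolding D[symmetric] by (rule integrable_distr_eq[symmetric]) measurable
  also have "\<dots> \<longleftrightarrow> integrable lborel (\<lambda>t. ?w t *\<^sub>R g t)"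
    using w by (intro integrable_density) auto
  finally show "integrable (span_lborel B) (\<lambda>u. g (?p u)) \<longleftrightarrow>
      integrable lborel (\<lambda>t. indicator {d<..} t * (g t * (t\<^sup>2 - d\<^sup>2) powr (real k / 2 - 1) * t))"
    unfolding eq using sphere_area_pos[of "k - 1"] by simp
  have "(\<integral>u. g (?p u) \<partial>span_lborel B) = (\<integral>t. g t \<partial>density lborel ?w)"
    unfolding D[symmetric] by (rule integral_distr[symmetric]) measurable
  also have "\<dots> = (\<integral>t. ?w t *\<^sub>R g t \<partial>lborel)"
    using w by (intro integral_density) auto
  finally show "(\<integral>u. g (?p u) \<partial>span_lborel B) = sphere_area (k - 1) *
      (\<integral>t. indicator {d<..} t * (g t * (t\<^sup>2 - d\<^sup>2) powr (real k / 2 - 1) * t) \<partial>lborel)"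
    unfolding eq by simp
qed

text \<open>The pushforward has a density, so preimages of null sets are null. This permits changing
  \<open>f0\<close> on a null set without affecting the inner integral.\<close>

lemma AE_span_lborel_shifted_norm:
  assumes B: "onb B V" "B \<noteq> {}" and d: "0 \<le> d" and P: "AE t in lborel. P t"
  shows "AE u in span_lborel B. P (sqrt ((norm u)\<^sup>2 + d\<^sup>2))"
proof -
  obtain N where N: "N \<in> null_sets lborel" "{t. \<not> P t} \<subseteq> N"
    using P by (auto simp: eventually_ae_filter)
  then have [measurable]: "N \<in> sets borel" by auto
  have "AE t in distr (span_lborel B) borel (\<lambda>u. sqrt ((norm u)\<^sup>2 + d\<^sup>2)). t \<notin> N"
    unfolding distr_span_lborel_shifted_norm[OF B d]
    using AE_not_in[OF N(1)] by (subst AE_density) auto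
  then have "AE u in span_lborel B. sqrt ((norm u)\<^sup>2 + d\<^sup>2) \<notin> N"
    by (subst (asm) AE_distr_iff) auto
  then show ?thesis by eventually_elim (use N in blast)
qed

lemma distr_infdist_grassmannian:
  fixes V :: "(real^'n) set"
  assumes M: "invariant_prob V j M" and V: "subspace V" and j: "0 < j" and l: "0 < l" and jl: "dim V = j + l"
    and v: "v \<in> V" "v \<noteq> 0"
  defines "s \<equiv> norm v"
  shows "distr M borel (infdist v) = density lborel (\<lambda>r. ennreal
    (sphere_area (j - 1) * sphere_area (l - 1) / sphere_area (j + l - 1) / s ^ (j + l - 2) *
      (indicator {0<..<s} r * ((s\<^sup>2 - r\<^sup>2) powr (real j / 2 - 1) * r ^ (l - 1)))))" 
proof -
  let ?w = "\<lambda>r. indicator {0<..<s} r * ((s\<^sup>2 - r\<^sup>2) powr (real j / 2 - 1) * r ^ (l - 1))"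
  define C where "C = sphere_area (j - 1) * sphere_area (l - 1) / sphere_area (j + l - 1) / s ^ (j + l - 2)"
  have sM [measurable_cong]: "sets M = sets (grassmannian_borel V j)"
    using M by (auto simp: invariant_prob_def)
  have [measurable]: "(\<lambda>\<xi>. \<xi>) \<in> M \<rightarrow>\<^sub>M grassmannian_borel V j"
    by (simp add: measurable_cong_sets[OF sM refl])
  have m [measurable]: "infdist v \<in> borel_measurable M" by measurable
  have C: "C \<ge> 0"
    by (auto simp: C_def s_def intro!: divide_nonneg_nonneg mult_nonneg_nonneg less_imp_le[OF sphere_area_pos])
  have "distr M borel (infdist v) = density lborel (\<lambda>r. ennreal (C * ?w r))"
  proof (rule measure_eqI)
    fix A assume "A \<in> sets (distr M borel (infdist v))"
    then have [measurable]: "A \<in> sets borel" by simp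
    have "emeasure (distr M borel (infdist v)) A = (\<integral>\<^sup>+r. indicator A r \<partial>distr M borel (infdist v))" by simp
    also have "\<dots> = (\<integral>\<^sup>+\<xi>. indicator A (infdist v \<xi>) \<partial>M)" by (rule nn_integral_distr) measurable
    also have "\<dots> = ennreal C * (\<integral>\<^sup>+r. ennreal ((s\<^sup>2 - r\<^sup>2) powr (real j / 2 - 1) * r ^ (l - 1)) * indicator {0<..<s} r * indicator A r \<partial>lborel)"
      unfolding s_def C_def by (rule nn_integral_infdist_grassmannian[OF M V j l jl v]) measurable
    also have "\<dots> = (\<integral>\<^sup>+r. ennreal (C * ?w r) * indicator A r \<partial>lborel)"
      by (subst nn_integral_cmult[symmetric], measurable)
         (auto intro!: nn_integral_cong split: split_indicator simp: ennreal_mult'[OF C])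
    also have "\<dots> = emeasure (density lborel (\<lambda>r. ennreal (C * ?w r))) A"
      by (rule emeasure_density[symmetric]) measurable
    finally show "emeasure (distr M borel (infdist v)) A = emeasure (density lborel (\<lambda>r. ennreal (C * ?w r))) A" .
  qed simp
  then show ?thesis unfolding C_def .
qed

text \<open>The density of \<open>infdist v\<close> transports integrals as before. The third claim
  is an equivalence because the density is positive on all of (0, s) and zero elsewhere.\<close>

lemma infdist_grassmannian:
  fixes V :: "(real^'n) set" and F :: "real \<Rightarrow> real"
  assumes M: "invariant_prob V j M" and V: "subspace V" and j: "0 < j" and l: "0 < l" and jl: "dim V = j + l"
    and v: "v \<in> V" "v \<noteq> 0" and F [measurable]: "F \<in> borel_measurable borel"
  defines "s \<equiv> norm v"
  shows "integrable M (\<lambda>\<xi>. F (infdist v \<xi>)) \<longleftrightarrow>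
      integrable lborel (\<lambda>r. indicator {0<..<s} r * ((s\<^sup>2 - r\<^sup>2) powr (real j / 2 - 1) * r ^ (l - 1) * F r))"
    and "(\<integral>\<xi>. F (infdist v \<xi>) \<partial>M) =
      sphere_area (j - 1) * sphere_area (l - 1) / sphere_area (j + l - 1) / s ^ (j + l - 2) *
      (\<integral>r. indicator {0<..<s} r * ((s\<^sup>2 - r\<^sup>2) powr (real j / 2 - 1) * r ^ (l - 1) * F r) \<partial>lborel)"
    and "Measurable.pred borel P \<Longrightarrow>
      (AE \<xi> in M. P (infdist v \<xi>)) \<longleftrightarrow> (AE r in lborel. r \<in> {0<..<s} \<longrightarrow> P r)"
proof -
  define C where "C = sphere_area (j - 1) * sphere_area (l - 1) / sphere_area (j + l - 1) / s ^ (j + l - 2)"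
  let ?w = "\<lambda>r. C * (indicator {0<..<s} r * ((s\<^sup>2 - r\<^sup>2) powr (real j / 2 - 1) * r ^ (l - 1)))"
  have s: "s > 0" using v by (simp add: s_def)
  have C: "C > 0" using s by (auto simp: C_def sphere_area_pos intro!: divide_pos_pos mult_pos_pos)
  have sM [measurable_cong]: "sets M = sets (grassmannian_borel V j)"
    using M by (auto simp: invariant_prob_def)
  have [measurable]: "(\<lambda>\<xi>. \<xi>) \<in> M \<rightarrow>\<^sub>M grassmannian_borel V j"
    by (simp add: measurable_cong_sets[OF sM refl])
  have m [measurable]: "infdist v \<in> borel_measurable M" by measurable
  have D: "distr M borel (infdist v) = density lborel ?w"
    unfolding C_def s_def by (rule distr_infdist_grassmannian[OF M V j l jl v])
  have w: "?w r \<ge> 0" for r using C by (auto split: split_indicator)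
  have eq: "?w r *\<^sub>R F r = C * (indicator {0<..<s} r * ((s\<^sup>2 - r\<^sup>2) powr (real j / 2 - 1) * r ^ (l - 1) * F r))" for r
    by simp
  have "integrable M (\<lambda>\<xi>. F (infdist v \<xi>)) \<longleftrightarrow> integrable (density lborel ?w) F"
    unfolding D[symmetric] by (rule integrable_distr_eq[symmetric]) measurable
  also have "\<dots> \<longleftrightarrow> integrable lborel (\<lambda>r. ?w r *\<^sub>R F r)"
    using w by (intro integrable_density) auto
  finally show "integrable M (\<lambda>\<xi>. F (infdist v \<xi>)) \<longleftrightarrow>
      integrable lborel (\<lambda>r. indicator {0<..<s} r * ((s\<^sup>2 - r\<^sup>2) powr (real j / 2 - 1) * r ^ (l - 1) * F r))"
    unfolding eq using C by simp
  have "(\<integral>\<xi>. F (infdist v \<xi>) \<partial>M) = (\<integral>r. F r \<partial>density lborel ?w)"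
    unfolding D[symmetric] by (rule integral_distr[symmetric]) measurable
  also have "\<dots> = (\<integral>r. ?w r *\<^sub>R F r \<partial>lborel)"
    using w by (intro integral_density) auto
  finally show "(\<integral>\<xi>. F (infdist v \<xi>) \<partial>M) =
      sphere_area (j - 1) * sphere_area (l - 1) / sphere_area (j + l - 1) / s ^ (j + l - 2) *
      (\<integral>r. indicator {0<..<s} r * ((s\<^sup>2 - r\<^sup>2) powr (real j / 2 - 1) * r ^ (l - 1) * F r) \<partial>lborel)"
    unfolding eq by (simp add: C_def)
  assume P [measurable]: "Measurable.pred borel P"
  have "(AE \<xi> in M. P (infdist v \<xi>)) \<longleftrightarrow> (AE r in distr M borel (infdist v). P r)"
    by (rule AE_distr_iff[symmetric]) measurable
  also have "\<dots> \<longleftrightarrow> (AE r in lborel. 0 < ennreal (?w r) \<longrightarrow> P r)"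
    unfolding D by (rule AE_density) measurable
  also have "\<dots> \<longleftrightarrow> (AE r in lborel. r \<in> {0<..<s} \<longrightarrow> P r)"
  proof -
    have "0 < ennreal (?w r) \<longleftrightarrow> r \<in> {0<..<s}" for r
    proof (cases "r \<in> {0<..<s}")
      case True
      then have "s\<^sup>2 - r\<^sup>2 > 0" by (simp add: power_strict_mono)
      then show ?thesis using True C by simp
    qed simp
    then show ?thesis by simp
  qed
  finally show "(AE \<xi> in M. P (infdist v \<xi>)) \<longleftrightarrow> (AE r in lborel. r \<in> {0<..<s} \<longrightarrow> P r)" .
qed

section \<open>Kernel estimates for local integrability\<close>

lemma inner_kernel_bound:
  assumes k: "0 < k" and l: "0 < l" and m: "0 < m" "m \<le> t"
  shows "(\<integral>\<^sup>+r. ennreal (r ^ (l - 1) * (t\<^sup>2 - r\<^sup>2) powr (real k / 2 - 1) * t) * indicator {0<..<m} r \<partial>lborel)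
    \<le> ennreal (2 * m ^ l * t ^ (k - 1))"
proof -
  define c where "c = m ^ (l - 1) * t ^ (k - 1) * sqrt t"
  have t: "t > 0" using m by simp
  have c0: "c \<ge> 0" using m t by (simp add: c_def)
  have bd: "r ^ (l - 1) * (t\<^sup>2 - r\<^sup>2) powr (real k / 2 - 1) * t \<le> c / sqrt (t - r)" if r: "0 < r" "r < m" for r
  proof -
    have tr: "t - r > 0" using r m by simp
    \<comment> \<open>The exponent k/2 - 1 is split as (k-1)/2 - 1/2. The first power is at most
      t^(k-1); the second is decreasing in its base and is bounded through
      \<open>t * (t - r)\<close>. The singular case k = 1 is covered together with the
      others.\<close>
    have q: "t\<^sup>2 - r\<^sup>2 \<ge> t * (t - r)" "t * (t - r) > 0" "t\<^sup>2 - r\<^sup>2 \<le> t\<^sup>2"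
      using r m t by (auto simp: power2_eq_square algebra_simps)
    have "(t\<^sup>2 - r\<^sup>2) powr (real k / 2 - 1) = (t\<^sup>2 - r\<^sup>2) powr ((real k - 1) / 2) * (t\<^sup>2 - r\<^sup>2) powr (- (1 / 2))"
      by (subst powr_add[symmetric]) (rule arg_cong[of _ _ "\<lambda>p. (t\<^sup>2 - r\<^sup>2) powr p"], simp add: field_simps)
    also have "\<dots> \<le> (t\<^sup>2) powr ((real k - 1) / 2) * (t * (t - r)) powr (- (1 / 2))"
      using q k by (intro mult_mono powr_mono2 powr_mono2') auto
    also have "(t\<^sup>2) powr ((real k - 1) / 2) = t ^ (k - 1)"
    proof -
      have "t\<^sup>2 = t powr 2" using t by simp
      moreover have "2 * ((real k - 1) / 2) = real (k - 1)" using k by (simp add: of_nat_diff)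
      ultimately show ?thesis using t by (simp only: powr_powr powr_realpow)
    qed
    also have "(t * (t - r)) powr (- (1 / 2)) = 1 / (sqrt t * sqrt (t - r))"
      using q(2) by (simp add: powr_minus powr_half_sqrt real_sqrt_mult inverse_eq_divide)
    finally have "(t\<^sup>2 - r\<^sup>2) powr (real k / 2 - 1) \<le> t ^ (k - 1) * (1 / (sqrt t * sqrt (t - r)))" .
    then have "r ^ (l - 1) * (t\<^sup>2 - r\<^sup>2) powr (real k / 2 - 1) * t
        \<le> m ^ (l - 1) * (t ^ (k - 1) * (1 / (sqrt t * sqrt (t - r)))) * t"
      using r t by (intro mult_right_mono mult_mono power_mono) auto
    also have "\<dots> = m ^ (l - 1) * t ^ (k - 1) * (t / sqrt t) / sqrt (t - r)"
      by simp
    also have "\<dots> = c / sqrt (t - r)"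
      using t by (simp only: c_def real_div_sqrt less_imp_le)
    finally show ?thesis .
  qed
  have "(\<integral>\<^sup>+r. ennreal (r ^ (l - 1) * (t\<^sup>2 - r\<^sup>2) powr (real k / 2 - 1) * t) * indicator {0<..<m} r \<partial>lborel)
    \<le> (\<integral>\<^sup>+r. ennreal (c / sqrt (t - r)) * indicator {0<..<m} r \<partial>lborel)"
    using bd by (intro nn_integral_mono) (auto split: split_indicator intro!: ennreal_leI)
  also have "\<dots> = ennreal (- 2 * c * sqrt (t - m) - - 2 * c * sqrt (t - 0))"
  proof (rule nn_integral_FTC_Ioo[OF m(1)])
    fix r assume r: "0 < r" "r < m"
    then have tr: "t - r > 0" using m by simp
    show "((\<lambda>r. - 2 * c * sqrt (t - r)) has_real_derivative c / sqrt (t - r)) (at r)"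
      using tr by (auto intro!: derivative_eq_intros simp: field_simps)
    show "isCont (\<lambda>r. c / sqrt (t - r)) r" using tr by (intro continuous_intros) auto
    show "0 \<le> c / sqrt (t - r)" using c0 tr by simp
  qed (intro continuous_intros)
  also have "\<dots> \<le> ennreal (2 * m ^ l * t ^ (k - 1))"
  proof (rule ennreal_leI)
    \<comment> \<open>The integral of 1 / sqrt(t - r) over (0, m) is twice a difference of square
      roots; multiplied by the sum of the roots, that difference is \<open>m\<close>.\<close>
    have "(sqrt t - sqrt (t - m)) * sqrt t \<le> (sqrt t - sqrt (t - m)) * (sqrt t + sqrt (t - m))"
      using m by (intro mult_left_mono) auto
    also have "\<dots> = m" using m by (simp add: algebra_simps)
    finally have "(sqrt t - sqrt (t - m)) * sqrt t \<le> m" .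
    then have "2 * (m ^ (l - 1) * t ^ (k - 1)) * ((sqrt t - sqrt (t - m)) * sqrt t) \<le> 2 * (m ^ (l - 1) * t ^ (k - 1)) * m"
      using m t by (intro mult_left_mono) auto
    moreover have "2 * (m ^ (l - 1) * t ^ (k - 1)) * m = 2 * m ^ l * t ^ (k - 1)" using l by (cases l) auto
    moreover have "- 2 * c * sqrt (t - m) - - 2 * c * sqrt (t - 0)
        = 2 * (m ^ (l - 1) * t ^ (k - 1)) * ((sqrt t - sqrt (t - m)) * sqrt t)"
      by (simp add: c_def algebra_simps)
    ultimately show "- 2 * c * sqrt (t - m) - - 2 * c * sqrt (t - 0) \<le> 2 * m ^ l * t ^ (k - 1)"
      by (simp only:)
  qed
  finally show ?thesis .
qed

text \<open>On [\<alpha>, \<beta>] the missing factor \<open>s\<close> is supplied by 1 \<le> s /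
  \<alpha>, which makes the integrand an exact derivative; the sphere area is inserted only to reuse
  \<open>nn_integral_shifted_power\<close> and cancels.\<close>

lemma outer_kernel_bound:
  assumes j: "0 < j" and \<alpha>: "0 < \<alpha>" and r: "0 \<le> r"
  shows "(\<integral>\<^sup>+s. ennreal ((s\<^sup>2 - r\<^sup>2) powr (real j / 2 - 1)) * indicator {r<..} s * indicator {\<alpha>..\<beta>} s \<partial>lborel)
    \<le> ennreal (\<beta> ^ j / (\<alpha> * real j)) * indicator {..<\<beta>} r"
proof (cases "r < \<beta>")
  case False
  have "(\<integral>\<^sup>+s. ennreal ((s\<^sup>2 - r\<^sup>2) powr (real j / 2 - 1)) * indicator {r<..} s * indicator {\<alpha>..\<beta>} s \<partial>lborel)
    = (\<integral>\<^sup>+s. 0 \<partial>(lborel :: real measure))"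
    using False by (intro nn_integral_cong) (auto split: split_indicator)
  then show ?thesis by simp
next
  case True
  let ?\<sigma> = "sphere_area (j - 1)"
  have \<sigma>: "?\<sigma> > 0" by (rule sphere_area_pos)
  have \<beta>: "\<beta> > 0" using True r by simp
  have "(\<integral>\<^sup>+s. ennreal ((s\<^sup>2 - r\<^sup>2) powr (real j / 2 - 1)) * indicator {r<..} s * indicator {\<alpha>..\<beta>} s \<partial>lborel)
     \<le> (\<integral>\<^sup>+s. ennreal (1 / (\<alpha> * ?\<sigma>)) * (ennreal (?\<sigma> * (s\<^sup>2 - r\<^sup>2) powr (real j / 2 - 1) * s) * indicator {r<..} s * indicator {..\<beta>} s) \<partial>lborel)"
  proof (intro nn_integral_mono)
    fix s
    have "(s\<^sup>2 - r\<^sup>2) powr (real j / 2 - 1) \<le> 1 / (\<alpha> * ?\<sigma>) * (?\<sigma> * (s\<^sup>2 - r\<^sup>2) powr (real j / 2 - 1) * s)" if "\<alpha> \<le> s"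
    proof -
      have "(s\<^sup>2 - r\<^sup>2) powr (real j / 2 - 1) * 1 \<le> (s\<^sup>2 - r\<^sup>2) powr (real j / 2 - 1) * (s / \<alpha>)"
        using that \<alpha> by (intro mult_left_mono) auto
      then show ?thesis using \<sigma> \<alpha> by simp
    qed
    then show "ennreal ((s\<^sup>2 - r\<^sup>2) powr (real j / 2 - 1)) * indicator {r<..} s * indicator {\<alpha>..\<beta>} s
      \<le> ennreal (1 / (\<alpha> * ?\<sigma>)) * (ennreal (?\<sigma> * (s\<^sup>2 - r\<^sup>2) powr (real j / 2 - 1) * s) * indicator {r<..} s * indicator {..\<beta>} s)"
      using \<sigma> \<alpha> r by (auto split: split_indicator simp: ennreal_mult[symmetric] intro!: ennreal_leI)
  qed
  also have "\<dots> = ennreal (1 / (\<alpha> * ?\<sigma>)) * ennreal (unit_ball_vol (real j) * (\<beta>\<^sup>2 - r\<^sup>2) powr (real j / 2))"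
  proof -
    have "\<not> \<beta> \<le> r" using True by simp
    then show ?thesis by (subst nn_integral_cmult, measurable) (simp only: nn_integral_shifted_power[OF j r] if_False)
  qed
  also have "\<dots> = ennreal (1 / (\<alpha> * real j) * (\<beta>\<^sup>2 - r\<^sup>2) powr (real j / 2))"
    using \<sigma> \<alpha> j by (subst ennreal_mult[symmetric]) (auto simp: unit_ball_vol_sphere_area[OF j] simp del: One_nat_def)
  also have "\<dots> \<le> ennreal (\<beta> ^ j / (\<alpha> * real j))"
  proof (rule ennreal_leI)
    have "(\<beta>\<^sup>2 - r\<^sup>2) powr (real j / 2) \<le> (\<beta>\<^sup>2) powr (real j / 2)"
      using True r by (intro powr_mono2) (auto simp: power_mono)
    also have "\<dots> = \<beta> ^ j"
      using \<beta> by (simp add: powr_powr powr_realpow[symmetric] powr_numeral[symmetric] del: powr_numeral)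
    finally show "1 / (\<alpha> * real j) * (\<beta>\<^sup>2 - r\<^sup>2) powr (real j / 2) \<le> \<beta> ^ j / (\<alpha> * real j)"
      using \<alpha> j by (simp add: divide_right_mono)
  qed
  finally show ?thesis using True by simp
qed

text \<open>The two weights of the hypotheses arise by splitting the kernel bound at
  \<open>a\<close>: min(t, \<beta>) is at most \<open>t\<close> below \<open>a\<close>, giving
  t^(k+l-1), and at most \<beta> above \<open>a\<close>, giving t^(k-1). The point \<open>a\<close>
  itself is null.\<close>

lemma iterated_integral_finite:
  fixes g :: "real \<Rightarrow> real"
  assumes j: "0 < j" and k: "0 < k" and l: "0 < l" and a: "0 < a" and \<alpha>: "0 < \<alpha>" "\<alpha> < \<beta>"
    and [measurable]: "g \<in> borel_measurable borel"
    and near: "(\<integral>\<^sup>+t. ennreal (\<bar>g t\<bar> * t ^ (k + l - 1)) * indicator {0<..<a} t \<partial>lborel) < \<infinity>"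
    and far: "(\<integral>\<^sup>+t. ennreal (\<bar>g t\<bar> * t ^ (k - 1)) * indicator {a<..} t \<partial>lborel) < \<infinity>"
  shows "(\<integral>\<^sup>+s. (\<integral>\<^sup>+r. ennreal ((s\<^sup>2 - r\<^sup>2) powr (real j / 2 - 1) * r ^ (l - 1)) * indicator {0<..<s} r *
      (\<integral>\<^sup>+t. ennreal (\<bar>g t\<bar> * (t\<^sup>2 - r\<^sup>2) powr (real k / 2 - 1) * t) * indicator {r<..} t \<partial>lborel) \<partial>lborel)
      * indicator {\<alpha>..\<beta>} s \<partial>lborel) < \<infinity>"
proof -
  define A where "A r = (\<integral>\<^sup>+t. ennreal (\<bar>g t\<bar> * (t\<^sup>2 - r\<^sup>2) powr (real k / 2 - 1) * t) * indicator {r<..} t \<partial>lborel)" for r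
  have Am [measurable]: "A \<in> borel_measurable borel"
    unfolding A_def by (rule measurable_nn_integral_greaterThan) measurable
  define D where "D = \<beta> ^ j / (\<alpha> * real j)"
  let ?m = "\<lambda>t. min t \<beta>"
  have "(\<integral>\<^sup>+s. (\<integral>\<^sup>+r. ennreal ((s\<^sup>2 - r\<^sup>2) powr (real j / 2 - 1) * r ^ (l - 1)) * indicator {0<..<s} r * A r \<partial>lborel)
      * indicator {\<alpha>..\<beta>} s \<partial>lborel)
    = (\<integral>\<^sup>+s. (\<integral>\<^sup>+r. ennreal ((s\<^sup>2 - r\<^sup>2) powr (real j / 2 - 1) * r ^ (l - 1)) * indicator {0<..<s} r * A r
      * indicator {\<alpha>..\<beta>} s \<partial>lborel) \<partial>lborel)"
    by (intro nn_integral_cong nn_integral_multc[symmetric]) measurable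
  also have "\<dots> = (\<integral>\<^sup>+r. (\<integral>\<^sup>+s. ennreal ((s\<^sup>2 - r\<^sup>2) powr (real j / 2 - 1) * r ^ (l - 1)) * indicator {0<..<s} r * A r
      * indicator {\<alpha>..\<beta>} s \<partial>lborel) \<partial>lborel)"
    by (rule lborel_pair.Fubini') measurable
  also have "\<dots> = (\<integral>\<^sup>+r. ennreal (r ^ (l - 1)) * indicator {0<..} r * A r *
      (\<integral>\<^sup>+s. ennreal ((s\<^sup>2 - r\<^sup>2) powr (real j / 2 - 1)) * indicator {r<..} s * indicator {\<alpha>..\<beta>} s \<partial>lborel) \<partial>lborel)"
    by (intro nn_integral_cong, subst nn_integral_cmult[symmetric], measurable)
       (auto intro!: nn_integral_cong split: split_indicator simp: ennreal_mult' mult_ac)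
  also have "\<dots> \<le> (\<integral>\<^sup>+r. ennreal (r ^ (l - 1)) * indicator {0<..} r * A r * (ennreal D * indicator {..<\<beta>} r) \<partial>lborel)"
  proof (intro nn_integral_mono)
    fix r
    show "ennreal (r ^ (l - 1)) * indicator {0<..} r * A r *
      (\<integral>\<^sup>+s. ennreal ((s\<^sup>2 - r\<^sup>2) powr (real j / 2 - 1)) * indicator {r<..} s * indicator {\<alpha>..\<beta>} s \<partial>lborel)
      \<le> ennreal (r ^ (l - 1)) * indicator {0<..} r * A r * (ennreal D * indicator {..<\<beta>} r)"
      using outer_kernel_bound[OF j \<alpha>(1), of r \<beta>] unfolding D_def
      by (cases "0 < r") (auto intro!: mult_left_mono)
  qed
  also have "\<dots> = ennreal D * (\<integral>\<^sup>+r. ennreal (r ^ (l - 1)) * indicator {0<..<\<beta>} r * A r \<partial>lborel)"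
    by (subst nn_integral_cmult[symmetric], measurable)
       (auto intro!: nn_integral_cong split: split_indicator simp: mult_ac)
  finally have outer: "(\<integral>\<^sup>+s. (\<integral>\<^sup>+r. ennreal ((s\<^sup>2 - r\<^sup>2) powr (real j / 2 - 1) * r ^ (l - 1)) * indicator {0<..<s} r * A r \<partial>lborel)
      * indicator {\<alpha>..\<beta>} s \<partial>lborel)
    \<le> ennreal D * (\<integral>\<^sup>+r. ennreal (r ^ (l - 1)) * indicator {0<..<\<beta>} r * A r \<partial>lborel)" .
  have "(\<integral>\<^sup>+r. ennreal (r ^ (l - 1)) * indicator {0<..<\<beta>} r * A r \<partial>lborel)
     = (\<integral>\<^sup>+r. (\<integral>\<^sup>+t. ennreal (r ^ (l - 1)) * indicator {0<..<\<beta>} r *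
        (ennreal (\<bar>g t\<bar> * (t\<^sup>2 - r\<^sup>2) powr (real k / 2 - 1) * t) * indicator {r<..} t) \<partial>lborel) \<partial>lborel)"
    unfolding A_def by (intro nn_integral_cong nn_integral_cmult[symmetric]) measurable
  also have "\<dots> = (\<integral>\<^sup>+t. (\<integral>\<^sup>+r. ennreal (r ^ (l - 1)) * indicator {0<..<\<beta>} r *
        (ennreal (\<bar>g t\<bar> * (t\<^sup>2 - r\<^sup>2) powr (real k / 2 - 1) * t) * indicator {r<..} t) \<partial>lborel) \<partial>lborel)"
    by (rule lborel_pair.Fubini') measurable
  also have "\<dots> \<le> (\<integral>\<^sup>+t. ennreal (\<bar>g t\<bar> * (2 * ?m t ^ l * t ^ (k - 1))) * indicator {0<..} t \<partial>lborel)"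
  proof (intro nn_integral_mono)
    fix t :: real
    show "(\<integral>\<^sup>+r. ennreal (r ^ (l - 1)) * indicator {0<..<\<beta>} r *
        (ennreal (\<bar>g t\<bar> * (t\<^sup>2 - r\<^sup>2) powr (real k / 2 - 1) * t) * indicator {r<..} t) \<partial>lborel)
      \<le> ennreal (\<bar>g t\<bar> * (2 * ?m t ^ l * t ^ (k - 1))) * indicator {0<..} t"
    proof (cases "0 < t")
      case False
      then have "(\<integral>\<^sup>+r. ennreal (r ^ (l - 1)) * indicator {0<..<\<beta>} r *
          (ennreal (\<bar>g t\<bar> * (t\<^sup>2 - r\<^sup>2) powr (real k / 2 - 1) * t) * indicator {r<..} t) \<partial>lborel)
        = (\<integral>\<^sup>+r. 0 \<partial>(lborel :: real measure))"
        by (intro nn_integral_cong) (auto split: split_indicator)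
      then show ?thesis by simp
    next
      case True
      have "(\<integral>\<^sup>+r. ennreal (r ^ (l - 1)) * indicator {0<..<\<beta>} r *
          (ennreal (\<bar>g t\<bar> * (t\<^sup>2 - r\<^sup>2) powr (real k / 2 - 1) * t) * indicator {r<..} t) \<partial>lborel)
        = (\<integral>\<^sup>+r. ennreal \<bar>g t\<bar> * (ennreal (r ^ (l - 1) * (t\<^sup>2 - r\<^sup>2) powr (real k / 2 - 1) * t) * indicator {0<..<?m t} r) \<partial>lborel)"
        using True by (intro nn_integral_cong)
          (auto split: split_indicator simp: ennreal_mult'[symmetric] mult_ac)
      also have "\<dots> = ennreal \<bar>g t\<bar> * (\<integral>\<^sup>+r. ennreal (r ^ (l - 1) * (t\<^sup>2 - r\<^sup>2) powr (real k / 2 - 1) * t) * indicator {0<..<?m t} r \<partial>lborel)"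
        by (rule nn_integral_cmult) measurable
      also have "\<dots> \<le> ennreal \<bar>g t\<bar> * ennreal (2 * ?m t ^ l * t ^ (k - 1))"
        using True \<alpha> by (intro mult_left_mono inner_kernel_bound[OF k l]) auto
      finally show ?thesis using True by (simp add: ennreal_mult')
    qed
  qed
  also have "\<dots> \<le> (\<integral>\<^sup>+t. ennreal 2 * (ennreal (\<bar>g t\<bar> * t ^ (k + l - 1)) * indicator {0<..<a} t)
      + ennreal (2 * \<beta> ^ l) * (ennreal (\<bar>g t\<bar> * t ^ (k - 1)) * indicator {a<..} t) \<partial>lborel)"
  proof (intro nn_integral_mono_AE eventually_mono[OF AE_lborel_singleton[of a]])
    fix t :: real assume ta: "t \<noteq> a"
    have p: "t ^ (k + l - 1) = t ^ l * t ^ (k - 1)"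
      using k by (simp add: power_add[symmetric] add.commute)
    consider "t \<le> 0" | "0 < t" "t < a" | "a < t" using ta by linarith
    then show "ennreal (\<bar>g t\<bar> * (2 * ?m t ^ l * t ^ (k - 1))) * indicator {0<..} t
      \<le> ennreal 2 * (ennreal (\<bar>g t\<bar> * t ^ (k + l - 1)) * indicator {0<..<a} t)
      + ennreal (2 * \<beta> ^ l) * (ennreal (\<bar>g t\<bar> * t ^ (k - 1)) * indicator {a<..} t)"
    proof cases
      case 2
      have "?m t ^ l \<le> t ^ l" using 2 \<alpha> by (intro power_mono) auto
      then have "\<bar>g t\<bar> * (2 * ?m t ^ l * t ^ (k - 1)) \<le> 2 * (\<bar>g t\<bar> * t ^ (k + l - 1))"
        unfolding p using 2 by (simp add: mult_left_mono mult_right_mono mult_ac)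
      then have "ennreal (\<bar>g t\<bar> * (2 * ?m t ^ l * t ^ (k - 1))) \<le> ennreal 2 * ennreal (\<bar>g t\<bar> * t ^ (k + l - 1))"
        using 2 by (subst ennreal_mult[symmetric]) (auto intro!: ennreal_leI)
      then show ?thesis using 2 by simp
    next
      case 3
      have "?m t ^ l \<le> \<beta> ^ l" using 3 a \<alpha> by (intro power_mono) auto
      then have "\<bar>g t\<bar> * (2 * ?m t ^ l * t ^ (k - 1)) \<le> (2 * \<beta> ^ l) * (\<bar>g t\<bar> * t ^ (k - 1))"
        using 3 a by (simp add: mult_left_mono mult_right_mono mult_ac)
      then have "ennreal (\<bar>g t\<bar> * (2 * ?m t ^ l * t ^ (k - 1))) \<le> ennreal (2 * \<beta> ^ l) * ennreal (\<bar>g t\<bar> * t ^ (k - 1))"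
        using 3 a \<alpha> by (subst ennreal_mult[symmetric]) (auto intro!: ennreal_leI)
      then show ?thesis using 3 a by simp
    qed simp
  qed
  also have "\<dots> = ennreal 2 * (\<integral>\<^sup>+t. ennreal (\<bar>g t\<bar> * t ^ (k + l - 1)) * indicator {0<..<a} t \<partial>lborel)
      + ennreal (2 * \<beta> ^ l) * (\<integral>\<^sup>+t. ennreal (\<bar>g t\<bar> * t ^ (k - 1)) * indicator {a<..} t \<partial>lborel)"
    by (subst nn_integral_add, measurable) (simp add: nn_integral_cmult)
  also have "\<dots> < \<infinity>" using near far by (simp add: ennreal_mult_less_top)
  finally have "(\<integral>\<^sup>+r. ennreal (r ^ (l - 1)) * indicator {0<..<\<beta>} r * A r \<partial>lborel) < \<infinity>" .
  then have "ennreal D * (\<integral>\<^sup>+r. ennreal (r ^ (l - 1)) * indicator {0<..<\<beta>} r * A r \<partial>lborel) < \<infinity>"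
    by (simp add: ennreal_mult_less_top)
  with outer show ?thesis unfolding A_def by (rule le_less_trans)
qed

section \<open>The transform of a radial function\<close>

lemma subspace_lebesgue_eq_span_lborel:
  assumes "subspace \<eta>"
  obtains B where "onb B \<eta>" "subspace_lebesgue \<eta> = completion (span_lborel B)"
proof -
  let ?B = "SOME B. onb B \<eta>"
  have "onb ?B \<eta>" by (rule someI_ex[OF onb_exists[OF assms]])
  moreover have "subspace_lebesgue \<eta> = completion (span_lborel ?B)"
    by (simp only: subspace_lebesgue_def Let_def span_lborel_def onb_def)
  ultimately show thesis by (rule that)
qed

lemma affine_grassmannian_decompose:
  fixes \<zeta> :: "(real^'n) set"
  assumes "\<zeta> \<in> affine_grassmannian k"
  shows "subspace (direction \<zeta>)" "dim (direction \<zeta>) = k" "foot \<zeta> \<in> orthogonal_comp (direction \<zeta>)"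
    "norm (foot \<zeta>) = plane_dist \<zeta>"
proof -
  have \<zeta>: "affine \<zeta>" "aff_dim \<zeta> = int k" using assms by (auto simp: affine_grassmannian_def)
  then have ne: "\<zeta> \<noteq> {}" by auto
  then obtain p where p: "p \<in> \<zeta>" by blast
  have cl: "closed \<zeta>" using \<zeta>(1) by (rule affine_closed)
  let ?D = "(\<lambda>x. x - p) ` \<zeta>"
  have sD: "subspace ?D" using affine_diffs_subspace_subtract[OF \<zeta>(1) p] .
  have D: "direction \<zeta> = ?D"
  proof
    show "?D \<subseteq> direction \<zeta>" using p by (auto simp: direction_def)
    show "direction \<zeta> \<subseteq> ?D"
    proof
      fix z assume "z \<in> direction \<zeta>"
      then obtain x y where xy: "z = x - y" "x \<in> \<zeta>" "y \<in> \<zeta>" by (auto simp: direction_def)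
      then show "z \<in> ?D" using subspace_diff[OF sD, of "x - p" "y - p"] by auto
    qed
  qed
  show "subspace (direction \<zeta>)" unfolding D by (rule sD)
  show "dim (direction \<zeta>) = k" using aff_dim_dim_affine_diffs[OF \<zeta>(1) p] \<zeta>(2) by (simp add: D)
  let ?v = "foot \<zeta>"
  have v: "?v \<in> \<zeta>" unfolding foot_def by (rule closest_point_in_set[OF cl ne])
  show "norm ?v = plane_dist \<zeta>"
    using setdist_closest_point[OF cl ne, of 0] ne
    by (simp add: plane_dist_def infdist_eq_setdist foot_def dist_norm)
  \<comment> \<open>The variational inequality of the nearest point of a convex set. An affine plane
    contains both \<open>?v + z\<close> and \<open>?v - z\<close>, which turns the inequality into
    orthogonality.\<close>
  have le: "?v \<bullet> (x - ?v) \<ge> 0" if "x \<in> \<zeta>" for x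
    using closest_point_dot[OF affine_imp_convex[OF \<zeta>(1)] cl that, of 0] by (simp add: foot_def)
  have "z \<bullet> ?v = 0" if z: "z \<in> direction \<zeta>" for z
  proof -
    obtain x y where xy: "z = x - y" "x \<in> \<zeta>" "y \<in> \<zeta>" using z by (auto simp: direction_def)
    have 1: "?v + c *\<^sub>R z \<in> \<zeta>" for c
      using mem_affine_3_minus[OF \<zeta>(1) v xy(2,3)] by (simp add: xy)
    have "?v \<bullet> z \<ge> 0" "- (?v \<bullet> z) \<ge> 0" using le[OF 1[of 1]] le[OF 1[of "-1"]] by simp_all
    then show ?thesis by (simp add: inner_commute)
  qed
  then show "?v \<in> orthogonal_comp (direction \<zeta>)"
    by (auto simp: orthogonal_comp_def orthogonal_def)
qed

lemma dim_orthogonal_comp: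
  fixes \<eta> :: "(real^'n) set"
  assumes "subspace \<eta>"
  shows "dim (orthogonal_comp \<eta>) = CARD('n) - dim \<eta>"
  using dim_subspace_orthogonal_to_vectors[OF assms subspace_UNIV subset_UNIV]
  by (simp add: orthogonal_comp_def)

text \<open>\<open>u\<close> is orthogonal to everything in the complement of \<eta>, which contains
  \<xi> and \<open>v\<close>. Projecting \<open>u + v\<close> onto \<xi> thus sees only
  \<open>v\<close>, and Pythagoras separates \<open>u\<close> from the residual of
  \<open>v\<close>.\<close>

lemma plane_dist_translate:
  fixes \<xi> \<eta> :: "(real^'n) set"
  assumes \<xi>: "\<xi> \<in> grassmannian (orthogonal_comp \<eta>) j" and \<eta>: "subspace \<eta>"
    and u: "u \<in> \<eta>" and v: "v \<in> orthogonal_comp \<eta>"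
  shows "(\<lambda>x. x + u + v) ` \<xi> \<in> affine_grassmannian j"
    and "plane_dist ((\<lambda>x. x + u + v) ` \<xi>) = sqrt ((norm u)\<^sup>2 + (infdist v \<xi>)\<^sup>2)"
proof -
  note s\<xi> = grassmannian_memD[OF \<xi>]
  have im: "(\<lambda>x. x + u + v) ` \<xi> = (+) (u + v) ` \<xi>"
    by (intro image_cong refl) (simp add: algebra_simps)
  have "affine ((+) (u + v) ` \<xi>)"
    using affine_translation[of \<xi> "u + v"] subspace_imp_affine[OF s\<xi>(1)] by blast
  moreover have "aff_dim ((+) (u + v) ` \<xi>) = int j"
    using aff_dim_subspace[OF s\<xi>(1)] s\<xi>(3) by (simp add: aff_dim_translation_eq)
  ultimately show "(\<lambda>x. x + u + v) ` \<xi> \<in> affine_grassmannian j"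
    by (simp add: affine_grassmannian_def im)
  have orth: "u \<bullet> z = 0" if "z \<in> orthogonal_comp \<eta>" for z
    using that u by (auto simp: orthogonal_comp_def orthogonal_def)
  have ne: "\<xi> \<noteq> {}" using subspace_0[OF s\<xi>(1)] by auto
  have "plane_dist ((+) (u + v) ` \<xi>) = infdist (- (u + v)) \<xi>"
  proof -
    have "dist 0 (u + v + x) = dist (- (u + v)) x" for x
      using norm_minus_cancel[of "u + v + x"] by (simp add: dist_norm algebra_simps)
    then show ?thesis using ne by (simp add: plane_dist_def infdist_def image_image)
  qed
  also have "\<dots> = infdist (u + v) \<xi>"
    using infdist_subspace_scale[OF s\<xi>(1), of "-1" "u + v"] by simp
  also have "\<dots> = norm (u + (v - closest_point \<xi> v))"
  proof -
    have "closest_point \<xi> u = 0"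
      using s\<xi> orth by (intro closest_point_subspace_eqI) (auto simp: subspace_0)
    then have "closest_point \<xi> (u + v) = closest_point \<xi> v"
      by (simp add: linear_add[OF linear_closest_point[OF s\<xi>(1)]])
    then show ?thesis by (simp add: infdist_subspace[OF s\<xi>(1)] algebra_simps)
  qed
  also have "\<dots> = sqrt ((norm u)\<^sup>2 + (infdist v \<xi>)\<^sup>2)"
  proof -
    have "closest_point \<xi> v \<in> orthogonal_comp \<eta>"
      using closest_point_subspace_in[OF s\<xi>(1)] s\<xi>(2) by blast
    then have "u \<bullet> (v - closest_point \<xi> v) = 0"
      using v by (intro orth subspace_diff subspace_orthogonal_comp)
    then have "(norm (u + (v - closest_point \<xi> v)))\<^sup>2 = (norm u)\<^sup>2 + (norm (v - closest_point \<xi> v))\<^sup>2"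
      by (intro norm_add_Pythagorean) (simp add: orthogonal_def)
    then show ?thesis by (simp add: infdist_subspace[OF s\<xi>(1)] real_sqrt_unique)
  qed
  finally show "plane_dist ((\<lambda>x. x + u + v) ` \<xi>) = sqrt ((norm u)\<^sup>2 + (infdist v \<xi>)\<^sup>2)"
    by (simp add: im)
qed

text \<open>The inner integral after replacing \<open>f0\<close> by a Borel function \<open>g\<close> that agrees with it
  almost everywhere.\<close>

definition inner_integrand :: "nat \<Rightarrow> (real \<Rightarrow> real) \<Rightarrow> real \<Rightarrow> real \<Rightarrow> real" where
  "inner_integrand k g r t = indicator {r<..} t * (g t * (t\<^sup>2 - r\<^sup>2) powr (real k / 2 - 1) * t)"

lemma measurable_inner_integrand [measurable (raw)]:
  assumes [measurable]: "g \<in> borel_measurable borel" "f \<in> borel_measurable M" "h \<in> borel_measurable M"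
  shows "(\<lambda>x. inner_integrand k g (f x) (h x)) \<in> borel_measurable M"
  unfolding inner_integrand_def by measurable

lemma I_inner_borel:
  assumes [measurable]: "g \<in> borel_measurable borel" and eq: "AE t in lborel. 0 < t \<longrightarrow> f0 t = g t" and r: "0 \<le> r"
  shows "set_integrable lebesgue {r<..} (I_inner k f0 r) \<longleftrightarrow> integrable lborel (inner_integrand k g r)"
    and "(LINT t:{r<..}|lebesgue. I_inner k f0 r t) = integral\<^sup>L lborel (inner_integrand k g r)"
proof -
  have ae: "AE t in lborel. indicator {r<..} t *\<^sub>R I_inner k f0 r t = inner_integrand k g r t"
    using eq by eventually_elim (use r in \<open>auto simp: inner_integrand_def I_inner_def split: split_indicator\<close>)
  have m: "inner_integrand k g r \<in> borel_measurable lborel" by measurable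
  show "set_integrable lebesgue {r<..} (I_inner k f0 r) \<longleftrightarrow> integrable lborel (inner_integrand k g r)"
    and "(LINT t:{r<..}|lebesgue. I_inner k f0 r t) = integral\<^sup>L lborel (inner_integrand k g r)"
    unfolding set_integrable_def set_lebesgue_integral_def
    using completion_AE_eq(2,3)[OF m ae] by auto
qed

lemma measurable_integral_inner_integrand [measurable]:
  assumes [measurable]: "g \<in> borel_measurable borel"
  shows "(\<lambda>r. integral\<^sup>L lborel (inner_integrand k g r)) \<in> borel_measurable borel"
    and "Measurable.pred borel (\<lambda>r. integrable lborel (inner_integrand k g r))"
proof -
  have "case_prod (inner_integrand k g) \<in> borel_measurable (borel \<Otimes>\<^sub>M lborel)" by measurable
  then show "(\<lambda>r. integral\<^sup>L lborel (inner_integrand k g r)) \<in> borel_measurable borel"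
    by (rule lborel.borel_measurable_lebesgue_integral)
  have "integrable lborel (inner_integrand k g r) \<longleftrightarrow> (\<integral>\<^sup>+t. ennreal (norm (inner_integrand k g r t)) \<partial>lborel) < \<infinity>" for r
    by (subst integrable_iff_bounded) auto
  moreover have "Measurable.pred borel (\<lambda>r. (\<integral>\<^sup>+t. ennreal (norm (inner_integrand k g r t)) \<partial>lborel) < \<infinity>)"
    by measurable
  ultimately show "Measurable.pred borel (\<lambda>r. integrable lborel (inner_integrand k g r))" by simp
qed

lemma mixed_radon_inner_integral:
  fixes \<zeta> :: "(real^'n) set"
  assumes \<zeta>: "\<zeta> \<in> affine_grassmannian k" and k: "0 < k"
    and radial: "\<And>\<tau>. \<tau> \<in> affine_grassmannian j \<Longrightarrow> 0 < plane_dist \<tau> \<Longrightarrow> f \<tau> = f0 (plane_dist \<tau>)"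
    and g [measurable]: "g \<in> borel_measurable borel" and eq: "AE t in lborel. 0 < t \<longrightarrow> f0 t = g t"
    and \<xi>: "\<xi> \<in> grassmannian (orthogonal_comp (direction \<zeta>)) j"
  shows "integrable (subspace_lebesgue (direction \<zeta>)) (mixed_radon_inner f \<zeta> \<xi>)
      \<longleftrightarrow> integrable lborel (inner_integrand k g (infdist (foot \<zeta>) \<xi>))"
    and "(LINT u | subspace_lebesgue (direction \<zeta>). mixed_radon_inner f \<zeta> \<xi> u)
      = sphere_area (k - 1) * integral\<^sup>L lborel (inner_integrand k g (infdist (foot \<zeta>) \<xi>))"
proof -
  note \<eta> = affine_grassmannian_decompose[OF \<zeta>]
  let ?d = "infdist (foot \<zeta>) \<xi>"
  have d: "0 \<le> ?d" by (rule infdist_nonneg)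
  obtain B where B: "onb B (direction \<zeta>)" and L: "subspace_lebesgue (direction \<zeta>) = completion (span_lborel B)"
    using subspace_lebesgue_eq_span_lborel[OF \<eta>(1)] .
  have cB: "card B = k" using onb_card[OF B] \<eta>(2) by simp
  then have ne: "B \<noteq> {}" using k by auto
  \<comment> \<open>\<open>f\<close> is tied to \<open>f0\<close> only at positive distance. Away
    from \<open>u = 0\<close> the distance is positive even when \<open>foot \<zeta>\<close> lies in
    \<xi>.\<close>
  have "AE u in span_lborel B. u \<notin> {0}"
    using \<eta>(2) k subspace_0[OF \<eta>(1)] by (intro AE_span_lborel_not_in[OF B]) auto
  then have ae: "AE u in span_lborel B. mixed_radon_inner f \<zeta> \<xi> u = g (sqrt ((norm u)\<^sup>2 + ?d\<^sup>2))"
    using AE_span_lborel_in[OF B] AE_span_lborel_shifted_norm[OF B ne d eq]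
  proof eventually_elim
    case (elim u)
    have pos: "0 < sqrt ((norm u)\<^sup>2 + ?d\<^sup>2)" using elim(1) by (simp add: add_pos_nonneg)
    note P = plane_dist_translate[OF \<xi> \<eta>(1) elim(2) \<eta>(3)]
    have "mixed_radon_inner f \<zeta> \<xi> u = f0 (sqrt ((norm u)\<^sup>2 + ?d\<^sup>2))"
      unfolding mixed_radon_inner_def using radial[OF P(1)] pos by (simp only: P(2))
    then show ?case using elim(3) pos by simp
  qed
  have m: "(\<lambda>u. g (sqrt ((norm u)\<^sup>2 + ?d\<^sup>2))) \<in> borel_measurable (span_lborel B)" by measurable
  note C = completion_AE_eq(2,3)[OF m ae]
  note E = span_lborel_shifted_norm[OF B ne d g, folded inner_integrand_def, unfolded cB]
  show "integrable (subspace_lebesgue (direction \<zeta>)) (mixed_radon_inner f \<zeta> \<xi>)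
      \<longleftrightarrow> integrable lborel (inner_integrand k g ?d)"
    unfolding L C(1) E(1) inner_integrand_def ..
  show "(LINT u | subspace_lebesgue (direction \<zeta>). mixed_radon_inner f \<zeta> \<xi> u)
      = sphere_area (k - 1) * integral\<^sup>L lborel (inner_integrand k g ?d)"
    unfolding L C(2) E(2) inner_integrand_def ..
qed

definition outer_integrand :: "nat \<Rightarrow> nat \<Rightarrow> nat \<Rightarrow> (real \<Rightarrow> real) \<Rightarrow> real \<Rightarrow> real \<Rightarrow> real" where
  "outer_integrand j k l g s r = indicator {0<..<s} r * ((s\<^sup>2 - r\<^sup>2) powr (real j / 2 - 1) * r ^ (l - 1) * integral\<^sup>L lborel (inner_integrand k g r))"

lemma measurable_outer_integrand [measurable (raw)]:
  assumes [measurable]: "g \<in> borel_measurable borel" "f \<in> borel_measurable M" "h \<in> borel_measurable M"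
  shows "(\<lambda>x. outer_integrand j k l g (f x) (h x)) \<in> borel_measurable M"
  unfolding outer_integrand_def by measurable

lemma I_outer_borel:
  assumes g [measurable]: "g \<in> borel_measurable borel" and eq: "AE t in lborel. 0 < t \<longrightarrow> f0 t = g t"
  shows "set_integrable lebesgue {0<..<s} (I_outer n j k f0 s) \<longleftrightarrow> integrable lborel (outer_integrand j k (n - j - k) g s)"
    and "(LINT r:{0<..<s}|lebesgue. I_outer n j k f0 s r) = integral\<^sup>L lborel (outer_integrand j k (n - j - k) g s)"
proof -
  \<comment> \<open>The integrands agree at every \<open>r\<close>, not just almost everywhere: for
    each r \<ge> 0 the inner integrals of \<open>f0\<close> and \<open>g\<close> have the same
    value.\<close>
  have ae: "AE r in lborel. indicator {0<..<s} r *\<^sub>R I_outer n j k f0 s r = outer_integrand j k (n - j - k) g s r"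
    by (intro AE_I2) (auto simp: outer_integrand_def I_outer_def I_inner_borel[OF g eq] split: split_indicator)
  have m: "outer_integrand j k (n - j - k) g s \<in> borel_measurable lborel" by measurable
  show "set_integrable lebesgue {0<..<s} (I_outer n j k f0 s) \<longleftrightarrow> integrable lborel (outer_integrand j k (n - j - k) g s)"
    and "(LINT r:{0<..<s}|lebesgue. I_outer n j k f0 s r) = integral\<^sup>L lborel (outer_integrand j k (n - j - k) g s)"
    unfolding set_integrable_def set_lebesgue_integral_def
    using completion_AE_eq(2,3)[OF m ae] by auto
qed

lemma I_jk_converges_borel:
  assumes g [measurable]: "g \<in> borel_measurable borel" and eq: "AE t in lborel. 0 < t \<longrightarrow> f0 t = g t"
  shows "I_jk_converges n j k f0 s \<longleftrightarrow>
    (AE r in lborel. r \<in> {0<..<s} \<longrightarrow> integrable lborel (inner_integrand k g r)) \<and>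
    integrable lborel (outer_integrand j k (n - j - k) g s)"
proof -
  have "(r \<in> {0<..<s} \<longrightarrow> set_integrable lebesgue {r<..} (I_inner k f0 r)) \<longleftrightarrow>
      (r \<in> {0<..<s} \<longrightarrow> integrable lborel (inner_integrand k g r))" for r
    using I_inner_borel(1)[OF g eq, of r k] by auto
  then show ?thesis
    by (simp only: I_jk_converges_def I_outer_borel(1)[OF g eq] AE_completion_iff)
qed

text \<open>The inner integral becomes a function of \<open>infdist (foot \<zeta>) \<xi>\<close> by
  polar coordinates in the direction space, and the law of that distance gives the outer one. Both
  reductions are exact for divergent integrals too, so the formula and the equivalence of
  convergence come out side by side.\<close>

lemma mixed_radon_radial:
  fixes \<zeta> :: "(real^'n) set"
  defines "n \<equiv> CARD('n)"
  assumes \<zeta>: "\<zeta> \<in> affine_grassmannian k" "0 < plane_dist \<zeta>"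
    and j: "0 < j" and k: "0 < k" and jk: "j + k < n"
    and radial: "\<And>\<tau>. \<tau> \<in> affine_grassmannian j \<Longrightarrow> 0 < plane_dist \<tau> \<Longrightarrow> f \<tau> = f0 (plane_dist \<tau>)"
    and g [measurable]: "g \<in> borel_measurable borel" and eq: "AE t in lborel. 0 < t \<longrightarrow> f0 t = g t"
  shows "mixed_radon j f \<zeta> = I_jk n j k f0 (plane_dist \<zeta>)"
    and "mixed_radon_converges j f \<zeta> \<longleftrightarrow> I_jk_converges n j k f0 (plane_dist \<zeta>)"
proof -
  note \<eta> = affine_grassmannian_decompose[OF \<zeta>(1)]
  define V where "V = orthogonal_comp (direction \<zeta>)"
  define M where "M = grassmannian_measure V j"
  let ?v = "foot \<zeta>"
  let ?l = "n - j - k"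
  let ?\<sigma> = "sphere_area (k - 1)"
  let ?F = "\<lambda>r. integral\<^sup>L lborel (inner_integrand k g r)"
  have V: "subspace V" unfolding V_def by (rule subspace_orthogonal_comp)
  have dV: "dim V = j + ?l" using dim_orthogonal_comp[OF \<eta>(1)] \<eta>(2) jk by (simp add: V_def n_def)
  have l: "0 < ?l" using jk by simp
  have M: "invariant_prob V j M"
    unfolding M_def using dV by (intro invariant_prob_grassmannian_measure V) simp
  have spM: "space M = grassmannian V j"
    using M sets_eq_imp_space_eq[of M "grassmannian_borel V j"]
    by (simp add: invariant_prob_def space_grassmannian_borel)
  have v: "?v \<in> V" "?v \<noteq> 0" using \<eta>(3,4) \<zeta>(2) by (auto simp: V_def)
  have inner: "integrable (subspace_lebesgue (direction \<zeta>)) (mixed_radon_inner f \<zeta> \<xi>)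
      \<longleftrightarrow> integrable lborel (inner_integrand k g (infdist ?v \<xi>))"
    "(LINT u | subspace_lebesgue (direction \<zeta>). mixed_radon_inner f \<zeta> \<xi> u) = ?\<sigma> * ?F (infdist ?v \<xi>)"
    if "\<xi> \<in> space M" for \<xi>
  proof -
    have \<xi>: "\<xi> \<in> grassmannian (orthogonal_comp (direction \<zeta>)) j" using that by (simp add: spM V_def)
    show "integrable (subspace_lebesgue (direction \<zeta>)) (mixed_radon_inner f \<zeta> \<xi>)
        \<longleftrightarrow> integrable lborel (inner_integrand k g (infdist ?v \<xi>))"
      by (rule mixed_radon_inner_integral(1)[OF \<zeta>(1) k _ g eq \<xi>]) (rule radial)
    show "(LINT u | subspace_lebesgue (direction \<zeta>). mixed_radon_inner f \<zeta> \<xi> u) = ?\<sigma> * ?F (infdist ?v \<xi>)"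
      by (rule mixed_radon_inner_integral(2)[OF \<zeta>(1) k _ g eq \<xi>]) (rule radial)
  qed
  have Fm: "(\<lambda>r. ?\<sigma> * ?F r) \<in> borel_measurable borel" by measurable
  have lam: "(\<lambda>r. indicator {0<..<norm ?v} r * (((norm ?v)\<^sup>2 - r\<^sup>2) powr (real j / 2 - 1) * r ^ (?l - 1) * (?\<sigma> * ?F r)))
      = (\<lambda>r. ?\<sigma> * outer_integrand j k ?l g (norm ?v) r)"
    by (simp add: outer_integrand_def fun_eq_iff)
  note G = infdist_grassmannian[OF M V j l dV v Fm, unfolded lam]
  \<comment> \<open>With l = n - j - k, j + l is n - k. Since \<open>j\<close> and \<open>l\<close>
    are positive it is at least 2, so the truncated subtractions are genuine.\<close>
  have idx: "j + ?l - 1 = n - k - 1" "j + ?l - 2 = n - k - 2" using jk by auto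
  have "mixed_radon j f \<zeta> = (LINT \<xi>|M. ?\<sigma> * ?F (infdist ?v \<xi>))"
    unfolding mixed_radon_def V_def[symmetric] M_def[symmetric]
    by (intro Bochner_Integration.integral_cong refl inner(2))
  also have "\<dots> = c1 n j k / plane_dist \<zeta> ^ (n - k - 2) * integral\<^sup>L lborel (outer_integrand j k ?l g (plane_dist \<zeta>))"
    unfolding G(2) idx \<eta>(4) by (simp add: c1_def)
  also have "\<dots> = I_jk n j k f0 (plane_dist \<zeta>)"
    by (simp only: I_jk_def I_outer_borel(2)[OF g eq])
  finally show "mixed_radon j f \<zeta> = I_jk n j k f0 (plane_dist \<zeta>)" .
  have "mixed_radon_converges j f \<zeta> \<longleftrightarrow>
    (AE \<xi> in M. integrable lborel (inner_integrand k g (infdist ?v \<xi>))) \<and> integrable M (\<lambda>\<xi>. ?\<sigma> * ?F (infdist ?v \<xi>))"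
    unfolding mixed_radon_converges_def V_def[symmetric] M_def[symmetric]
    by (intro arg_cong2[where f="(\<and>)"] AE_cong Bochner_Integration.integrable_cong refl inner)
  also have "\<dots> \<longleftrightarrow> (AE r in lborel. r \<in> {0<..<norm ?v} \<longrightarrow> integrable lborel (inner_integrand k g r)) \<and>
      integrable lborel (outer_integrand j k ?l g (norm ?v))"
    using G(3)[OF measurable_integral_inner_integrand(2)[OF g]] G(1) sphere_area_pos[of "k - 1"] by simp
  also have "\<dots> \<longleftrightarrow> I_jk_converges n j k f0 (plane_dist \<zeta>)"
    by (simp only: I_jk_converges_borel[OF g eq] \<eta>(4))
  finally show "mixed_radon_converges j f \<zeta> \<longleftrightarrow> I_jk_converges n j k f0 (plane_dist \<zeta>)" .
qed

section \<open>Convergence\<close>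

text \<open>Measurability of the profile is hidden in the two weighted integrability conditions:
  dividing each weighted piece by its power recovers \<open>f0\<close> on (0, a) and on (a,
  \<infinity>), and a Borel representative of the sum is taken.\<close>

lemma radial_profile_borel:
  fixes f0 :: "real \<Rightarrow> real"
  assumes a: "0 < a"
    and near: "set_integrable lebesgue {0<..<a} (\<lambda>t. f0 t * t ^ p)"
    and far: "set_integrable lebesgue {a<..} (\<lambda>t. f0 t * t ^ q)"
  obtains g where "g \<in> borel_measurable borel" "AE t in lborel. 0 < t \<longrightarrow> f0 t = g t"
    "(\<integral>\<^sup>+t. ennreal (\<bar>g t\<bar> * t ^ p) * indicator {0<..<a} t \<partial>lborel) < \<infinity>"
    "(\<integral>\<^sup>+t. ennreal (\<bar>g t\<bar> * t ^ q) * indicator {a<..} t \<partial>lborel) < \<infinity>"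
proof -
  have [measurable]: "(\<lambda>t. indicator {0<..<a} t * (f0 t * t ^ p)) \<in> borel_measurable lebesgue"
    "(\<lambda>t. indicator {a<..} t * (f0 t * t ^ q)) \<in> borel_measurable lebesgue"
    using near far by (auto simp: set_integrable_def dest: borel_measurable_integrable)
  have c: "h \<in> borel_measurable lebesgue" if "h \<in> borel_measurable borel" for h :: "real \<Rightarrow> real"
    using that by (intro measurable_completion) simp
  have [measurable]: "(\<lambda>t. 1 / t ^ p :: real) \<in> borel_measurable lebesgue" "(\<lambda>t. 1 / t ^ q :: real) \<in> borel_measurable lebesgue"
    by (rule c, measurable)+
  have "(\<lambda>t. indicator {0<..<a} t * (f0 t * t ^ p) * (1 / t ^ p) + indicator {a<..} t * (f0 t * t ^ q) * (1 / t ^ q))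
      \<in> borel_measurable lebesgue" by measurable
  from completion_ex_borel_measurable_real[OF this]
  obtain g where g: "g \<in> borel_measurable lborel" and
    ae: "AE t in lborel. indicator {0<..<a} t * (f0 t * t ^ p) * (1 / t ^ p)
      + indicator {a<..} t * (f0 t * t ^ q) * (1 / t ^ q) = g t" by blast
  have gm [measurable]: "g \<in> borel_measurable borel" using g by simp
  have eq: "AE t in lborel. 0 < t \<longrightarrow> f0 t = g t"
    using ae AE_lborel_singleton[of a]
    by eventually_elim (use a in \<open>auto split: split_indicator_asm\<close>)
  have fin: "(\<integral>\<^sup>+t. ennreal (\<bar>g t\<bar> * t ^ m) * indicator A t \<partial>lborel) < \<infinity>"
    if A: "A \<in> sets borel" "A \<subseteq> {0<..}" and int: "set_integrable lebesgue A (\<lambda>t. f0 t * t ^ m)" for A m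
  proof -
    note [measurable] = A(1)
    have m: "(\<lambda>t. indicator A t *\<^sub>R (g t * t ^ m)) \<in> borel_measurable lborel" by measurable
    have "AE t in lborel. indicator A t *\<^sub>R (f0 t * t ^ m) = indicator A t *\<^sub>R (g t * t ^ m)"
      using eq by eventually_elim (use A(2) in \<open>auto split: split_indicator\<close>)
    from completion_AE_eq(2)[OF m this] int
    have "integrable lborel (\<lambda>t. indicator A t *\<^sub>R (g t * t ^ m))" by (simp add: set_integrable_def)
    then have "(\<integral>\<^sup>+t. ennreal (norm (indicator A t *\<^sub>R (g t * t ^ m))) \<partial>lborel) < \<infinity>"
      by (simp add: integrable_iff_bounded)
    also have "(\<integral>\<^sup>+t. ennreal (norm (indicator A t *\<^sub>R (g t * t ^ m))) \<partial>lborel)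
      = (\<integral>\<^sup>+t. ennreal (\<bar>g t\<bar> * t ^ m) * indicator A t \<partial>lborel)"
      using A(2) by (intro nn_integral_cong) (auto split: split_indicator simp: abs_mult subset_iff)
    finally show ?thesis .
  qed
  show thesis
    by (rule that[OF gm eq fin[OF _ _ near] fin[OF _ _ far]]) (use a in auto)
qed

text \<open>Where the inner Bochner integral diverges its value is 0, so the bound by the absolute
  integral holds there as well.\<close>

lemma outer_integrand_bound:
  fixes g :: "real \<Rightarrow> real"
  assumes [measurable]: "g \<in> borel_measurable borel"
  shows "(\<integral>\<^sup>+r. ennreal (norm (outer_integrand j k l g s r)) \<partial>lborel) \<le>
    (\<integral>\<^sup>+r. ennreal ((s\<^sup>2 - r\<^sup>2) powr (real j / 2 - 1) * r ^ (l - 1)) * indicator {0<..<s} r *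
      (\<integral>\<^sup>+t. ennreal (\<bar>g t\<bar> * (t\<^sup>2 - r\<^sup>2) powr (real k / 2 - 1) * t) * indicator {r<..} t \<partial>lborel) \<partial>lborel)"
    and "(\<integral>\<^sup>+r. ennreal ((s\<^sup>2 - r\<^sup>2) powr (real j / 2 - 1) * r ^ (l - 1)) * indicator {0<..<s} r *
      (\<integral>\<^sup>+t. ennreal (\<bar>g t\<bar> * (t\<^sup>2 - r\<^sup>2) powr (real k / 2 - 1) * t) * indicator {r<..} t \<partial>lborel) \<partial>lborel) < \<infinity>
    \<Longrightarrow> AE r in lborel. r \<in> {0<..<s} \<longrightarrow> integrable lborel (inner_integrand k g r)"
proof -
  define A where "A r = (\<integral>\<^sup>+t. ennreal (\<bar>g t\<bar> * (t\<^sup>2 - r\<^sup>2) powr (real k / 2 - 1) * t) * indicator {r<..} t \<partial>lborel)" for r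
  have Am [measurable]: "A \<in> borel_measurable borel"
    unfolding A_def by (rule measurable_nn_integral_greaterThan) measurable
  have A: "A r = (\<integral>\<^sup>+t. ennreal (norm (inner_integrand k g r t)) \<partial>lborel)" if "0 < r" for r
    unfolding A_def using that
    by (intro nn_integral_cong) (auto simp: inner_integrand_def abs_mult split: split_indicator)
  have int: "integrable lborel (inner_integrand k g r) \<longleftrightarrow> A r < \<infinity>" if "0 < r" for r
    unfolding A[OF that] by (subst integrable_iff_bounded) auto
  have bd: "ennreal (norm (integral\<^sup>L lborel (inner_integrand k g r))) \<le> A r" if "0 < r" for r
  proof (cases "integrable lborel (inner_integrand k g r)")
    case True
    then show ?thesis unfolding A[OF that] by (rule integral_norm_bound_ennreal)
  qed (simp add: not_integrable_integral_eq)
  let ?w = "\<lambda>r. ennreal ((s\<^sup>2 - r\<^sup>2) powr (real j / 2 - 1) * r ^ (l - 1)) * indicator {0<..<s} r"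
  have "ennreal (norm (outer_integrand j k l g s r)) \<le> ?w r * A r" for r
  proof (cases "r \<in> {0<..<s}")
    case True
    then have "ennreal (norm (outer_integrand j k l g s r)) = ?w r * ennreal (norm (integral\<^sup>L lborel (inner_integrand k g r)))"
      by (simp add: outer_integrand_def abs_mult ennreal_mult)
    also have "\<dots> \<le> ?w r * A r" using bd[of r] True by (intro mult_left_mono) auto
    finally show ?thesis .
  qed (simp add: outer_integrand_def)
  then show "(\<integral>\<^sup>+r. ennreal (norm (outer_integrand j k l g s r)) \<partial>lborel) \<le>
    (\<integral>\<^sup>+r. ?w r * (\<integral>\<^sup>+t. ennreal (\<bar>g t\<bar> * (t\<^sup>2 - r\<^sup>2) powr (real k / 2 - 1) * t) * indicator {r<..} t \<partial>lborel) \<partial>lborel)"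
    unfolding A_def[symmetric] by (rule nn_integral_mono)
  assume "(\<integral>\<^sup>+r. ?w r * (\<integral>\<^sup>+t. ennreal (\<bar>g t\<bar> * (t\<^sup>2 - r\<^sup>2) powr (real k / 2 - 1) * t) * indicator {r<..} t \<partial>lborel) \<partial>lborel) < \<infinity>"
  then have "(\<integral>\<^sup>+r. ?w r * A r \<partial>lborel) \<noteq> \<infinity>" unfolding A_def[symmetric] by simp
  then have "AE r in lborel. ?w r * A r \<noteq> \<infinity>" by (intro nn_integral_PInf_AE) measurable
  then show "AE r in lborel. r \<in> {0<..<s} \<longrightarrow> integrable lborel (inner_integrand k g r)"
  proof (eventually_elim, intro impI)
    fix r assume fin: "?w r * A r \<noteq> \<infinity>" and r: "r \<in> {0<..<s}"
    \<comment> \<open>Strict positivity of the weight on (0, s) is what passes finiteness from the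
      product to \<open>A r\<close>, since zero times infinity is finite.\<close>
    have "s\<^sup>2 - r\<^sup>2 > 0" using r by (simp add: power_strict_mono)
    then have "?w r \<noteq> 0" using r by (simp add: ennreal_eq_0_iff not_le)
    then have "A r \<noteq> \<infinity>" using fin by (auto simp: ennreal_mult_eq_top_iff)
    then show "integrable lborel (inner_integrand k g r)" using r by (simp add: int less_top)
  qed
qed

lemma I_jk_convergence:
  fixes f0 g :: "real \<Rightarrow> real"
  assumes j: "0 < j" and k: "0 < k" and jk: "j + k < n" and a: "0 < a" and \<alpha>: "0 < \<alpha>" "\<alpha> < \<beta>"
    and g [measurable]: "g \<in> borel_measurable borel" and eq: "AE t in lborel. 0 < t \<longrightarrow> f0 t = g t"
    and near: "(\<integral>\<^sup>+t. ennreal (\<bar>g t\<bar> * t ^ (n - j - 1)) * indicator {0<..<a} t \<partial>lborel) < \<infinity>"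
    and far: "(\<integral>\<^sup>+t. ennreal (\<bar>g t\<bar> * t ^ (k - 1)) * indicator {a<..} t \<partial>lborel) < \<infinity>"
  shows "AE s in lborel. s \<in> {\<alpha>..\<beta>} \<longrightarrow> I_jk_converges n j k f0 s"
    and "set_integrable lebesgue {\<alpha>..\<beta>} (I_jk n j k f0)"
proof -
  let ?l = "n - j - k"
  have l: "0 < ?l" using jk by simp
  have idx: "n - j - 1 = k + ?l - 1" using jk by simp
  define J where "J s = (\<integral>\<^sup>+r. ennreal ((s\<^sup>2 - r\<^sup>2) powr (real j / 2 - 1) * r ^ (?l - 1)) * indicator {0<..<s} r *
      (\<integral>\<^sup>+t. ennreal (\<bar>g t\<bar> * (t\<^sup>2 - r\<^sup>2) powr (real k / 2 - 1) * t) * indicator {r<..} t \<partial>lborel) \<partial>lborel)" for s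
  have Jm [measurable]: "J \<in> borel_measurable borel"
    unfolding J_def by measurable
  have fin: "(\<integral>\<^sup>+s. J s * indicator {\<alpha>..\<beta>} s \<partial>lborel) < \<infinity>"
    unfolding J_def by (rule iterated_integral_finite[OF j k l a \<alpha> g near[unfolded idx] far])
  note bound = outer_integrand_bound(1)[OF g, of j k ?l, folded J_def]
    and aeint = outer_integrand_bound(2)[OF g, of _ j ?l k, folded J_def]
  have "AE s in lborel. J s * indicator {\<alpha>..\<beta>} s \<noteq> \<infinity>"
    using fin by (intro nn_integral_PInf_AE) auto
  then show "AE s in lborel. s \<in> {\<alpha>..\<beta>} \<longrightarrow> I_jk_converges n j k f0 s"
  proof (eventually_elim, intro impI)
    fix s assume "J s * indicator {\<alpha>..\<beta>} s \<noteq> \<infinity>" "s \<in> {\<alpha>..\<beta>}"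
    then have J: "J s < \<infinity>" by (simp add: less_top)
    have "integrable lborel (outer_integrand j k ?l g s)"
      using le_less_trans[OF bound J] by (intro integrableI_bounded) auto
    then show "I_jk_converges n j k f0 s"
      using aeint[OF J] by (simp add: I_jk_converges_borel[OF g eq])
  qed
  let ?p = "n - k - 2"
  let ?h = "\<lambda>s. indicator {\<alpha>..\<beta>} s *\<^sub>R (c1 n j k / s ^ ?p * integral\<^sup>L lborel (outer_integrand j k ?l g s))"
  have c: "c1 n j k \<ge> 0"
    unfolding c1_def by (intro divide_nonneg_nonneg mult_nonneg_nonneg less_imp_le[OF sphere_area_pos])
  have [measurable]: "(\<lambda>s. integral\<^sup>L lborel (outer_integrand j k ?l g s)) \<in> borel_measurable borel"
  proof -
    have "case_prod (outer_integrand j k ?l g) \<in> borel_measurable (borel \<Otimes>\<^sub>M lborel)" by measurable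
    then show ?thesis by (rule lborel.borel_measurable_lebesgue_integral)
  qed
  have hm: "?h \<in> borel_measurable lborel" by measurable
  \<comment> \<open>On [\<alpha>, \<beta>] the prefactor is largest at \<alpha>, so integrability in
    \<open>s\<close> reduces to that of \<open>J\<close>, whose integral is already known to be
    finite.\<close>
  have le: "ennreal (norm (?h s)) \<le> ennreal (c1 n j k / \<alpha> ^ ?p) * (J s * indicator {\<alpha>..\<beta>} s)" for s
  proof (cases "s \<in> {\<alpha>..\<beta>}")
    case True
    have "ennreal (norm (integral\<^sup>L lborel (outer_integrand j k ?l g s))) \<le> J s"
    proof (cases "integrable lborel (outer_integrand j k ?l g s)")
      case True
      from integral_norm_bound_ennreal[OF this] bound show ?thesis by (rule order_trans)
    qed (simp add: not_integrable_integral_eq)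
    moreover have "c1 n j k / s ^ ?p \<le> c1 n j k / \<alpha> ^ ?p"
      using True \<alpha> c by (intro divide_left_mono power_mono mult_pos_pos) auto
    ultimately have "ennreal (c1 n j k / s ^ ?p) * ennreal (norm (integral\<^sup>L lborel (outer_integrand j k ?l g s)))
        \<le> ennreal (c1 n j k / \<alpha> ^ ?p) * J s"
      by (intro mult_mono ennreal_leI) auto
    moreover have "ennreal (norm (?h s)) = ennreal (c1 n j k / s ^ ?p) * ennreal (norm (integral\<^sup>L lborel (outer_integrand j k ?l g s)))"
    proof -
      have "0 \<le> c1 n j k / s ^ ?p" using True c \<alpha> by simp
      moreover from this have "norm (?h s) = c1 n j k / s ^ ?p * norm (integral\<^sup>L lborel (outer_integrand j k ?l g s))"
        using True by (simp only: indicator_simps scaleR_one real_norm_def abs_mult abs_of_nonneg)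
      ultimately show ?thesis by (simp only: ennreal_mult')
    qed
    moreover have "J s * indicator {\<alpha>..\<beta>} s = J s" using True by simp
    ultimately show ?thesis by (simp only:)
  qed simp
  have "(\<integral>\<^sup>+s. ennreal (norm (?h s)) \<partial>lborel) \<le> (\<integral>\<^sup>+s. ennreal (c1 n j k / \<alpha> ^ ?p) * (J s * indicator {\<alpha>..\<beta>} s) \<partial>lborel)"
    by (intro nn_integral_mono le)
  also have "\<dots> = ennreal (c1 n j k / \<alpha> ^ ?p) * (\<integral>\<^sup>+s. J s * indicator {\<alpha>..\<beta>} s \<partial>lborel)"
    by (rule nn_integral_cmult) measurable
  also have "\<dots> < \<infinity>" using fin by (simp add: ennreal_mult_less_top)
  finally have int: "integrable lborel ?h" using hm by (intro integrableI_bounded)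
  have ae: "AE s in lborel. indicator {\<alpha>..\<beta>} s *\<^sub>R I_jk n j k f0 s = ?h s"
    by (simp add: I_jk_def I_outer_borel(2)[OF g eq])
  show "set_integrable lebesgue {\<alpha>..\<beta>} (I_jk n j k f0)"
    unfolding set_integrable_def completion_AE_eq(2)[OF hm ae] by (rule int)
qed

section \<open>The Erdelyi-Kober form\<close>

lemma c1_eq_c1_tilde:
  assumes j: "0 < j" and k: "0 < k" and jk: "j + k < n"
  shows "c1 n j k = c1_tilde n j k * (2 / Gamma (real j / 2)) * (2 / Gamma (real k / 2))"
proof -
  define l where "l = n - j - k"
  have l: "l > 0" "n - k = j + l" "n - j - k = l" using jk by (auto simp: l_def)
  have S: "sphere_area (m - 1) = 2 * pi powr (real m / 2) / Gamma (real m / 2)" if "0 < m" for m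
    using that by (simp add: sphere_area_def of_nat_diff)
  have G: "Gamma (real m / 2) > 0" if "0 < m" for m using that by (simp add: Gamma_real_pos)
  \<comment> \<open>As n - k = j + l, these powers of pi cancel and leave exponent k/2. Three
    factors 2 over one leave 4, which the two prefactors 2 / Gamma absorb.\<close>
  have p: "pi powr (real (j + l) / 2) = pi powr (real j / 2) * pi powr (real l / 2)"
    by (simp add: powr_add[symmetric] add_divide_distrib)
  have jl: "0 < j + l" using j by simp
  show ?thesis
    unfolding c1_def c1_tilde_def l S[OF j] S[OF k] S[OF l(1)] S[OF jl] p
    using G[OF j] G[OF k] G[OF l(1)] G[OF jl] by (simp add: field_simps)
qed

lemma I_jk_eq_EK:
  assumes j: "0 < j" and k: "0 < k" and jk: "j + k < n"
  shows "I_jk n j k f0 s = c1_tilde n j k / s ^ (n - k - 2) *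
    EK_plus (real j / 2) (\<lambda>r. r powr (real (n - j - k) - 2) * EK_minus (real k / 2) f0 r) s"
proof -
  let ?l = "n - j - k"
  have l: "0 < ?l" using jk by simp
  have "EK_plus (real j / 2) (\<lambda>r. r powr (real ?l - 2) * EK_minus (real k / 2) f0 r) s
      = 2 / Gamma (real j / 2) * (LINT r:{0<..<s}|lebesgue. 2 / Gamma (real k / 2) * I_outer n j k f0 s r)"
    unfolding EK_plus_def
  proof (rule arg_cong[where f="(*) (2 / Gamma (real j / 2))"], rule set_lebesgue_integral_cong, simp, intro allI impI)
    fix r assume r: "r \<in> {0<..<s}"
    have "EK_minus (real k / 2) f0 r = 2 / Gamma (real k / 2) * (LINT t:{r<..}|lebesgue. I_inner k f0 r t)"
      unfolding EK_minus_def I_inner_def by (simp only: mult_ac)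
    then have "(s\<^sup>2 - r\<^sup>2) powr (real j / 2 - 1) * (r powr (real ?l - 2) * EK_minus (real k / 2) f0 r) * r
      = (s\<^sup>2 - r\<^sup>2) powr (real j / 2 - 1) * (r powr (real ?l - 2) * r)
        * (2 / Gamma (real k / 2) * (LINT t:{r<..}|lebesgue. I_inner k f0 r t))"
      by (simp only: mult_ac)
    also have "\<dots> = 2 / Gamma (real k / 2) * I_outer n j k f0 s r"
    proof -
      \<comment> \<open>The exponent l - 2 is -1 when l = 1, hence the real power; the factor
        \<open>r\<close> in the measure of \<open>EK_plus\<close> restores the natural exponent l -
        1.\<close>
      have "r powr (real ?l - 2) * r = r ^ (?l - 1)" using r by (intro powr_minus_two_mult l) simp
      then show ?thesis by (simp only: I_outer_def mult_ac)
    qed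
    finally show "(s\<^sup>2 - r\<^sup>2) powr (real j / 2 - 1) * (r powr (real ?l - 2) * EK_minus (real k / 2) f0 r) * r
      = 2 / Gamma (real k / 2) * I_outer n j k f0 s r" .
  qed
  then show ?thesis
    by (simp add: I_jk_def c1_eq_c1_tilde[OF j k jk] mult_ac)
qed

theorem lemma4p1:
  fixes j k l :: nat and a :: real
    and f :: "(real ^ 'n) set \<Rightarrow> real" and f0 :: "real \<Rightarrow> real"
  defines "n \<equiv> CARD('n)"
  assumes "0 < j" and "0 < k" and "j + k < n" and "l = n - j - k"
    and radial: "\<And>\<tau>. \<tau> \<in> affine_grassmannian j \<Longrightarrow> 0 < plane_dist \<tau> \<Longrightarrow> f \<tau> = f0 (plane_dist \<tau>)"
    and "0 < a"
    and "set_integrable lebesgue {0<..<a} (\<lambda>t. f0 t * t ^ (n - j - 1))"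
    and "set_integrable lebesgue {a<..} (\<lambda>t. f0 t * t ^ (k - 1))"
  shows "(\<forall>\<zeta>. \<zeta> \<in> affine_grassmannian k \<and> 0 < plane_dist \<zeta> \<longrightarrow>
            mixed_radon j f \<zeta> = I_jk n j k f0 (plane_dist \<zeta>) \<and>
            (mixed_radon_converges j f \<zeta> \<longleftrightarrow> I_jk_converges n j k f0 (plane_dist \<zeta>))) \<and>
         (AE s in lebesgue. 0 < s \<longrightarrow> I_jk_converges n j k f0 s) \<and>
         (\<forall>s>0. I_jk n j k f0 s =
            c1_tilde n j k / s ^ (n - k - 2) *
            EK_plus (real j / 2) (\<lambda>r. r powr (real l - 2) * EK_minus (real k / 2) f0 r) s) \<and>
         (\<forall>\<alpha> \<beta>. 0 < \<alpha> \<and> \<alpha> < \<beta> \<longrightarrow> set_integrable lebesgue {\<alpha>..\<beta>} (I_jk n j k f0))"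
proof -
  obtain g where g: "g \<in> borel_measurable borel" "AE t in lborel. 0 < t \<longrightarrow> f0 t = g t"
    "(\<integral>\<^sup>+t. ennreal (\<bar>g t\<bar> * t ^ (n - j - 1)) * indicator {0<..<a} t \<partial>lborel) < \<infinity>"
    "(\<integral>\<^sup>+t. ennreal (\<bar>g t\<bar> * t ^ (k - 1)) * indicator {a<..} t \<partial>lborel) < \<infinity>"
    using radial_profile_borel[OF assms(7-9)] .
  note conv = I_jk_convergence[OF assms(2-4) assms(7) _ _ g]
  have "mixed_radon j f \<zeta> = I_jk n j k f0 (plane_dist \<zeta>)"
    "mixed_radon_converges j f \<zeta> \<longleftrightarrow> I_jk_converges n j k f0 (plane_dist \<zeta>)"
    if "\<zeta> \<in> affine_grassmannian k" "0 < plane_dist \<zeta>" for \<zeta>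
    unfolding n_def
    by (rule mixed_radon_radial[OF that assms(2,3) assms(4)[unfolded n_def] _ g(1,2)], rule radial, assumption+)+
  moreover have "AE s in lebesgue. 0 < s \<longrightarrow> I_jk_converges n j k f0 s"
  proof -
    \<comment> \<open>Almost-everywhere statements combine only countably, so (0, \<infinity>) is
      exhausted by countably many compact intervals. The right end \<open>Suc (Suc i)\<close> keeps
      the interval nondegenerate at \<open>i = 0\<close>.\<close>
    have "AE s in lborel. \<forall>i. s \<in> {1 / real (Suc i)..real (Suc (Suc i))} \<longrightarrow> I_jk_converges n j k f0 s"
      unfolding AE_all_countable
    proof
      fix i
      have "1 / real (Suc i) \<le> 1" by simp
      also have "1 < real (Suc (Suc i))" by simp
      finally show "AE s in lborel. s \<in> {1 / real (Suc i)..real (Suc (Suc i))} \<longrightarrow> I_jk_converges n j k f0 s"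
        by (intro conv) auto
    qed
    then have "AE s in lborel. 0 < s \<longrightarrow> I_jk_converges n j k f0 s"
    proof (eventually_elim, intro impI)
      fix s :: real
      assume H: "\<forall>i. s \<in> {1 / real (Suc i)..real (Suc (Suc i))} \<longrightarrow> I_jk_converges n j k f0 s" and s: "0 < s"
      obtain i1 :: nat where i1: "s \<le> real i1" using real_arch_simple by blast
      obtain i2 :: nat where i2: "1 / s \<le> real i2" using real_arch_simple by blast
      define i where "i = max i1 i2"
      have "1 / s \<le> real (Suc i)" using i2 by (simp add: i_def)
      then have "1 / real (Suc i) \<le> s" using s by (simp add: field_simps)
      moreover have "s \<le> real (Suc (Suc i))" using i1 by (simp add: i_def)
      ultimately show "I_jk_converges n j k f0 s" using H by auto
    qed
    then show ?thesis by (rule AE_completion)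
  qed
  moreover have "I_jk n j k f0 s = c1_tilde n j k / s ^ (n - k - 2) *
      EK_plus (real j / 2) (\<lambda>r. r powr (real l - 2) * EK_minus (real k / 2) f0 r) s" for s
    unfolding assms(5) by (rule I_jk_eq_EK[OF assms(2-4)])
  ultimately show ?thesis using conv(2) by blast
qed

end
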